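(* Let $\mathbb K$ be a restrained definably complete expansion of an ordered field, and let $f:\mathbb K^n\to\mathbb K^m$ be definable. (1) If $f$ is continuous and $p\in\mathbb N$, then there exists a definable nowhere dense set $D\subset\mathbb K^n$ such that $f$ is $\mathcal C^p$ outside $D$. (2) If $f$ is $\mathcal C^1$, then the set $\Sigma_f$ of singular values of $f$ is nowhere dense.
   Context: "Definable" means definable in $\mathbb K$ with parameters; $\mathbb K$ carries the order topology and $\mathbb K^n$ the product topology; derivatives and $\mathcal C^p$ are defined by the usual $\varepsilon$–$\delta$ definitions inside $\mathbb K$. $\mathbb K$ is definably complete if every definable subset of $\mathbb K$ has a least upper bound in $\mathbb K\cup\{\pm\infty\}$; it is restrained if moreover for every definable discrete $D\subseteq\mathbb K^k$ and every definable $g:D\to\mathbb K$, $g(D)$ is nowhere dense in $\mathbb K$. A singular value of a $\mathcal C^1$ map $f$ is a point $f(x)$ where the differential of $f$ at $x$ has rank less than $m$. *)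

theory Defs
  imports
    "HOL-Analysis.Function_Topology"
    "HOL-Library.Extended"
    "Jordan_Normal_Form.DL_Rank"
begin

section \<open>First-order expansions of an ordered field and their definable sets\<close>

text \<open>
  The language of ordered rings is built into the syntax. The types \<open>'f\<close> and \<open>'r\<close> consist of
  additional function and relation symbols. A symbol carries no arity: applied to argument lists
  of different lengths it plays the role of different symbols.
\<close>

datatype 'f fo_term =
    TVar nat
  | TZero
  | TOne
  | TNeg "'f fo_term"
  | TAdd "'f fo_term" "'f fo_term"
  | TMul "'f fo_term" "'f fo_term"
  | TFun 'f "'f fo_term list"

datatype ('f, 'r) fo_formula =
    FEq "'f fo_term" "'f fo_term"
  | FLess "'f fo_term" "'f fo_term"
  | FRel 'r "'f fo_term list"
  | FNot "('f, 'r) fo_formula"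
  | FAnd "('f, 'r) fo_formula" "('f, 'r) fo_formula"
  | FEx nat "('f, 'r) fo_formula"

text \<open>
  The underlying ordered field is the type \<open>'a\<close> itself, so an expansion only has to interpret the
  additional symbols.
\<close>

record ('f, 'r, 'a) expansion =
  fun_interp :: "'f \<Rightarrow> 'a list \<Rightarrow> 'a"
  rel_interp :: "'r \<Rightarrow> 'a list \<Rightarrow> bool"

primrec eval_term ::
  "('f, 'r, 'a::linordered_field) expansion \<Rightarrow> (nat \<Rightarrow> 'a) \<Rightarrow> 'f fo_term \<Rightarrow> 'a" where
  "eval_term M e (TVar i) = e i"
| "eval_term M e TZero = 0"
| "eval_term M e TOne = 1"
| "eval_term M e (TNeg t) = - eval_term M e t"
| "eval_term M e (TAdd s t) = eval_term M e s + eval_term M e t"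
| "eval_term M e (TMul s t) = eval_term M e s * eval_term M e t"
| "eval_term M e (TFun g ts) = fun_interp M g (map (eval_term M e) ts)"

primrec sat ::
  "('f, 'r, 'a::linordered_field) expansion \<Rightarrow> (nat \<Rightarrow> 'a) \<Rightarrow> ('f, 'r) fo_formula \<Rightarrow> bool" where
  "sat M e (FEq s t) \<longleftrightarrow> eval_term M e s = eval_term M e t"
| "sat M e (FLess s t) \<longleftrightarrow> eval_term M e s < eval_term M e t"
| "sat M e (FRel r ts) \<longleftrightarrow> rel_interp M r (map (eval_term M e) ts)"
| "sat M e (FNot \<phi>) \<longleftrightarrow> \<not> sat M e \<phi>"
| "sat M e (FAnd \<phi> \<psi>) \<longleftrightarrow> sat M e \<phi> \<and> sat M e \<psi>"
| "sat M e (FEx i \<phi>) \<longleftrightarrow> (\<exists>a. sat M (e(i := a)) \<phi>)"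

text \<open>
  Definability with parameters: the variables with index below \<open>n\<close> range over the point of
  \<open>K\<^sup>n\<close>, all other free variables (finitely many in each formula) take the parameters \<open>b\<close>.
\<close>

definition definable ::
  "('f, 'r, 'a::linordered_field) expansion \<Rightarrow> nat \<Rightarrow> 'a vec set \<Rightarrow> bool" where
  "definable M n S \<longleftrightarrow>
     (\<exists>\<phi> b. S = {x \<in> carrier_vec n. sat M (\<lambda>i. if i < n then x $ i else b i) \<phi>})"

definition point_vec :: "'a \<Rightarrow> 'a vec" where
  "point_vec a = vec 1 (\<lambda>_. a)"

text \<open>Subsets of \<open>K\<close> are identified with subsets of \<open>K\<^sup>1\<close> along \<open>point_vec\<close>.\<close>

definition definable_in_field ::
  "('f, 'r, 'a::linordered_field) expansion \<Rightarrow> 'a set \<Rightarrow> bool" where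
  "definable_in_field M X \<longleftrightarrow> definable M 1 (point_vec ` X)"

definition definable_map ::
  "('f, 'r, 'a::linordered_field) expansion \<Rightarrow> nat \<Rightarrow> nat \<Rightarrow> 'a vec set \<Rightarrow> ('a vec \<Rightarrow> 'a vec) \<Rightarrow> bool"
  where
  "definable_map M n m D f \<longleftrightarrow>
     D \<subseteq> carrier_vec n \<and> f ` D \<subseteq> carrier_vec m \<and> definable M (n + m) ((\<lambda>x. x @\<^sub>v f x) ` D)"

section \<open>Topology\<close>

text \<open>
  The product topology on \<open>K\<^sup>n\<close>, transported from the function space \<open>{..<n} \<rightarrow>\<^sub>E UNIV\<close> to
  \<open>carrier_vec n\<close>. The class \<open>linorder_topology\<close> makes \<open>euclidean\<close> the order topology on \<open>'a\<close>.
\<close>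

definition vec_topology :: "nat \<Rightarrow> 'a::linorder_topology vec topology" where
  "vec_topology n =
     pullback_topology (carrier_vec n) (\<lambda>x. \<lambda>i\<in>{..<n}. x $ i)
       (product_topology (\<lambda>_. euclidean) {..<n})"

definition nowhere_dense_in :: "'b topology \<Rightarrow> 'b set \<Rightarrow> bool" where
  "nowhere_dense_in X S \<longleftrightarrow> S \<subseteq> topspace X \<and> X interior_of (X closure_of S) = {}"

definition discrete_in :: "'b topology \<Rightarrow> 'b set \<Rightarrow> bool" where
  "discrete_in X S \<longleftrightarrow> S \<subseteq> topspace X \<and> subtopology X S = discrete_topology S"

section \<open>Definable completeness and restrained structures\<close>

definition definably_complete :: "('f, 'r, 'a::linordered_field) expansion \<Rightarrow> bool" where
  "definably_complete M \<longleftrightarrow>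
     (\<forall>X. definable_in_field M X \<longrightarrow>
        (\<exists>s::'a extended. (\<forall>x\<in>X. Fin x \<le> s) \<and> (\<forall>t. (\<forall>x\<in>X. Fin x \<le> t) \<longrightarrow> s \<le> t)))"

definition restrained ::
  "('f, 'r, 'a::{linordered_field, linorder_topology}) expansion \<Rightarrow> bool" where
  "restrained M \<longleftrightarrow> definably_complete M \<and>
     (\<forall>k D (g :: 'a vec \<Rightarrow> 'a).
        definable M k D \<and> discrete_in (vec_topology k) D \<and>
        definable_map M k 1 D (\<lambda>x. point_vec (g x)) \<longrightarrow>
        nowhere_dense_in euclidean (g ` D))"

section \<open>Differential calculus\<close>

text \<open>The maximum norm on \<open>K\<^sup>n\<close>; \<open>0\<close> is inserted for the case \<open>n = 0\<close>.\<close>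

definition max_norm :: "'a::linordered_field vec \<Rightarrow> 'a" where
  "max_norm x = Max (insert 0 ((\<lambda>i. \<bar>x $ i\<bar>) ` {..<dim_vec x}))"

text \<open>The differential of \<open>f : K\<^sup>n \<rightarrow> K\<^sup>m\<close> at \<open>x\<close> is given by the \<open>m \<times> n\<close> matrix \<open>A\<close>.\<close>

definition has_differential ::
  "nat \<Rightarrow> nat \<Rightarrow> ('a::linordered_field vec \<Rightarrow> 'a vec) \<Rightarrow> 'a vec \<Rightarrow> 'a mat \<Rightarrow> bool" where
  "has_differential n m f x A \<longleftrightarrow> A \<in> carrier_mat m n \<and>
     (\<forall>\<epsilon>>0. \<exists>\<delta>>0. \<forall>y\<in>carrier_vec n. max_norm (y - x) < \<delta> \<longrightarrow>
        max_norm (f y - f x - A *\<^sub>v (y - x)) \<le> \<epsilon> * max_norm (y - x))"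

text \<open>
  \<open>Cp_on p n m U f\<close> is meant for open \<open>U\<close>. The columns of the differential are the partial
  derivatives of \<open>f\<close>, so the recursion says that the differential is of class \<open>p\<close>.
\<close>

primrec Cp_on ::
  "nat \<Rightarrow> nat \<Rightarrow> nat \<Rightarrow> 'a::{linordered_field, linorder_topology} vec set \<Rightarrow>
   ('a vec \<Rightarrow> 'a vec) \<Rightarrow> bool" where
  "Cp_on 0 n m U f \<longleftrightarrow> continuous_map (subtopology (vec_topology n) U) (vec_topology m) f"
| "Cp_on (Suc p) n m U f \<longleftrightarrow>
     (\<exists>J. (\<forall>x\<in>U. has_differential n m f x (J x)) \<and>
          (\<forall>j<n. Cp_on p n m U (\<lambda>x. col (J x) j)))"

text \<open>
  The complement of a nowhere dense set need not be open; being \<open>C\<^sup>p\<close> there means being \<open>C\<^sup>p\<close>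
  on an open set containing it.
\<close>

definition Cp_outside ::
  "nat \<Rightarrow> nat \<Rightarrow> nat \<Rightarrow> 'a::{linordered_field, linorder_topology} vec set \<Rightarrow>
   ('a vec \<Rightarrow> 'a vec) \<Rightarrow> bool" where
  "Cp_outside p n m D f \<longleftrightarrow>
     (\<exists>U. openin (vec_topology n) U \<and> carrier_vec n - D \<subseteq> U \<and> Cp_on p n m U f)"

definition singular_values ::
  "nat \<Rightarrow> nat \<Rightarrow> ('a::linordered_field vec \<Rightarrow> 'a vec) \<Rightarrow> 'a vec set" where
  "singular_values n m f =
     {f x | x. x \<in> carrier_vec n \<and> (\<exists>A. has_differential n m f x A \<and> vec_space.rank m A < m)}"

end

theory Submission
  imports Defs
begin

text \<open>
  Write \<open>K\<close> for the field. The basic tool is a substitute for the Baire category theorem: a union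
  of a definable increasing family \<open>(A\<^sub>t)\<^bsub>t > 0\<^esub>\<close> of nowhere dense subsets of
  \<open>K\<^sup>n\<close> is nowhere dense. For \<open>n = 1\<close> and closed \<open>A\<^sub>t\<close> there
  are two cases. If \<open>K\<close> has an unbounded definable subset \<open>N\<close> without accumulation
  points, the left endpoints of the gaps of the \<open>A\<^sub>t\<close> with \<open>t \<in> N\<close> are the
  image of the definable discrete set of pairs of \<open>t\<close> and the midpoint of a gap of
  \<open>A\<^sub>t\<close>; this image is nowhere dense because \<open>K\<close> is restrained. Otherwise closed
  nowhere dense definable sets have no accumulation points, and the bounded part of the union is exhausted at
  some \<open>t\<close>. The general case follows by induction on \<open>n\<close> as in the Kuratowski-Ulam
  theorem.

  For (1), let \<open>\<phi>\<close> be continuous on a cube. For a given coordinate direction and a given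
  \<open>q\<close>, either the slopes of \<open>\<phi>\<close> are at most \<open>q\<close> on some subcube or
  they are at least \<open>q\<close> on some subcube, and in the second case this can be had for all \<open>q >
  0\<close> at once if the first case occurs for none of them. The latter is absurd, so the slopes are bounded
  on some subcube. With \<open>q\<close> slightly below the infimum of the upper bounds on subcubes, their
  oscillation becomes small. Applying the union theorem to the oscillation gives a dense open set on which
  \<open>\<phi>\<close> is continuously differentiable, and one iterates.

  For (2), normalize a covector \<open>v\<close> with \<open>v J(x) = 0\<close> so that one of its coordinates
  is \<open>1\<close>. The values \<open>y = f(x)\<close> with \<open>x\<close> and \<open>v\<close> bounded by
  \<open>t\<close> form a closed set, so if it is dense somewhere it contains a cube. On a subcube,
  \<open>x\<close> and \<open>v\<close> can be chosen as continuous definable functions of \<open>y\<close>, and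
  \<open>x\<close> even locally Lipschitz at some point in every coordinate direction. Then \<open>f(x(y)) =
  y\<close> contradicts \<open>v J(x) = 0\<close> in the direction of the coordinate of \<open>v\<close> that is
  \<open>1\<close>.
\<close>

section \<open>Definable predicates and terms\<close>

text \<open>\<open>K\<close> need not be archimedean, and countable constructions leave the
  definable world. Limiting processes are therefore indexed by the elements \<open>t > 0\<close> of
  \<open>K\<close> itself, with \<open>1 / t\<close> in the role of \<open>1 / n\<close>, and
  suprema of definable sets take the place of compactness. Every auxiliary set has to be definable,
  uniformly in its index, before a supremum or the union theorem may be applied. This is why the
  topology is rewritten with cubes, over whose centres and radii a first-order formula can quantify,
  and why definability is proved by rules that follow the syntax. Derivatives are taken in a strict
  form, with moving base point: this yields existence and continuity of the partial derivatives at
  once, and differentiability without a mean value theorem. Sard's theorem classically asks for a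
  smoothness that grows with the dimension; here \<open>C^1\<close> suffices, because a cube of
  singular values would carry a continuous definable section of \<open>f\<close>, which is Lipschitz
  somewhere. The covector is selected together with the point because this makes singularity a
  closed condition, and closed definable sets have closed projections as long as the witnesses are
  bounded.\<close>

primrec ren_term :: "(nat \<Rightarrow> nat) \<Rightarrow> 'f fo_term \<Rightarrow> 'f fo_term" where
  "ren_term r (TVar i) = TVar (r i)"
| "ren_term r TZero = TZero"
| "ren_term r TOne = TOne"
| "ren_term r (TNeg t) = TNeg (ren_term r t)"
| "ren_term r (TAdd s t) = TAdd (ren_term r s) (ren_term r t)"
| "ren_term r (TMul s t) = TMul (ren_term r s) (ren_term r t)"
| "ren_term r (TFun g ts) = TFun g (map (ren_term r) ts)"

lemma eval_ren_term: "eval_term M e (ren_term r t) = eval_term M (\<lambda>j. e (r j)) t"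
proof (induction t)
  case (TFun g ts)
  then show ?case by (auto intro!: arg_cong[where f = "fun_interp M g"])
qed auto

text \<open>Bound variables are replaced by the fresh variables \<open>c k, c (k + 1), \<dots>\<close>, so that the renaming
  \<open>r\<close> of the free variables need not be injective.\<close>

primrec ren_formula ::
  "('f, 'r) fo_formula \<Rightarrow> (nat \<Rightarrow> nat) \<Rightarrow> (nat \<Rightarrow> nat) \<Rightarrow> nat \<Rightarrow> ('f, 'r) fo_formula" where
  "ren_formula (FEq s t) c r k = FEq (ren_term r s) (ren_term r t)"
| "ren_formula (FLess s t) c r k = FLess (ren_term r s) (ren_term r t)"
| "ren_formula (FRel R ts) c r k = FRel R (map (ren_term r) ts)"
| "ren_formula (FNot \<phi>) c r k = FNot (ren_formula \<phi> c r k)"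
| "ren_formula (FAnd \<phi> \<psi>) c r k = FAnd (ren_formula \<phi> c r k) (ren_formula \<psi> c r k)"
| "ren_formula (FEx i \<phi>) c r k = FEx (c k) (ren_formula \<phi> c (r(i := c k)) (Suc k))"

text \<open>The invariant is that \<open>r\<close> never hits a variable \<open>c l\<close> with
  \<open>l \<ge> k\<close>. Overwriting \<open>c k\<close> then leaves the renamed free variables
  alone, and injectivity of \<open>c\<close> restores the invariant for \<open>Suc k\<close> once
  \<open>c k\<close> has entered the range of \<open>r\<close>.\<close>

lemma sat_ren_formula:
  assumes "inj c" "\<And>j l. l \<ge> k \<Longrightarrow> r j \<noteq> c l"
  shows "sat M e (ren_formula \<phi> c r k) \<longleftrightarrow> sat M (\<lambda>j. e (r j)) \<phi>"
  using assms(2)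
proof (induction \<phi> arbitrary: r k e)
  case (FEx i \<phi>)
  have 1: "(r(i := c k)) j \<noteq> c l" if "l \<ge> Suc k" for j l
    using FEx.prems[of l j] that injD[OF assms(1), of k l] by auto
  have 2: "(\<lambda>j. (e(c k := a)) ((r(i := c k)) j)) = (\<lambda>j. e (r j))(i := a)" for a
    using FEx.prems[of k] by (auto simp: fun_eq_iff)
  have "sat M (e(c k := a)) (ren_formula \<phi> c (r(i := c k)) (Suc k)) \<longleftrightarrow>
      sat M ((\<lambda>j. e (r j))(i := a)) \<phi>" for a
    using FEx.IH[of "Suc k" "r(i := c k)" "e(c k := a)"] 1 2 by metis
  then show ?case by simp
qed (auto simp: eval_ren_term comp_def)

lemma ex_renamed_formula:
  fixes c r :: "nat \<Rightarrow> nat"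
  assumes "inj c" "\<And>j l. r j \<noteq> c l"
  obtains \<psi> where "\<And>e. sat M e \<psi> \<longleftrightarrow> sat M (\<lambda>j. e (r j)) \<phi>"
  using sat_ren_formula[OF assms(1), of 0 r] assms(2) by blast

text \<open>A semantic stand-in for "all free variables are below \<open>N\<close>". Since every
  formula has such a bound, substitution for all variables at once reduces to substitution for
  finitely many.\<close>

definition depends_below :: "nat \<Rightarrow> ((nat \<Rightarrow> 'a) \<Rightarrow> 'b) \<Rightarrow> bool" where
  "depends_below N F \<longleftrightarrow> (\<forall>e e'. (\<forall>i<N. e i = e' i) \<longrightarrow> F e = F e')"

lemma depends_belowD: "depends_below N F \<Longrightarrow> (\<And>i. i < N \<Longrightarrow> e i = e' i) \<Longrightarrow> F e = F e'"
  unfolding depends_below_def by blast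

lemma depends_belowI: "(\<And>e e'. (\<And>i. i < N \<Longrightarrow> e i = e' i) \<Longrightarrow> F e = F e') \<Longrightarrow> depends_below N F"
  unfolding depends_below_def by blast

lemma depends_below_comp: "depends_below N F \<Longrightarrow> depends_below N (\<lambda>e. G (F e))"
  by (rule depends_belowI, rule arg_cong[where f = G], erule depends_belowD) simp

lemma depends_below_comp2:
  assumes "\<exists>N. depends_below N F" "\<exists>N. depends_below N G"
  shows "\<exists>N. depends_below N (\<lambda>e. H (F e) (G e))"
proof -
  obtain N1 N2 where N: "depends_below N1 F" "depends_below N2 G" using assms by blast
  have "depends_below (max N1 N2) (\<lambda>e. H (F e) (G e))"
  proof (rule depends_belowI)
    fix e e' :: "nat \<Rightarrow> 'a" assume e: "\<And>i. i < max N1 N2 \<Longrightarrow> e i = e' i"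
    have "F e = F e'" by (rule depends_belowD[OF N(1)]) (simp add: e)
    moreover have "G e = G e'" by (rule depends_belowD[OF N(2)]) (simp add: e)
    ultimately show "H (F e) (G e) = H (F e') (G e')" by (rule arg_cong2)
  qed
  then show ?thesis ..
qed

lemma depends_below_map:
  assumes "\<And>t. t \<in> set ts \<Longrightarrow> \<exists>N. depends_below N (\<lambda>e. F e t)"
  shows "\<exists>N. depends_below N (\<lambda>e. map (F e) ts)"
  using assms
proof (induction ts)
  case Nil
  have "depends_below 0 (\<lambda>e. map (F e) [])" by (rule depends_belowI) simp
  then show ?case ..
next
  case (Cons t ts)
  have "\<exists>N. depends_below N (\<lambda>e. F e t # map (F e) ts)"
    using Cons by (intro depends_below_comp2[where H = "(#)"]) simp_all
  then show ?case by simp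
qed

lemma eval_term_finite_dep:
  fixes M :: "('f, 'r, 'a::linordered_field) expansion"
  shows "\<exists>N. depends_below N (\<lambda>e. eval_term M e t)"
proof (induction t)
  case (TVar i)
  have "depends_below (Suc i) (\<lambda>e. eval_term M e (TVar i))" by (rule depends_belowI) simp
  then show ?case ..
next
  case (TNeg t)
  then obtain N where "depends_below N (\<lambda>e. eval_term M e t)" ..
  from depends_below_comp[OF this, of uminus] show ?case by auto
next
  case (TAdd s t)
  then show ?case using depends_below_comp2[where H = "(+)"] by simp
next
  case (TMul s t)
  then show ?case using depends_below_comp2[where H = "(*)"] by simp
next
  case (TFun g ts)
  then obtain N where "depends_below N (\<lambda>e. map (eval_term M e) ts)"
    using depends_below_map[of ts "eval_term M"] by auto
  from depends_below_comp[OF this, of "fun_interp M g"] show ?case by auto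
qed (auto intro!: exI[of _ 0] depends_belowI)

lemma sat_finite_dep:
  fixes M :: "('f, 'r, 'a::linordered_field) expansion"
  shows "\<exists>N. depends_below N (\<lambda>e. sat M e \<phi>)"
proof (induction \<phi>)
  case (FEq s t)
  show ?case
    using depends_below_comp2[where H = "(=)", OF eval_term_finite_dep eval_term_finite_dep] by simp
next
  case (FLess s t)
  show ?case
    using depends_below_comp2[where H = "(<)", OF eval_term_finite_dep eval_term_finite_dep] by simp
next
  case (FRel R ts)
  obtain N where "depends_below N (\<lambda>e. map (eval_term M e) ts)"
    using depends_below_map[of ts "eval_term M"] eval_term_finite_dep by auto
  from depends_below_comp[OF this, of "rel_interp M R"] show ?case by auto
next
  case (FNot \<phi>)
  then obtain N where "depends_below N (\<lambda>e. sat M e \<phi>)" ..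
  from depends_below_comp[OF this, of Not] show ?case by auto
next
  case (FAnd \<phi> \<psi>)
  then show ?case using depends_below_comp2[where H = "(\<and>)"] by simp
next
  case (FEx i \<phi>)
  then obtain N where N: "depends_below N (\<lambda>e. sat M e \<phi>)" ..
  have "depends_below N (\<lambda>e. sat M e (FEx i \<phi>))"
  proof (rule depends_belowI)
    fix e e' :: "nat \<Rightarrow> 'a" assume "\<And>j. j < N \<Longrightarrow> e j = e' j"
    then have "sat M (e(i := a)) \<phi> = sat M (e'(i := a)) \<phi>" for a
      by (intro depends_belowD[OF N]) simp
    then show "sat M e (FEx i \<phi>) = sat M e' (FEx i \<phi>)" by (simp only: sat.simps)
  qed
  then show ?case ..
qed

text \<open>The odd variables hold the parameters.\<close>

definition def_pred :: "('f, 'r, 'a::linordered_field) expansion \<Rightarrow> ((nat \<Rightarrow> 'a) \<Rightarrow> bool) \<Rightarrow> bool" where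
  "def_pred M P \<longleftrightarrow>
     (\<exists>\<phi> b. \<forall>e. P e \<longleftrightarrow> sat M (\<lambda>i. if even i then e (i div 2) else b (i div 2)) \<phi>)"

lemma def_predI:
  assumes "\<And>e. P e \<longleftrightarrow> sat M (\<lambda>i. if even i then e (i div 2) else b (i div 2)) \<phi>"
  shows "def_pred M P"
  unfolding def_pred_def by (intro exI[of _ \<phi>] exI[of _ b] allI assms)

lemma def_predE:
  assumes "def_pred M P"
  obtains \<phi> b where "\<And>e. P e \<longleftrightarrow> sat M (\<lambda>i. if even i then e (i div 2) else b (i div 2)) \<phi>"
proof -
  obtain \<phi> b where "\<forall>e. P e \<longleftrightarrow> sat M (\<lambda>i. if even i then e (i div 2) else b (i div 2)) \<phi>"
    using assms unfolding def_pred_def by (elim exE)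
  then have "P e \<longleftrightarrow> sat M (\<lambda>i. if even i then e (i div 2) else b (i div 2)) \<phi>" for e
    by (rule spec)
  then show ?thesis by (rule that)
qed

text \<open>"Term" is meant semantically: any function of the assignment with a definable graph
  counts. Quotients, absolute values, partial derivatives and least elements can therefore stand
  wherever a variable can.\<close>

definition def_term :: "('f, 'r, 'a::linordered_field) expansion \<Rightarrow> ((nat \<Rightarrow> 'a) \<Rightarrow> 'a) \<Rightarrow> bool" where
  "def_term M t \<longleftrightarrow> def_pred M (\<lambda>e. e 0 = t (\<lambda>i. e (Suc i)))"

definition def_vec :: "('f, 'r, 'a::linordered_field) expansion \<Rightarrow> nat \<Rightarrow> ((nat \<Rightarrow> 'a) \<Rightarrow> 'a vec) \<Rightarrow> bool" where
  "def_vec M n v \<longleftrightarrow> (\<forall>e. v e \<in> carrier_vec n) \<and> (\<forall>i<n. def_term M (\<lambda>e. v e $ i))"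

lemma def_pred_finite_dep:
  fixes M :: "('f, 'r, 'a::linordered_field) expansion"
  assumes "def_pred M P"
  shows "\<exists>N. depends_below N P"
proof -
  obtain \<phi> b where P: "\<And>e. P e \<longleftrightarrow> sat M (\<lambda>i. if even i then e (i div 2) else b (i div 2)) \<phi>"
    using assms by (rule def_predE) (rule that)
  obtain N where N: "depends_below N (\<lambda>e. sat M e \<phi>)"
    using sat_finite_dep[of M \<phi>] ..
  have "depends_below N P"
  proof (rule depends_belowI)
    fix e e' :: "nat \<Rightarrow> 'a" assume e: "\<And>j. j < N \<Longrightarrow> e j = e' j"
    have "e (i div 2) = e' (i div 2)" if "i < N" for i by (rule e) (use that in linarith)
    then show "P e = P e'" unfolding P by (intro depends_belowD[OF N]) simp
  qed
  then show ?thesis ..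
qed

section \<open>Closure of definable predicates under connectives, renaming, quantifiers and
  substitution\<close>

lemma def_pred_not:
  assumes "def_pred M P" shows "def_pred M (\<lambda>e. \<not> P e)"
proof -
  obtain \<phi> b where "\<And>e. P e \<longleftrightarrow> sat M (\<lambda>i. if even i then e (i div 2) else b (i div 2)) \<phi>"
    using assms by (rule def_predE) (rule that)
  then show ?thesis by (intro def_predI[of _ M b "FNot \<phi>"]) simp
qed

lemma def_pred_reindex:
  assumes "def_pred M P" shows "def_pred M (\<lambda>e. P (\<lambda>i. e (r i)))"
proof -
  obtain \<phi> b where P: "\<And>e. P e \<longleftrightarrow> sat M (\<lambda>i. if even i then e (i div 2) else b (i div 2)) \<phi>"
    using assms by (rule def_predE) (rule that)
  \<comment> \<open>Residues keep three kinds of variables apart: even numbers for the arguments,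
    \<open>1\<close> modulo \<open>4\<close> for the parameters, \<open>3\<close> modulo
    \<open>4\<close> for the renamed bound variables.\<close>
  define r' where "r' i = (if even i then 2 * r (i div 2) else 4 * (i div 2) + 1)" for i
  have "r' j \<noteq> 4 * l + 3" for j l by (cases "even j") (simp_all add: r'_def, presburger+)
  moreover have "inj (\<lambda>k::nat. 4 * k + 3)" by (auto simp: inj_def)
  ultimately obtain \<psi> where psi: "\<And>e. sat M e \<psi> \<longleftrightarrow> sat M (\<lambda>j. e (r' j)) \<phi>"
    using ex_renamed_formula[of "\<lambda>k. 4 * k + 3" r' M \<phi>] by metis
  have "P (\<lambda>i. e (r i)) \<longleftrightarrow> sat M (\<lambda>i. if even i then e (i div 2) else b (i div 2 div 2)) \<psi>" for e
  proof -
    have "(4 * q + 1) div 2 div 2 = q" for q :: nat by presburger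
    then have "(\<lambda>i. if even i then e (r (i div 2)) else b (i div 2)) =
        (\<lambda>j. if even (r' j) then e (r' j div 2) else b (r' j div 2 div 2))"
      unfolding r'_def by (intro ext) (simp del: div_mult_self1 Suc_eq_plus1 Suc_eq_plus1_left add_Suc_right)
    then show ?thesis unfolding psi P by (simp only:)
  qed
  then show ?thesis by (rule def_predI[of _ M "\<lambda>i. b (i div 2)" \<psi>])
qed

lemma def_pred_conj:
  assumes "def_pred M P" "def_pred M Q" shows "def_pred M (\<lambda>e. P e \<and> Q e)"
proof -
  obtain \<phi> b where P: "\<And>e. P e \<longleftrightarrow> sat M (\<lambda>i. if even i then e (i div 2) else b (i div 2)) \<phi>"
    using assms(1) by (rule def_predE) (rule that)
  obtain \<psi> b' where Q: "\<And>e. Q e \<longleftrightarrow> sat M (\<lambda>i. if even i then e (i div 2) else b' (i div 2)) \<psi>"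
    using assms(2) by (rule def_predE) (rule that)
  \<comment> \<open>The parameters of \<open>\<phi>\<close> go to the residue \<open>1\<close> and
    those of \<open>\<psi>\<close> to the residue \<open>5\<close> modulo \<open>8\<close>, so that
    the single assignment \<open>bb\<close> can hold both; the residue \<open>3\<close> modulo
    \<open>4\<close> stays free for bound variables.\<close>
  define r where "r i = (if even i then i else 8 * (i div 2) + 1)" for i :: nat
  define r' where "r' i = (if even i then i else 8 * (i div 2) + 5)" for i :: nat
  have "r j \<noteq> 4 * l + 3" for j l by (cases "even j") (simp_all add: r_def, presburger+)
  moreover have "r' j \<noteq> 4 * l + 3" for j l by (cases "even j") (simp_all add: r'_def, presburger+)
  moreover have "inj (\<lambda>k::nat. 4 * k + 3)" by (auto simp: inj_def)
  ultimately obtain \<phi>' \<psi>' where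
    phi': "\<And>e. sat M e \<phi>' \<longleftrightarrow> sat M (\<lambda>j. e (r j)) \<phi>" and
    psi': "\<And>e. sat M e \<psi>' \<longleftrightarrow> sat M (\<lambda>j. e (r' j)) \<psi>"
    using ex_renamed_formula[of "\<lambda>k. 4 * k + 3" r M \<phi>] ex_renamed_formula[of "\<lambda>k. 4 * k + 3" r' M \<psi>]
    by metis
  define bb where "bb i = (if i mod 4 = 0 then b (i div 4) else b' (i div 4))" for i
  let ?E = "\<lambda>e i. if even i then e (i div 2) else bb (i div 2)"
  have e1: "(8 * q + 1) div 2 = 4 * q" "(8 * q + 5) div 2 = 4 * q + 2" for q :: nat by auto
  have e2: "(4 * q + 2) mod 4 = 2" "(4 * q + 2) div 4 = q" for q :: nat by presburger+
  have "P e \<longleftrightarrow> sat M (?E e) \<phi>'" for e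
  proof -
    have "(\<lambda>i. if even i then e (i div 2) else b (i div 2)) = (\<lambda>j. ?E e (r j))"
      unfolding r_def by (rule ext) (simp add: e1 bb_def del: One_nat_def Suc_eq_plus1 add_Suc_right)
    then show ?thesis unfolding phi' P by (simp only:)
  qed
  moreover have "Q e \<longleftrightarrow> sat M (?E e) \<psi>'" for e
  proof -
    have "(\<lambda>i. if even i then e (i div 2) else b' (i div 2)) = (\<lambda>j. ?E e (r' j))"
      unfolding r'_def by (rule ext) (simp add: e1 e2 bb_def del: One_nat_def Suc_eq_plus1 add_Suc_right add_2_eq_Suc add_2_eq_Suc')
    then show ?thesis unfolding psi' Q by (simp only:)
  qed
  ultimately show ?thesis by (intro def_predI[of _ M bb "FAnd \<phi>' \<psi>'"]) simp
qed

text \<open>As with de Bruijn indices, slot \<open>0\<close> holds the quantified variable and all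
  others move up by one.\<close>

lemma def_pred_ex:
  fixes M :: "('f, 'r, 'a::linordered_field) expansion"
  assumes "def_pred M (\<lambda>e. Q (\<lambda>i. e (Suc i)) (e 0))"
  shows "def_pred M (\<lambda>e. \<exists>a. Q e a)"
proof -
  obtain \<phi> b where P: "\<And>e. Q (\<lambda>i. e (Suc i)) (e 0) \<longleftrightarrow>
      sat M (\<lambda>i. if even i then e (i div 2) else b (i div 2)) \<phi>"
    using assms by (rule def_predE) (rule that)
  let ?E = "\<lambda>e i. if even i then e (i div 2) else b (i div 2)"
  have "(\<exists>a. Q (\<lambda>i. e (Suc i)) a) \<longleftrightarrow> sat M (?E e) (FEx 0 \<phi>)" for e :: "nat \<Rightarrow> 'a"
  proof -
    have "Q (\<lambda>i. e (Suc i)) a \<longleftrightarrow> sat M ((?E e)(0 := a)) \<phi>" for a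
    proof -
      have "(?E e)(0 := a) = ?E (e(0 := a))" by (rule ext) auto
      moreover have "Q (\<lambda>i. e (Suc i)) a \<longleftrightarrow> sat M (?E (e(0 := a))) \<phi>"
        using P[of "e(0 := a)"] by simp
      ultimately show ?thesis by (simp only:)
    qed
    then show ?thesis by simp
  qed
  then have "def_pred M (\<lambda>e. \<exists>a. Q (\<lambda>i. e (Suc i)) a)" by (rule def_predI)
  \<comment> \<open>Reindexing by the predecessor undoes the shift, because
    \<open>Suc i - 1 = i\<close>.\<close>
  from def_pred_reindex[OF this, of "\<lambda>i. i - 1"] show ?thesis by simp
qed

lemma def_pred_const:
  fixes M :: "('f, 'r, 'a::linordered_field) expansion"
  shows "def_pred M (\<lambda>e. c)"
proof -
  have T: "def_pred M (\<lambda>e. True)" by (rule def_predI[of _ M "\<lambda>_. 0" "FEq TZero TZero"]) simp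
  show ?thesis using T def_pred_not[OF T] by (cases c) simp_all
qed

lemma def_term_reindex:
  assumes "def_term M t" shows "def_term M (\<lambda>e. t (\<lambda>i. e (r i)))"
  using def_pred_reindex[OF assms[unfolded def_term_def], of "case_nat 0 (\<lambda>i. Suc (r i))"]
  unfolding def_term_def by simp

text \<open>A \<open>def_term\<close> is known through its graph only, so a term is substituted by
  quantifying over a new variable that is required to equal it. The induction treats one variable at
  a time.\<close>

lemma def_pred_subst_first:
  fixes M :: "('f, 'r, 'a::linordered_field) expansion"
  assumes "\<And>i. def_term M (t i)" "def_pred M P"
  shows "def_pred M (\<lambda>e. P (\<lambda>i. if i < k then t i e else e (i - k)))"
  using assms
proof (induction k arbitrary: P t)
  case 0
  have "(\<lambda>i. if i < 0 then t i e else e (i - 0)) = e" for e by simp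
  then show ?case using 0(2) by (simp only:)
next
  case (Suc k)
  \<comment> \<open>\<open>Q\<close> moves variable \<open>0\<close> of \<open>P\<close> to slot
    \<open>k\<close>. The induction hypothesis then substitutes for the variables \<open>1\<close>
    to \<open>k\<close> of \<open>P\<close>, and variable \<open>0\<close> remains as the first free
    slot, ready for the quantifier.\<close>
  define Q where "Q e = P (case_nat (e k) (\<lambda>i. if i < k then e i else e (Suc i)))" for e
  define r where "r i = (case i of 0 \<Rightarrow> k | Suc i \<Rightarrow> if i < k then i else Suc i)" for i
  have "Q e = P (\<lambda>i. e (r i))" for e
    unfolding Q_def r_def by (rule arg_cong[where f = P], rule ext) (simp split: nat.split)
  then have "Q = (\<lambda>e. P (\<lambda>i. e (r i)))" by (rule ext)
  then have "def_pred M Q" using def_pred_reindex[OF Suc.prems(2), of r] by (simp only:)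
  then have *: "def_pred M (\<lambda>e. Q (\<lambda>i. if i < k then t (Suc i) (\<lambda>i. e (Suc i)) else e (i - k)))"
    by (intro Suc.IH[of "\<lambda>i e. t (Suc i) (\<lambda>i. e (Suc i))"] def_term_reindex[OF Suc.prems(1), of _ Suc])
  define R where "R e a = Q (\<lambda>i. if i < k then t (Suc i) e else if i = k then a else e (i - Suc k))" for e a
  have "def_pred M (\<lambda>e. \<exists>a. a = t 0 e \<and> R e a)"
  proof (rule def_pred_ex, rule def_pred_conj)
    show "def_pred M (\<lambda>e. e 0 = t 0 (\<lambda>i. e (Suc i)))"
      using Suc.prems(1)[of 0] by (simp only: def_term_def)
    have "(\<lambda>i. if i < k then t (Suc i) (\<lambda>i. e (Suc i)) else if i = k then e 0 else e (Suc (i - Suc k))) =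
       (\<lambda>i. if i < k then t (Suc i) (\<lambda>i. e (Suc i)) else e (i - k))" for e :: "nat \<Rightarrow> 'a"
      by (rule ext) (simp add: Suc_diff_Suc)
    then show "def_pred M (\<lambda>e. R (\<lambda>i. e (Suc i)) (e 0))"
      using * unfolding R_def by (simp only:)
  qed
  moreover have "(\<exists>a. a = t 0 e \<and> R e a) \<longleftrightarrow> R e (t 0 e)" for e by blast
  moreover have "R e (t 0 e) = P (\<lambda>i. if i < Suc k then t i e else e (i - Suc k))" for e
    unfolding R_def Q_def by (rule arg_cong[where f = P], rule ext) (simp split: nat.split)
  ultimately show ?case by (simp only:)
qed

lemma def_pred_subst:
  fixes M :: "('f, 'r, 'a::linordered_field) expansion"
  assumes "def_pred M P" "\<And>i. def_term M (t i)"
  shows "def_pred M (\<lambda>e. P (\<lambda>i. t i e))"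
proof -
  obtain N where N: "depends_below N P"
    using def_pred_finite_dep[OF assms(1)] ..
  have "P (\<lambda>i. t i e) = P (\<lambda>i. if i < N then t i e else e (i - N))" for e
    by (intro depends_belowD[OF N]) auto
  then show ?thesis using def_pred_subst_first[of M t P N] assms by simp
qed

lemma def_term_subst:
  assumes "def_term M s" "\<And>i. def_term M (t i)"
  shows "def_term M (\<lambda>e. s (\<lambda>i. t i e))"
proof -
  let ?t = "\<lambda>i e. case i of 0 \<Rightarrow> e 0 | Suc i \<Rightarrow> t i (\<lambda>i. e (Suc i))"
  have v: "def_term M (\<lambda>e. e 0)"
    unfolding def_term_def by (rule def_predI[of _ M "\<lambda>_. 0" "FEq (TVar 0) (TVar 2)"]) simp
  have "def_term M (?t i)" for i
    using v def_term_reindex[OF assms(2), of _ Suc] by (cases i) auto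
  from def_pred_subst[OF assms(1)[unfolded def_term_def], of ?t, OF this] show ?thesis
    unfolding def_term_def by simp
qed

section \<open>Definable arithmetic, order and finite conjunctions\<close>

lemma def_term_var: "def_term M (\<lambda>e. e i)"
  unfolding def_term_def by (rule def_predI[of _ M "\<lambda>_. 0" "FEq (TVar 0) (TVar (2 * Suc i))"]) simp

lemma def_term_const: "def_term M (\<lambda>e. c)"
  unfolding def_term_def by (rule def_predI[of _ M "\<lambda>_. c" "FEq (TVar 0) (TVar 1)"]) simp

lemma def_term_binop:
  assumes "def_pred M (\<lambda>e. e 0 = F (e 1) (e 2))" "def_term M s" "def_term M t"
  shows "def_term M (\<lambda>e. F (s e) (t e))"
proof -
  have "def_term M (\<lambda>e. F (e 0) (e 1))"
    using assms(1) unfolding def_term_def by (simp add: numeral_2_eq_2)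
  from def_term_subst[OF this, of "case_nat s (\<lambda>_. t)"] show ?thesis
    using assms(2,3) by (simp split: nat.split)
qed

lemma def_term_add:
  assumes "def_term M s" "def_term M t" shows "def_term M (\<lambda>e. s e + t e)"
  by (rule def_term_binop[where F = "(+)", OF _ assms], rule def_predI[of _ M "\<lambda>_. 0" "FEq (TVar 0) (TAdd (TVar 2) (TVar 4))"]) simp

lemma def_term_mult:
  assumes "def_term M s" "def_term M t" shows "def_term M (\<lambda>e. s e * t e)"
  by (rule def_term_binop[where F = "(*)", OF _ assms], rule def_predI[of _ M "\<lambda>_. 0" "FEq (TVar 0) (TMul (TVar 2) (TVar 4))"]) simp

lemma def_term_uminus:
  assumes "def_term M s" shows "def_term M (\<lambda>e. - s e)"
  using def_term_mult[OF def_term_const[of M "-1"] assms] by simp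

lemma def_term_diff:
  assumes "def_term M s" "def_term M t" shows "def_term M (\<lambda>e. s e - t e)"
  using def_term_add[OF assms(1) def_term_uminus[OF assms(2)]] by simp

lemma def_pred_binrel:
  assumes "def_pred M (\<lambda>e. R (e 0) (e 1))" "def_term M s" "def_term M t"
  shows "def_pred M (\<lambda>e. R (s e) (t e))"
  using def_pred_subst[OF assms(1), of "case_nat s (\<lambda>_. t)"] assms(2,3) by (simp split: nat.split)

lemma def_pred_eq:
  assumes "def_term M s" "def_term M t" shows "def_pred M (\<lambda>e. s e = t e)"
  by (rule def_pred_binrel[where R = "(=)", OF _ assms], rule def_predI[of _ M "\<lambda>_. 0" "FEq (TVar 0) (TVar 2)"]) simp

lemma def_pred_less:
  assumes "def_term M s" "def_term M t" shows "def_pred M (\<lambda>e. s e < t e)"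
  by (rule def_pred_binrel[where R = "(<)", OF _ assms], rule def_predI[of _ M "\<lambda>_. 0" "FLess (TVar 0) (TVar 2)"]) simp

lemma def_pred_le:
  assumes "def_term M s" "def_term M t" shows "def_pred M (\<lambda>e. s e \<le> t e)"
  using def_pred_not[OF def_pred_less[OF assms(2,1)]] by (simp add: not_less)

lemma def_pred_disj:
  assumes "def_pred M P" "def_pred M Q" shows "def_pred M (\<lambda>e. P e \<or> Q e)"
  using def_pred_not[OF def_pred_conj[OF def_pred_not[OF assms(1)] def_pred_not[OF assms(2)]]] by simp

lemma def_pred_imp:
  assumes "def_pred M P" "def_pred M Q" shows "def_pred M (\<lambda>e. P e \<longrightarrow> Q e)"
  unfolding imp_conv_disj by (intro def_pred_disj def_pred_not assms)

lemma def_pred_iff: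
  assumes "def_pred M P" "def_pred M Q" shows "def_pred M (\<lambda>e. P e \<longleftrightarrow> Q e)"
  unfolding iff_conv_conj_imp by (intro def_pred_conj def_pred_imp assms)

lemma def_pred_all:
  assumes "def_pred M (\<lambda>e. Q (\<lambda>i. e (Suc i)) (e 0))"
  shows "def_pred M (\<lambda>e. \<forall>a. Q e a)"
  using def_pred_not[OF def_pred_ex[of M "\<lambda>e a. \<not> Q e a", OF def_pred_not[OF assms]]] by simp

lemma def_pred_all_less:
  fixes k :: nat
  assumes "\<And>i. i < k \<Longrightarrow> def_pred M (\<lambda>e. Q e i)"
  shows "def_pred M (\<lambda>e. \<forall>i<k. Q e i)"
  using assms
proof (induction k)
  case 0 then show ?case using def_pred_const[of M True] by simp
next
  case (Suc k)
  have "def_pred M (\<lambda>e. (\<forall>i<k. Q e i) \<and> Q e k)" by (intro def_pred_conj Suc) auto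
  moreover have "(\<forall>i<Suc k. Q e i) \<longleftrightarrow> (\<forall>i<k. Q e i) \<and> Q e k" for e
    by (auto simp: less_Suc_eq)
  ultimately show ?case by (simp only:)
qed

lemma def_pred_ex_less:
  fixes k :: nat
  assumes "\<And>i. i < k \<Longrightarrow> def_pred M (\<lambda>e. Q e i)"
  shows "def_pred M (\<lambda>e. \<exists>i<k. Q e i)"
  using def_pred_not[OF def_pred_all_less[of k M "\<lambda>e i. \<not> Q e i", OF def_pred_not[OF assms]]] by simp

section \<open>Quantifiers over vectors and vector-valued terms\<close>

lemma def_pred_ex_vec_aux:
  fixes M :: "('f, 'r, 'a::linordered_field) expansion"
  assumes "def_pred M P"
  shows "def_pred M (\<lambda>e. \<exists>x\<in>carrier_vec n. P (\<lambda>i. if i < n then x $ i else e (i - n)))"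
  using assms
proof (induction n arbitrary: P)
  case 0
  have "(\<exists>x\<in>carrier_vec 0. P (\<lambda>i. if i < 0 then x $ i else e (i - 0))) \<longleftrightarrow> P e" for e
  proof -
    show ?thesis by (auto intro!: exI[of _ "vec 0 (\<lambda>_. undefined)"])
  qed
  then show ?case using 0 by (simp only:)
next
  case (Suc n)
  have "def_pred M (\<lambda>e. \<exists>a. \<exists>x\<in>carrier_vec n. P (\<lambda>i. if i < n then x $ i else if i = n then a else e (i - Suc n)))"
  proof (rule def_pred_ex)
    have "(\<lambda>i. if i < n then x $ i else if i = n then e 0 else e (Suc (i - Suc n))) =
      (\<lambda>i. if i < n then x $ i else e (i - n))" for e :: "nat \<Rightarrow> 'a" and x
      by (auto simp: fun_eq_iff Suc_diff_Suc)
    then show "def_pred M (\<lambda>e. \<exists>x\<in>carrier_vec n. P (\<lambda>i. if i < n then x $ i else if i = n then e 0 else e (Suc (i - Suc n))))"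
      using Suc by simp
  qed
  moreover have "(\<exists>a. \<exists>x\<in>carrier_vec n. P (\<lambda>i. if i < n then x $ i else if i = n then a else e (i - Suc n))) \<longleftrightarrow>
    (\<exists>x\<in>carrier_vec (Suc n). P (\<lambda>i. if i < Suc n then x $ i else e (i - Suc n)))" (is "?l \<longleftrightarrow> ?r") for e
  proof
    assume ?l
    then obtain a x where x: "x \<in> carrier_vec n" "P (\<lambda>i. if i < n then x $ i else if i = n then a else e (i - Suc n))"
      by blast
    have "(\<lambda>i. if i < n then x $ i else if i = n then a else e (i - Suc n)) =
      (\<lambda>i. if i < Suc n then (vec (Suc n) (\<lambda>i. if i < n then x $ i else a)) $ i else e (i - Suc n))"
      by (auto simp: fun_eq_iff)
    then show ?r using x(2) by (intro bexI[of _ "vec (Suc n) (\<lambda>i. if i < n then x $ i else a)"]) auto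
  next
    assume ?r
    then obtain x where x: "x \<in> carrier_vec (Suc n)" "P (\<lambda>i. if i < Suc n then x $ i else e (i - Suc n))"
      by blast
    have "(\<lambda>i. if i < Suc n then x $ i else e (i - Suc n)) =
       (\<lambda>i. if i < n then vec n (\<lambda>i. x $ i) $ i else if i = n then x $ n else e (i - Suc n))"
      by (auto simp: fun_eq_iff)
    then show ?l using x(2) by (intro exI[of _ "x $ n"] bexI[of _ "vec n (\<lambda>i. x $ i)"]) auto
  qed
  ultimately show ?case by simp
qed

lemma def_pred_ex_vec:
  fixes M :: "('f, 'r, 'a::linordered_field) expansion"
  assumes "def_pred M (\<lambda>e. Q (\<lambda>i. e (i + n)) (vec n e))"
  shows "def_pred M (\<lambda>e. \<exists>x\<in>carrier_vec n. Q e x)"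
proof -
  have eq: "vec n (\<lambda>i. if i < n then x $ i else e (i - n)) = x" if "x \<in> carrier_vec n" for x and e :: "nat \<Rightarrow> 'a"
    using that by (intro eq_vecI) auto
  show ?thesis using def_pred_ex_vec_aux[OF assms, of n] by (simp add: eq cong: bex_cong)
qed

lemma def_pred_all_vec:
  fixes M :: "('f, 'r, 'a::linordered_field) expansion"
  assumes "def_pred M (\<lambda>e. Q (\<lambda>i. e (i + n)) (vec n e))"
  shows "def_pred M (\<lambda>e. \<forall>x\<in>carrier_vec n. Q e x)"
  using def_pred_not[OF def_pred_ex_vec[of M "\<lambda>e a. \<not> Q e a", OF def_pred_not[OF assms]]] by simp

lemma def_term_vec_nth:
  assumes "def_vec M n v" "i < n" shows "def_term M (\<lambda>e. v e $ i)"
  using assms by (simp add: def_vec_def)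

lemma def_vec_vec:
  assumes "\<And>i. i < n \<Longrightarrow> def_term M (\<lambda>e. t e i)"
  shows "def_vec M n (\<lambda>e. vec n (t e))"
  using assms unfolding def_vec_def by simp

lemma def_vec_const:
  assumes "x \<in> carrier_vec n" shows "def_vec M n (\<lambda>e. x)"
  using assms unfolding def_vec_def by (simp add: def_term_const)

lemma def_vec_carrier: "def_vec M n v \<Longrightarrow> v e \<in> carrier_vec n"
  by (simp add: def_vec_def)

lemma def_vec_vCons:
  fixes M :: "('f, 'r, 'a::linordered_field) expansion"
  assumes "def_term M t" "def_vec M n v"
  shows "def_vec M (Suc n) (\<lambda>e. vCons (t e) (v e))"
  unfolding def_vec_def
proof (intro conjI allI impI)
  fix e show "vCons (t e) (v e) \<in> carrier_vec (Suc n)" using def_vec_carrier[OF assms(2)] by auto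
next
  fix i assume "i < Suc n"
  then show "def_term M (\<lambda>e. vCons (t e) (v e) $ i)"
    using assms by (cases i) (auto simp: def_vec_def)
qed

lemma def_vec_append:
  fixes M :: "('f, 'r, 'a::linordered_field) expansion"
  assumes "def_vec M n v" "def_vec M m w"
  shows "def_vec M (n + m) (\<lambda>e. v e @\<^sub>v w e)"
  unfolding def_vec_def
proof (intro conjI allI impI)
  fix e show "v e @\<^sub>v w e \<in> carrier_vec (n + m)"
    using def_vec_carrier[OF assms(1)] def_vec_carrier[OF assms(2)] by auto
next
  fix i assume i: "i < n + m"
  have d: "dim_vec (v e) = n" "dim_vec (w e) = m" for e
    using def_vec_carrier[OF assms(1)] def_vec_carrier[OF assms(2)] by auto
  show "def_term M (\<lambda>e. (v e @\<^sub>v w e) $ i)"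
    using assms i by (cases "i < n") (auto simp: def_vec_def d)
qed

lemma def_pred_subst_vec:
  fixes M :: "('f, 'r, 'a::linordered_field) expansion"
  assumes "def_pred M (\<lambda>e. R (vec n e))" "def_vec M n v"
  shows "def_pred M (\<lambda>e. R (v e))"
proof -
  have "def_term M (\<lambda>e. if i < n then v e $ i else 0)" for i
    using assms(2) by (cases "i < n") (auto simp: def_vec_def def_term_const)
  from def_pred_subst[OF assms(1) this]
  have "def_pred M (\<lambda>e. R (vec n (\<lambda>i. if i < n then v e $ i else 0)))" .
  moreover have "vec n (\<lambda>i. if i < n then v e $ i else 0) = v e" for e
    using def_vec_carrier[OF assms(2), of e] by (intro eq_vecI) auto
  ultimately show ?thesis by simp
qed

lemma def_pred_subst_scalar_vec:
  fixes M :: "('f, 'r, 'a::linordered_field) expansion"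
  assumes "def_pred M (\<lambda>e. R (e 0) (vec n (\<lambda>i. e (Suc i))))" "def_term M t" "def_vec M n v"
  shows "def_pred M (\<lambda>e. R (t e) (v e))"
proof -
  have v: "vec n (\<lambda>i. if i < n then v e $ i else 0) = v e" for e
    using def_vec_carrier[OF assms(3), of e] by (intro eq_vecI) auto
  let ?t = "\<lambda>i e. case i of 0 \<Rightarrow> t e | Suc i \<Rightarrow> if i < n then v e $ i else 0"
  have "def_term M (?t i)" for i
  proof (cases i)
    case (Suc j)
    then show ?thesis using assms(3) by (cases "j < n") (auto simp: def_vec_def def_term_const)
  qed (use assms(2) in simp)
  from def_pred_subst[OF assms(1), of ?t, OF this] v show ?thesis by simp
qed

text \<open>The bridge to the given notion of definability. There the point occupies an initial
  block of variables; interleaving arguments and parameters instead leaves room for any number of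
  new variables, as nested quantifiers require.\<close>

lemma definable_iff_def_pred:
  fixes M :: "('f, 'r, 'a::linordered_field) expansion"
  shows "definable M n S \<longleftrightarrow> S \<subseteq> carrier_vec n \<and> def_pred M (\<lambda>e. vec n e \<in> S)"
proof
  assume "definable M n S"
  then obtain \<phi> b where S: "S = {x \<in> carrier_vec n. sat M (\<lambda>i. if i < n then x $ i else b i) \<phi>}"
    unfolding definable_def by (elim exE) (rule that)
  \<comment> \<open>Coordinates go to even variables and parameters to the residue \<open>1\<close>
    modulo \<open>4\<close>; the residue \<open>3\<close> is kept for bound variables.\<close>
  define r where "r i = (if i < n then 2 * i else 4 * i + 1)" for i
  have "r j \<noteq> 4 * l + 3" for j l
  proof -
    have "2 * j \<noteq> 4 * l + 3" "4 * j + 1 \<noteq> 4 * l + 3" by presburger+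
    then show ?thesis unfolding r_def by (cases "j < n") simp_all
  qed
  moreover have "inj (\<lambda>k::nat. 4 * k + 3)" by (auto simp: inj_def)
  ultimately obtain \<psi> where psi: "\<And>e. sat M e \<psi> \<longleftrightarrow> sat M (\<lambda>j. e (r j)) \<phi>"
    using ex_renamed_formula[of "\<lambda>k. 4 * k + 3" r M \<phi>] by metis
  have "vec n e \<in> S \<longleftrightarrow> sat M (\<lambda>i. if even i then e (i div 2) else b (i div 2 div 2)) \<psi>" for e
  proof -
    have "(\<lambda>i. if i < n then vec n e $ i else b i) =
        (\<lambda>j. if even (r j) then e (r j div 2) else b (r j div 2 div 2))"
    proof (rule ext)
      fix j :: nat
      have "(4 * j + 1) div 2 div 2 = j" by presburger
      then show "(if j < n then vec n e $ j else b j) =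
          (if even (r j) then e (r j div 2) else b (r j div 2 div 2))"
        unfolding r_def by (cases "j < n") simp_all
    qed
    then show ?thesis unfolding psi S by (simp only: mem_Collect_eq vec_carrier simp_thms)
  qed
  then have "def_pred M (\<lambda>e. vec n e \<in> S)" by (rule def_predI[of _ M "\<lambda>i. b (i div 2)" \<psi>])
  then show "S \<subseteq> carrier_vec n \<and> def_pred M (\<lambda>e. vec n e \<in> S)" using S by blast
next
  assume S: "S \<subseteq> carrier_vec n \<and> def_pred M (\<lambda>e. vec n e \<in> S)"
  then have "def_pred M (\<lambda>e. vec n e \<in> S)" by blast
  then obtain \<phi> b where P: "\<And>e. vec n e \<in> S \<longleftrightarrow>
      sat M (\<lambda>i. if even i then e (i div 2) else b (i div 2)) \<phi>"
    by (rule def_predE) (rule that)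
  \<comment> \<open>Above \<open>n\<close>, residues modulo \<open>3\<close> (counted from
    \<open>n\<close>) separate the arguments that are not coordinates, which receive the value
    \<open>0\<close>, from the parameters and from the bound variables.\<close>
  define r where "r i = (if even i then if i div 2 < n then i div 2 else n + 3 * i else n + 3 * i + 1)" for i
  have "r j \<noteq> n + 3 * l + 2" for j l
  proof -
    have "3 * j \<noteq> 3 * l + 2" "3 * j + 1 \<noteq> 3 * l + 2" by presburger+
    then show ?thesis unfolding r_def by (cases "even j"; cases "j div 2 < n") simp_all
  qed
  moreover have "inj (\<lambda>k::nat. n + 3 * k + 2)" by (auto simp: inj_def)
  ultimately obtain \<psi> where psi: "\<And>e. sat M e \<psi> \<longleftrightarrow> sat M (\<lambda>j. e (r j)) \<phi>"
    using ex_renamed_formula[of "\<lambda>k. n + 3 * k + 2" r M \<phi>] by metis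
  define b' where "b' i = (if (i - n) mod 3 = 0 then 0 else b ((i - n) div 3 div 2))" for i
  have "x \<in> S \<longleftrightarrow> sat M (\<lambda>i. if i < n then x $ i else b' i) \<psi>" if "x \<in> carrier_vec n" for x
  proof -
    let ?e = "\<lambda>i. if i < n then x $ i else 0"
    have "vec n ?e = x" using that by (intro eq_vecI) auto
    moreover have "(\<lambda>j. if r j < n then x $ r j else b' (r j)) =
      (\<lambda>i. if even i then ?e (i div 2) else b (i div 2))"
    proof (rule ext)
      fix j :: nat
      have "(3 * j + 1) mod 3 = 1" "(3 * j + 1) div 3 = j" by presburger+
      then show "(if r j < n then x $ r j else b' (r j)) = (if even j then ?e (j div 2) else b (j div 2))"
        unfolding r_def b'_def by (cases "even j"; cases "j div 2 < n") simp_all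
    qed
    ultimately show ?thesis using P[of ?e] unfolding psi by (simp only:)
  qed
  then have "S = {x \<in> carrier_vec n. sat M (\<lambda>i. if i < n then x $ i else b' i) \<psi>}"
    using S by blast
  then show "definable M n S" unfolding definable_def by (intro exI)
qed

lemma def_termI:
  assumes "def_pred M (\<lambda>e. e 0 = t (\<lambda>i. e (Suc i)))" shows "def_term M t"
  using assms by (simp only: def_term_def)

lemma def_term_abs:
  assumes "def_term M t" shows "def_term M (\<lambda>e. \<bar>t e\<bar>)"
proof -
  have "def_pred M (\<lambda>e. (0 \<le> e 1 \<longrightarrow> e 0 = e 1) \<and> (e 1 < 0 \<longrightarrow> e 0 = - e 1))"
    by (intro def_pred_conj def_pred_imp def_pred_eq def_pred_le def_pred_less def_term_var
        def_term_uminus def_term_const)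
  moreover have "((0 \<le> y \<longrightarrow> x = y) \<and> (y < 0 \<longrightarrow> x = - y)) \<longleftrightarrow> x = \<bar>y\<bar>" for x y :: 'c
    by auto
  ultimately have "def_pred M (\<lambda>e. e 0 = \<bar>e 1\<bar>)" by (simp only:)
  then show ?thesis by (rule def_term_binop[where F = "\<lambda>x _. \<bar>x\<bar>", OF _ assms def_term_const[of M 0]])
qed

lemma def_term_divide:
  assumes "def_term M s" "def_term M t" shows "def_term M (\<lambda>e. s e / t e)"
proof -
  \<comment> \<open>The first clause encodes the convention \<open>y / 0 = 0\<close>, so that
    division is a total function with definable graph.\<close>
  have "def_pred M (\<lambda>e. (e 2 = 0 \<longrightarrow> e 0 = 0) \<and> (\<not> e 2 = 0 \<longrightarrow> e 0 * e 2 = e 1))"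
    by (intro def_pred_conj def_pred_imp def_pred_not def_pred_eq def_term_var def_term_mult def_term_const)
  moreover have "((z = 0 \<longrightarrow> x = 0) \<and> (\<not> z = 0 \<longrightarrow> x * z = y)) \<longleftrightarrow> x = y / z" for x y z :: 'c
    by (auto simp: field_simps)
  ultimately have "def_pred M (\<lambda>e. e 0 = e 1 / e 2)" by (simp only:)
  then show ?thesis by (rule def_term_binop[where F = "(/)", OF _ assms])
qed

lemma def_term_sum:
  fixes k :: nat
  assumes "\<And>i. i < k \<Longrightarrow> def_term M (\<lambda>e. t e i)"
  shows "def_term M (\<lambda>e. \<Sum>i<k. t e i)"
  using assms
proof (induction k)
  case 0
  show ?case using def_term_const[of M 0] by simp
next
  case (Suc k)
  have "def_term M (\<lambda>e. (\<Sum>i<k. t e i) + t e k)"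
    by (rule def_term_add) (use Suc in auto)
  then show ?case by (simp only: sum.lessThan_Suc)
qed

definition def_set :: "('f, 'r, 'a::linordered_field) expansion \<Rightarrow> nat \<Rightarrow> 'a vec set \<Rightarrow> bool" where
  "def_set M n S \<longleftrightarrow> def_pred M (\<lambda>e. vec n e \<in> S)"

text \<open>Definability is joint in the index and the point. Definability of every single
  \<open>A t\<close> would not permit quantification over \<open>t\<close>.\<close>

definition def_family :: "('f, 'r, 'a::linordered_field) expansion \<Rightarrow> nat \<Rightarrow> ('a \<Rightarrow> 'a vec set) \<Rightarrow> bool" where
  "def_family M n A \<longleftrightarrow> def_pred M (\<lambda>e. vec n (\<lambda>i. e (Suc i)) \<in> A (e 0))"

definition def_fun :: "('f, 'r, 'a::linordered_field) expansion \<Rightarrow> nat \<Rightarrow> ('a vec \<Rightarrow> 'a) \<Rightarrow> bool" where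
  "def_fun M n g \<longleftrightarrow> def_term M (\<lambda>e. g (vec n e))"

lemma def_set_mem:
  assumes "def_set M n S" "def_vec M n v" shows "def_pred M (\<lambda>e. v e \<in> S)"
  using def_pred_subst_vec[of M "\<lambda>x. x \<in> S", OF assms(1)[unfolded def_set_def] assms(2)] .

lemma def_family_mem:
  assumes "def_family M n A" "def_term M t" "def_vec M n v"
  shows "def_pred M (\<lambda>e. v e \<in> A (t e))"
  using def_pred_subst_scalar_vec[of M "\<lambda>t x. x \<in> A t", OF assms(1)[unfolded def_family_def] assms(2,3)] .

lemma def_family_at:
  assumes "def_family M n A" shows "def_set M n (A t)"
  unfolding def_set_def
  by (intro def_family_mem[OF assms] def_term_const def_vec_vec def_term_var)

lemma def_fun_app:
  fixes M :: "('f, 'r, 'a::linordered_field) expansion"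
  assumes "def_fun M n g" "def_vec M n v" shows "def_term M (\<lambda>e. g (v e))"
proof -
  have v: "vec n (\<lambda>i. if i < n then v e $ i else 0) = v e" for e
    using def_vec_carrier[OF assms(2), of e] by (intro eq_vecI) auto
  have "def_term M (\<lambda>e. if i < n then v e $ i else 0)" for i
    using assms(2) by (cases "i < n") (auto simp: def_vec_def def_term_const)
  from def_term_subst[OF assms(1)[unfolded def_fun_def], of "\<lambda>i e. if i < n then v e $ i else 0", OF this]
  show ?thesis unfolding v .
qed

lemma definable_iff_def_set: "definable M n S \<longleftrightarrow> S \<subseteq> carrier_vec n \<and> def_set M n S"
  by (simp only: definable_iff_def_pred def_set_def)

text \<open>Constants come first: otherwise a constant vector would be decomposed into its components.\<close>

lemmas def_intros = def_term_const def_term_var def_term_add def_term_diff def_term_mult def_term_uminus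
  def_term_divide def_term_abs def_term_sum
  def_pred_const def_pred_not def_pred_conj def_pred_disj def_pred_imp def_pred_iff
  def_pred_eq def_pred_less def_pred_le def_pred_all_less def_pred_ex_less
  def_pred_all def_pred_ex def_pred_all_vec def_pred_ex_vec
  def_vec_vec def_vec_vCons def_vec_append def_term_vec_nth

section \<open>Cubes and the product topology\<close>

definition cube :: "nat \<Rightarrow> 'a::linordered_field vec \<Rightarrow> 'a \<Rightarrow> 'a vec set" where
  "cube n x r = {y \<in> carrier_vec n. \<forall>i<n. \<bar>y $ i - x $ i\<bar> < r}"

lemma def_pred_mem_cube:
  assumes "def_vec M n v" "def_vec M n w" "def_term M t"
  shows "def_pred M (\<lambda>e. v e \<in> cube n (w e) (t e))"
proof -
  have "def_pred M (\<lambda>e. \<forall>i<n. \<bar>v e $ i - w e $ i\<bar> < t e)"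
    by (rule def_intros assms | assumption)+
  moreover have "v e \<in> cube n (w e) (t e) \<longleftrightarrow> (\<forall>i<n. \<bar>v e $ i - w e $ i\<bar> < t e)" for e
    using def_vec_carrier[OF assms(1)] unfolding cube_def by blast
  ultimately show ?thesis by (simp only:)
qed

text \<open>The minimum of finitely many admissible bounds is admissible for all, since
  admissibility passes to smaller positive numbers. It supplies a common radius for finitely many
  coordinates or functions.\<close>

lemma ex_pos_all_less:
  fixes k :: nat and Q :: "nat \<Rightarrow> 'a::linordered_field \<Rightarrow> bool"
  assumes "\<And>i. i < k \<Longrightarrow> \<exists>s>0. Q i s"
    and "\<And>i s s'. i < k \<Longrightarrow> Q i s \<Longrightarrow> 0 < s' \<Longrightarrow> s' \<le> s \<Longrightarrow> Q i s'"
  shows "\<exists>s>0. \<forall>i<k. Q i s"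
  using assms
proof (induction k)
  case 0
  show ?case by (intro exI[of _ 1]) auto
next
  case (Suc k)
  have "\<exists>s>0. \<forall>i<k. Q i s"
    by (rule Suc.IH[OF Suc.prems(1)[OF less_SucI] Suc.prems(2)[OF less_SucI]])
  then obtain s where s: "s > 0" "\<forall>i<k. Q i s" by blast
  obtain s' where s': "s' > 0" "Q k s'" using Suc.prems(1)[of k] by blast
  have "Q i (min s s')" if "i < Suc k" for i
  proof (cases "i = k")
    case True
    then show ?thesis using Suc.prems(2)[of k s' "min s s'"] s s' by simp
  next
    case False
    then show ?thesis using Suc.prems(2)[of i s "min s s'"] s s' that by simp
  qed
  then show ?case using s s' by (intro exI[of _ "min s s'"]) auto
qed

lemma cube_carrier: "y \<in> cube n x r \<Longrightarrow> y \<in> carrier_vec n"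
  by (simp add: cube_def)

lemma center_in_cube: "x \<in> carrier_vec n \<Longrightarrow> 0 < r \<Longrightarrow> x \<in> cube n x r"
  by (simp add: cube_def)

lemma cube_mono: "r \<le> s \<Longrightarrow> cube n x r \<subseteq> cube n x s"
  by (auto simp: cube_def intro: less_le_trans)

lemma cube_open:
  assumes "y \<in> cube n x r"
  obtains s where "s > 0" "cube n y s \<subseteq> cube n x r"
proof -
  have "\<exists>s>0. \<forall>i<n. \<bar>y $ i - x $ i\<bar> + s \<le> r"
  proof (rule ex_pos_all_less)
    show "\<exists>s>0. \<bar>y $ i - x $ i\<bar> + s \<le> r" if "i < n" for i
      using assms that by (intro exI[of _ "r - \<bar>y $ i - x $ i\<bar>"]) (simp add: cube_def)
  qed auto
  then obtain s where s: "s > 0" "\<forall>i<n. \<bar>y $ i - x $ i\<bar> + s \<le> r" by blast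
  have "cube n y s \<subseteq> cube n x r"
  proof
    fix z assume z: "z \<in> cube n y s"
    have "\<bar>z $ i - x $ i\<bar> < r" if "i < n" for i
    proof -
      have "\<bar>z $ i - y $ i\<bar> < s" using z that by (simp add: cube_def)
      moreover have "\<bar>y $ i - x $ i\<bar> + s \<le> r" using s that by simp
      ultimately show ?thesis by (simp add: abs_if split: if_splits)
    qed
    then show "z \<in> cube n x r" using z by (simp add: cube_def)
  qed
  then show ?thesis using that s by blast
qed

lemma cube_refine:
  assumes "y \<in> cube n x r" "y \<in> cube n x' r'"
  obtains s where "s > 0" "cube n y s \<subseteq> cube n x r" "cube n y s \<subseteq> cube n x' r'"
proof -
  obtain s where s: "s > 0" "cube n y s \<subseteq> cube n x r" by (rule cube_open[OF assms(1)])
  obtain s' where s': "s' > 0" "cube n y s' \<subseteq> cube n x' r'" by (rule cube_open[OF assms(2)])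
  have "cube n y (min s s') \<subseteq> cube n y s" "cube n y (min s s') \<subseteq> cube n y s'" by (simp_all add: cube_mono)
  then have "cube n y (min s s') \<subseteq> cube n x r" "cube n y (min s s') \<subseteq> cube n x' r'" "min s s' > 0"
    using s s' by auto
  then show ?thesis using that by blast
qed

lemma open_interval_around:
  fixes S :: "'a::{linordered_field, linorder_topology} set"
  assumes "open S" "x \<in> S"
  obtains r where "r > 0" "\<forall>y. \<bar>y - x\<bar> < r \<longrightarrow> y \<in> S"
proof -
  have "x - 1 < x" "x < x + 1" by simp_all
  obtain b where b: "b > x" "{x..<b} \<subseteq> S" using open_right[OF assms \<open>x < x + 1\<close>] by blast
  obtain a where a: "a < x" "{a<..x} \<subseteq> S" using open_left[OF assms \<open>x - 1 < x\<close>] by blast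
  have in_S: "y \<in> S" if "\<bar>y - x\<bar> < min (b - x) (x - a)" for y
  proof (cases "y \<le> x")
    case True
    have "x - y \<le> \<bar>y - x\<bar>" by (simp add: abs_if)
    then have "y \<in> {a<..x}" using that True by simp
    then show ?thesis using a by blast
  next
    case False
    have "y - x \<le> \<bar>y - x\<bar>" by (simp add: abs_if)
    then have "y \<in> {x..<b}" using that False by simp
    then show ?thesis using b by blast
  qed
  have "min (b - x) (x - a) > 0" using a b by simp
  moreover have "\<forall>y. \<bar>y - x\<bar> < min (b - x) (x - a) \<longrightarrow> y \<in> S" using in_S by blast
  ultimately show ?thesis by (rule that)
qed

lemma topspace_vec_topology [simp]:
  "topspace (vec_topology n :: 'a::linorder_topology vec topology) = carrier_vec n"
  unfolding vec_topology_def topspace_pullback_topology by auto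

text \<open>From here on cubes replace open sets: centre and radius are finitely many elements of
  \<open>K\<close>, so topological statements become first-order.\<close>

lemma openin_vec_topology:
  fixes U :: "'a::{linordered_field, linorder_topology} vec set"
  shows "openin (vec_topology n) U \<longleftrightarrow> U \<subseteq> carrier_vec n \<and> (\<forall>x\<in>U. \<exists>r>0. cube n x r \<subseteq> U)"
proof
  assume U: "openin (vec_topology n) U"
  then have sub: "U \<subseteq> carrier_vec n" using openin_subset by fastforce
  obtain V where V: "openin (product_topology (\<lambda>_. euclidean) {..<n}) V"
    "U = (\<lambda>x. \<lambda>i\<in>{..<n}. x $ i) -` V \<inter> carrier_vec n"
    using U unfolding vec_topology_def openin_pullback_topology by blast
  have "\<exists>r>0. cube n x r \<subseteq> U" if x: "x \<in> U" for x
  proof -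
    have "(\<lambda>i\<in>{..<n}. x $ i) \<in> V" using V x by auto
    then obtain W where W: "\<forall>i\<in>{..<n}. openin euclidean (W i)"
      "(\<lambda>i\<in>{..<n}. x $ i) \<in> PiE {..<n} W" "PiE {..<n} W \<subseteq> V"
      using V(1) unfolding openin_product_topology_alt by meson
    have "\<exists>r>0. \<forall>i<n. \<forall>y. \<bar>y - x $ i\<bar> < r \<longrightarrow> y \<in> W i"
    proof (rule ex_pos_all_less)
      fix i assume i: "i < n"
      have "open (W i)" using W(1) i by simp
      moreover have "x $ i \<in> W i" using W(2) i by (auto simp: PiE_iff)
      ultimately obtain r where "r > 0" "\<forall>y. \<bar>y - x $ i\<bar> < r \<longrightarrow> y \<in> W i"
        by (rule open_interval_around)
      then show "\<exists>r>0. \<forall>y. \<bar>y - x $ i\<bar> < r \<longrightarrow> y \<in> W i" by blast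
    qed auto
    then obtain r where r: "r > 0" "\<forall>i<n. \<forall>y. \<bar>y - x $ i\<bar> < r \<longrightarrow> y \<in> W i" by blast
    have "cube n x r \<subseteq> U"
    proof
      fix y assume y: "y \<in> cube n x r"
      then have "(\<lambda>i\<in>{..<n}. y $ i) \<in> PiE {..<n} W" using r by (auto simp: cube_def)
      then have "(\<lambda>i\<in>{..<n}. y $ i) \<in> V" using W(3) by blast
      then show "y \<in> U" using V(2) cube_carrier[OF y] by blast
    qed
    then show ?thesis using r by blast
  qed
  then show "U \<subseteq> carrier_vec n \<and> (\<forall>x\<in>U. \<exists>r>0. cube n x r \<subseteq> U)" using sub by blast
next
  assume U: "U \<subseteq> carrier_vec n \<and> (\<forall>x\<in>U. \<exists>r>0. cube n x r \<subseteq> U)"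
  define V where "V = {f \<in> extensional {..<n}. vec n f \<in> U}"
  have "openin (product_topology (\<lambda>_. euclidean) {..<n}) V"
    unfolding openin_product_topology_alt
  proof (intro ballI)
    fix f assume f: "f \<in> V"
    then obtain r where r: "r > 0" "cube n (vec n f) r \<subseteq> U" using U by (auto simp: V_def)
    define W where "W i = {f i - r <..< f i + r}" for i
    have "finite {i \<in> {..<n}. W i \<noteq> topspace euclidean}" by simp
    moreover have "\<forall>i\<in>{..<n}. openin euclidean (W i)" by (simp add: W_def)
    moreover have "f \<in> PiE {..<n} W" using f r(1) by (simp add: V_def W_def PiE_iff)
    moreover have "PiE {..<n} W \<subseteq> V"
    proof
      fix g assume g: "g \<in> PiE {..<n} W"
      have "\<bar>g i - f i\<bar> < r" if "i < n" for i
      proof -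
        have "g i \<in> {f i - r <..< f i + r}" using g that by (simp add: W_def PiE_iff)
        then show ?thesis by (auto simp: abs_if)
      qed
      then have "vec n g \<in> cube n (vec n f) r" by (simp add: cube_def)
      then have "vec n g \<in> U" using r by blast
      then show "g \<in> V" using g by (simp add: V_def PiE_iff)
    qed
    ultimately show "\<exists>W. finite {i \<in> {..<n}. W i \<noteq> topspace euclidean} \<and>
        (\<forall>i\<in>{..<n}. openin euclidean (W i)) \<and> f \<in> PiE {..<n} W \<and> PiE {..<n} W \<subseteq> V" by blast
  qed
  moreover have "U = (\<lambda>x. \<lambda>i\<in>{..<n}. x $ i) -` V \<inter> carrier_vec n"
  proof -
    have "vec n (\<lambda>i\<in>{..<n}. x $ i) = x" if "x \<in> carrier_vec n" for x :: "'a vec"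
      using that by (intro eq_vecI) auto
    then show ?thesis using U by (auto simp: V_def)
  qed
  ultimately show "openin (vec_topology n) U"
    unfolding vec_topology_def openin_pullback_topology by blast
qed

lemma openin_cube: "openin (vec_topology n) (cube n x r :: 'a::{linordered_field, linorder_topology} vec set)"
  unfolding openin_vec_topology using cube_open by (metis cube_carrier subsetI)

section \<open>Density, nowhere density and closedness in terms of cubes\<close>

definition dense_in_cube :: "nat \<Rightarrow> 'a::linordered_field vec set \<Rightarrow> 'a vec \<Rightarrow> 'a \<Rightarrow> bool" where
  "dense_in_cube n S x r \<longleftrightarrow>
     (\<forall>y\<in>carrier_vec n. \<forall>s>0. cube n y s \<subseteq> cube n x r \<longrightarrow> cube n y s \<inter> S \<noteq> {})"

definition nowhere_dense_cubes :: "nat \<Rightarrow> 'a::linordered_field vec set \<Rightarrow> bool" where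
  "nowhere_dense_cubes n S \<longleftrightarrow> (\<forall>x\<in>carrier_vec n. \<forall>r>0. \<not> dense_in_cube n S x r)"

definition closed_cubes :: "nat \<Rightarrow> 'a::linordered_field vec set \<Rightarrow> bool" where
  "closed_cubes n S \<longleftrightarrow> (\<forall>x\<in>carrier_vec n - S. \<exists>r>0. cube n x r \<inter> S = {})"

lemma nowhere_dense_cubesD:
  assumes "nowhere_dense_cubes n S" "x \<in> carrier_vec n" "r > 0"
  obtains y s where "y \<in> carrier_vec n" "s > 0" "cube n y s \<subseteq> cube n x r" "cube n y s \<inter> S = {}"
proof -
  have "\<not> dense_in_cube n S x r" using assms unfolding nowhere_dense_cubes_def by blast
  then show ?thesis unfolding dense_in_cube_def using that by meson
qed

lemma nowhere_dense_cubesI: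
  assumes "\<And>x r. x \<in> carrier_vec n \<Longrightarrow> r > 0 \<Longrightarrow>
    \<exists>y\<in>carrier_vec n. \<exists>s>0. cube n y s \<subseteq> cube n x r \<and> cube n y s \<inter> S = {}"
  shows "nowhere_dense_cubes n S"
  unfolding nowhere_dense_cubes_def
proof (intro ballI allI impI notI)
  fix x :: "'a vec" and r :: 'a
  assume "x \<in> carrier_vec n" "0 < r" and d: "dense_in_cube n S x r"
  then obtain y s where "y \<in> carrier_vec n" "s > 0" "cube n y s \<subseteq> cube n x r" "cube n y s \<inter> S = {}"
    using assms by meson
  then show False using d unfolding dense_in_cube_def by blast
qed

lemma nowhere_dense_cubes_subset:
  assumes "nowhere_dense_cubes n S" "T \<subseteq> S" shows "nowhere_dense_cubes n T"
proof -
  have "dense_in_cube n S x r" if "dense_in_cube n T x r" for x r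
    using that assms(2) unfolding dense_in_cube_def by fast
  then show ?thesis using assms(1) unfolding nowhere_dense_cubes_def by blast
qed

lemma dense_in_subcube:
  "dense_in_cube n S x r \<Longrightarrow> cube n y s \<subseteq> cube n x r \<Longrightarrow> dense_in_cube n S y s"
  unfolding dense_in_cube_def by blast

text \<open>Failure of nowhere density provides only density in some cube; for closed sets this is
  upgraded to a full cube. A missing point would have a whole neighbourhood off \<open>S\<close>,
  and this contains a subcube of the given cube.\<close>

lemma closed_dense_contains_cube:
  assumes "closed_cubes n S" "dense_in_cube n S x r"
  shows "cube n x r \<subseteq> S"
proof
  fix y assume y: "y \<in> cube n x r"
  show "y \<in> S"
  proof (rule ccontr)
    assume "y \<notin> S"
    then obtain r' where r': "r' > 0" "cube n y r' \<inter> S = {}"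
      using assms(1) cube_carrier[OF y] unfolding closed_cubes_def by blast
    then obtain s where "s > 0" "cube n y s \<subseteq> cube n x r" "cube n y s \<subseteq> cube n y r'"
      using cube_refine[OF y center_in_cube[OF cube_carrier[OF y] r'(1)]] by blast
    then show False using assms(2) r' cube_carrier[OF y] unfolding dense_in_cube_def by blast
  qed
qed

definition cube_closure :: "nat \<Rightarrow> 'a::linordered_field vec set \<Rightarrow> 'a vec set" where
  "cube_closure n S = {x \<in> carrier_vec n. \<forall>r>0. cube n x r \<inter> S \<noteq> {}}"

lemma subset_cube_closure: "S \<subseteq> carrier_vec n \<Longrightarrow> S \<subseteq> cube_closure n S"
  unfolding cube_closure_def using center_in_cube by blast

lemma closed_cube_closure: "closed_cubes n (cube_closure n S)"
  unfolding closed_cubes_def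
proof
  fix x assume x: "x \<in> carrier_vec n - cube_closure n S"
  then obtain r where r: "r > 0" "cube n x r \<inter> S = {}" unfolding cube_closure_def by blast
  have "y \<notin> cube_closure n S" if y: "y \<in> cube n x r" for y
  proof -
    obtain s where "s > 0" "cube n y s \<subseteq> cube n x r" by (rule cube_open[OF y])
    then show ?thesis using r unfolding cube_closure_def by blast
  qed
  then show "\<exists>r>0. cube n x r \<inter> cube_closure n S = {}" using r by blast
qed

lemma nowhere_dense_cube_closure:
  assumes "nowhere_dense_cubes n S" shows "nowhere_dense_cubes n (cube_closure n S)"
proof (rule nowhere_dense_cubesI)
  fix x :: "'a vec" and r :: 'a assume "x \<in> carrier_vec n" "r > 0"
  then obtain y s where y: "y \<in> carrier_vec n" "s > 0" "cube n y s \<subseteq> cube n x r" "cube n y s \<inter> S = {}"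
    by (rule nowhere_dense_cubesD[OF assms])
  have "z \<notin> cube_closure n S" if z: "z \<in> cube n y s" for z
  proof -
    obtain t where "t > 0" "cube n z t \<subseteq> cube n y s" by (rule cube_open[OF z])
    then show ?thesis using y unfolding cube_closure_def by blast
  qed
  then show "\<exists>y\<in>carrier_vec n. \<exists>s>0. cube n y s \<subseteq> cube n x r \<and> cube n y s \<inter> cube_closure n S = {}"
    using y by blast
qed

lemma nowhere_dense_in_vec_topology:
  fixes S :: "'a::{linordered_field, linorder_topology} vec set"
  shows "nowhere_dense_in (vec_topology n) S \<longleftrightarrow> S \<subseteq> carrier_vec n \<and> nowhere_dense_cubes n S"
proof -
  have cl: "vec_topology n closure_of S = cube_closure n S" if S: "S \<subseteq> carrier_vec n"
  proof -
    have "x \<in> vec_topology n closure_of S \<longleftrightarrow> x \<in> cube_closure n S" for x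
    proof
      assume x: "x \<in> vec_topology n closure_of S"
      then have "x \<in> carrier_vec n" by (simp add: in_closure_of)
      moreover have "cube n x r \<inter> S \<noteq> {}" if "r > 0" for r
        using x openin_cube[of n x r] center_in_cube[OF \<open>x \<in> carrier_vec n\<close> that]
        unfolding in_closure_of by blast
      ultimately show "x \<in> cube_closure n S" by (simp add: cube_closure_def)
    next
      assume x: "x \<in> cube_closure n S"
      have "\<exists>y\<in>S. y \<in> T" if "x \<in> T" "openin (vec_topology n) T" for T
      proof -
        obtain r where "r > 0" "cube n x r \<subseteq> T" using \<open>openin (vec_topology n) T\<close> \<open>x \<in> T\<close>
          unfolding openin_vec_topology by blast
        then show ?thesis using x unfolding cube_closure_def by blast
      qed
      moreover have "x \<in> topspace (vec_topology n)" using x by (simp add: cube_closure_def)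
      ultimately show "x \<in> vec_topology n closure_of S" unfolding in_closure_of by blast
    qed
    then show ?thesis by blast
  qed
  have int: "vec_topology n interior_of T = {} \<longleftrightarrow> \<not> (\<exists>x\<in>carrier_vec n. \<exists>r>0. cube n x r \<subseteq> T)" for T :: "'a vec set"
  proof
    assume e: "vec_topology n interior_of T = {}"
    show "\<not> (\<exists>x\<in>carrier_vec n. \<exists>r>0. cube n x r \<subseteq> T)"
    proof (intro notI, elim bexE exE conjE)
      fix x r assume x: "x \<in> carrier_vec n" "(r::'a) > 0" "cube n x r \<subseteq> T"
      have "cube n x r \<subseteq> vec_topology n interior_of T" by (rule interior_of_maximal[OF x(3) openin_cube])
      then show False using e center_in_cube[OF x(1,2)] by simp
    qed
  next
    assume n: "\<not> (\<exists>x\<in>carrier_vec n. \<exists>r>0. cube n x r \<subseteq> T)"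
    have op: "openin (vec_topology n) (vec_topology n interior_of T)" by (rule openin_interior_of)
    have "x \<notin> vec_topology n interior_of T" for x
    proof
      assume x: "x \<in> vec_topology n interior_of T"
      have "x \<in> carrier_vec n" using x op openin_vec_topology[of n "vec_topology n interior_of T"] by blast
      moreover have "\<exists>r>0. cube n x r \<subseteq> vec_topology n interior_of T"
        using x op openin_vec_topology[of n "vec_topology n interior_of T"] by blast
      ultimately show False using n interior_of_subset[of "vec_topology n" T] by blast
    qed
    then show "vec_topology n interior_of T = {}" by blast
  qed
  have eq: "nowhere_dense_cubes n S \<longleftrightarrow> \<not> (\<exists>x\<in>carrier_vec n. \<exists>r>0. cube n x r \<subseteq> cube_closure n S)"
    (is "?l \<longleftrightarrow> ?r") if S: "S \<subseteq> carrier_vec n"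
  proof
    assume ?l
    then have nd: "nowhere_dense_cubes n (cube_closure n S)" by (rule nowhere_dense_cube_closure)
    show ?r
    proof (intro notI, elim bexE exE conjE)
      fix x r assume "x \<in> carrier_vec n" "r > 0" and sub: "cube n x r \<subseteq> cube_closure n S"
      obtain y s where "y \<in> carrier_vec n" "s > 0" "cube n y s \<subseteq> cube n x r"
          "cube n y s \<inter> cube_closure n S = {}"
        using nowhere_dense_cubesD[OF nd \<open>x \<in> carrier_vec n\<close> \<open>r > 0\<close>] .
      then show False using sub center_in_cube[of y n s] by blast
    qed
  next
    assume r: ?r
    have "cube n x r \<subseteq> cube_closure n S" if d: "dense_in_cube n S x r" for x r
      using closed_dense_contains_cube[OF closed_cube_closure, of n S x r] d
        subset_cube_closure[OF S] unfolding dense_in_cube_def by blast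
    then show ?l using r unfolding nowhere_dense_cubes_def by blast
  qed
  show ?thesis
  proof (cases "S \<subseteq> carrier_vec n")
    case True
    show ?thesis unfolding nowhere_dense_in_def cl[OF True] int eq[OF True] topspace_vec_topology
      by (simp only: True simp_thms)
  next
    case False
    then show ?thesis unfolding nowhere_dense_in_def topspace_vec_topology by (simp only: simp_thms)
  qed
qed

definition nowhere_dense_ivl :: "'a::linordered_field set \<Rightarrow> bool" where
  "nowhere_dense_ivl X \<longleftrightarrow> (\<forall>a b. a < b \<longrightarrow> (\<exists>c d. a \<le> c \<and> c < d \<and> d \<le> b \<and> {c<..<d} \<inter> X = {}))"

lemma nowhere_dense_in_euclidean:
  fixes X :: "'a::{linordered_field, linorder_topology} set"
  assumes "nowhere_dense_in euclidean X"
  shows "nowhere_dense_ivl X"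
  unfolding nowhere_dense_ivl_def
proof (intro allI impI)
  fix a b :: 'a assume ab: "a < b"
  have "interior (closure X) = {}"
    using assms by (simp add: nowhere_dense_in_def)
  moreover have "{a<..<b} \<noteq> {}" using dense[OF ab] by auto
  ultimately have "\<not> {a<..<b} \<subseteq> closure X"
    using interior_maximal[of "{a<..<b}" "closure X"] by auto
  then obtain y where y: "y \<in> {a<..<b}" "y \<notin> closure X" by blast
  have "open ({a<..<b} - closure X)" by (intro open_Diff) auto
  moreover have "y \<in> {a<..<b} - closure X" using y by blast
  ultimately obtain r where r: "r > 0" "\<forall>z. \<bar>z - y\<bar> < r \<longrightarrow> z \<in> {a<..<b} - closure X"
    by (rule open_interval_around)
  have "{max a (y - r)<..<min b (y + r)} \<inter> X = {}"
  proof -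
    have "z \<notin> X" if "z \<in> {max a (y - r)<..<min b (y + r)}" for z
    proof -
      have "\<bar>z - y\<bar> < r" using that by (auto simp: abs_if)
      then show ?thesis using r(2) closure_subset[of X] by blast
    qed
    then show ?thesis by blast
  qed
  moreover have "max a (y - r) < min b (y + r)" using y(1) r(1) by auto
  ultimately show "\<exists>c d. a \<le> c \<and> c < d \<and> d \<le> b \<and> {c<..<d} \<inter> X = {}"
    by (intro exI[of _ "max a (y - r)"] exI[of _ "min b (y + r)"]) simp
qed

lemma discrete_in_vec_topology:
  fixes D :: "'a::{linordered_field, linorder_topology} vec set"
  assumes "D \<subseteq> carrier_vec n" "\<And>x. x \<in> D \<Longrightarrow> \<exists>r>0. cube n x r \<inter> D \<subseteq> {x}"
  shows "discrete_in (vec_topology n) D"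
proof -
  have "openin (subtopology (vec_topology n) D) {x}" if x: "x \<in> D" for x
  proof -
    obtain r where "r > 0" "cube n x r \<inter> D \<subseteq> {x}" using assms(2)[OF x] by blast
    then have "{x} = cube n x r \<inter> D" using center_in_cube[of x n r] x assms(1) by blast
    then show ?thesis unfolding openin_subtopology using openin_cube by blast
  qed
  moreover have "topspace (subtopology (vec_topology n) D) = D" using assms(1) by auto
  ultimately have "subtopology (vec_topology n) D = discrete_topology D"
    by (metis discrete_topology_unique)
  then show ?thesis using assms(1) by (simp add: discrete_in_def)
qed

section \<open>Increasing unions of nowhere dense sets on the line\<close>

lemma def_pred_unary:
  assumes "def_pred M (\<lambda>e. P (e 0))" "def_term M t" shows "def_pred M (\<lambda>e. P (t e))"
  by (rule def_pred_binrel[where R = "\<lambda>x _. P x", OF assms(1,2) def_term_const[of M 0]])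

definition closed_ivl :: "'a::linordered_field set \<Rightarrow> bool" where
  "closed_ivl X \<longleftrightarrow> (\<forall>x. x \<notin> X \<longrightarrow> (\<exists>\<epsilon>>0. \<forall>y. \<bar>y - x\<bar> < \<epsilon> \<longrightarrow> y \<notin> X))"

definition no_acc_point :: "'a::linordered_field set \<Rightarrow> bool" where
  "no_acc_point X \<longleftrightarrow> (\<forall>x. \<exists>\<epsilon>>0. \<forall>y\<in>X. \<bar>y - x\<bar> < \<epsilon> \<longrightarrow> y = x)"

lemma no_acc_point_subset: "no_acc_point X \<Longrightarrow> Y \<subseteq> X \<Longrightarrow> no_acc_point Y"
  unfolding no_acc_point_def by blast

lemma no_acc_point_separated:
  assumes "\<epsilon> > 0" "\<And>u v. u \<in> X \<Longrightarrow> v \<in> X \<Longrightarrow> u < v \<Longrightarrow> \<epsilon> \<le> v - u"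
  shows "no_acc_point X"
  unfolding no_acc_point_def
proof
  fix x
  show "\<exists>\<epsilon>>0. \<forall>y\<in>X. \<bar>y - x\<bar> < \<epsilon> \<longrightarrow> y = x"
  proof (cases "\<exists>u\<in>X. u \<noteq> x \<and> \<bar>u - x\<bar> < \<epsilon> / 2")
    case False
    then show ?thesis using assms(1) by (intro exI[of _ "\<epsilon> / 2"]) auto
  next
    case True
    then obtain u where u: "u \<in> X" "u \<noteq> x" "\<bar>u - x\<bar> < \<epsilon> / 2" by blast
    \<comment> \<open>Such a \<open>y\<close> is within \<open>\<epsilon>\<close> of
      \<open>u\<close> and hence equal to \<open>u\<close>, which contradicts its being strictly
      closer to \<open>x\<close>. So there is none, and the claim holds vacuously.\<close>
    have "y = x" if y: "y \<in> X" "\<bar>y - x\<bar> < \<bar>u - x\<bar>" for y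
    proof -
      have "\<bar>y - u\<bar> \<le> \<bar>y - x\<bar> + \<bar>u - x\<bar>" by (simp add: abs_if)
      then have "\<bar>y - u\<bar> < \<epsilon>" using u y by linarith
      then have "y - u < \<epsilon>" "u - y < \<epsilon>" by (simp_all add: abs_less_iff)
      then have "\<not> y < u" "\<not> u < y" using assms(2)[OF y(1) u(1)] assms(2)[OF u(1) y(1)] by auto
      then have "y = u" by simp
      then show ?thesis using y by simp
    qed
    then show ?thesis using u by (intro exI[of _ "\<bar>u - x\<bar>"]) auto
  qed
qed

locale restrained_expansion =
  fixes M :: "('f, 'r, 'a::{linordered_field, linorder_topology}) expansion"
  assumes restrained: "restrained M"
begin

text \<open>Definable completeness yields a supremum that may be infinite; the witness
  \<open>a\<close> and the bound \<open>b\<close> exclude both infinities. Leastness is stated as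
  approximation from below, the form in which it is applied.\<close>

lemma def_sup:
  assumes "def_pred M (\<lambda>e. P (e 0))" "P a" "\<forall>x. P x \<longrightarrow> x \<le> b"
  obtains s where "\<forall>x. P x \<longrightarrow> x \<le> s" "\<forall>t<s. \<exists>x. P x \<and> t < x"
proof -
  have mem: "vec 1 e \<in> point_vec ` {x. P x} \<longleftrightarrow> P (e 0)" for e :: "nat \<Rightarrow> 'a"
  proof
    assume "vec 1 e \<in> point_vec ` {x. P x}"
    then obtain x where x: "P x" "vec 1 e = point_vec x" by blast
    from arg_cong[OF x(2), of "\<lambda>v. v $ 0"] have "e 0 = x" by (simp add: point_vec_def)
    then show "P (e 0)" using x by simp
  next
    assume "P (e 0)"
    moreover have "vec 1 e = point_vec (e 0)" by (rule eq_vecI) (simp_all add: point_vec_def)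
    ultimately show "vec 1 e \<in> point_vec ` {x. P x}" by blast
  qed
  have "def_set M 1 (point_vec ` {x. P x})"
    unfolding def_set_def mem by (rule assms(1))
  moreover have "point_vec ` {x. P x} \<subseteq> carrier_vec 1" by (auto simp: point_vec_def)
  ultimately have "definable_in_field M {x. P x}"
    unfolding definable_in_field_def definable_iff_def_set by blast
  then obtain s where s: "\<forall>x\<in>{x. P x}. Fin x \<le> s" "\<forall>t. (\<forall>x\<in>{x. P x}. Fin x \<le> t) \<longrightarrow> s \<le> t"
    using restrained unfolding restrained_def definably_complete_def by blast
  have "s \<le> Fin b" using s(2) assms(3) by auto
  moreover have "Fin a \<le> s" using s(1) assms(2) by auto
  ultimately obtain r where r: "s = Fin r" by (cases s) auto
  have 1: "\<forall>x. P x \<longrightarrow> x \<le> r" using s(1) r by auto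
  have 2: "\<forall>t<r. \<exists>x. P x \<and> t < x"
  proof (intro allI impI, rule ccontr)
    fix t assume "t < r" "\<not> (\<exists>x. P x \<and> t < x)"
    then have "\<forall>x\<in>{x. P x}. Fin x \<le> Fin t" by (auto simp: not_less)
    then have "s \<le> Fin t" using s(2) by blast
    then show False using r \<open>t < r\<close> by simp
  qed
  show ?thesis using 1 2 by (rule that)
qed

lemma def_inf:
  assumes "def_pred M (\<lambda>e. P (e 0))" "P a" "\<forall>x. P x \<longrightarrow> b \<le> x"
  obtains s where "\<forall>x. P x \<longrightarrow> s \<le> x" "\<forall>t>s. \<exists>x. P x \<and> x < t"
proof -
  have d: "def_pred M (\<lambda>e. P (- e 0))"
    by (rule def_pred_unary[where P = P, OF assms(1)]) (rule def_intros)+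
  have "P (- (- a))" using assms(2) by simp
  moreover have "\<forall>x. P (- x) \<longrightarrow> x \<le> - b" using assms(3) by (auto simp: le_minus_iff)
  ultimately obtain s where s: "\<forall>x. P (- x) \<longrightarrow> x \<le> s" "\<forall>t<s. \<exists>x. P (- x) \<and> t < x"
    by (rule def_sup[of "\<lambda>x. P (- x)", OF d])
  have 1: "\<forall>x. P x \<longrightarrow> - s \<le> x"
  proof (intro allI impI)
    fix x assume "P x"
    then have "P (- (- x))" by simp
    then have "- x \<le> s" using s(1) by blast
    then show "- s \<le> x" by simp
  qed
  have 2: "\<forall>t>- s. \<exists>x. P x \<and> x < t"
  proof (intro allI impI)
    fix t assume "- s < t"
    then have "- t < s" by simp
    then obtain x where "P (- x)" "- t < x" using s(2) by blast
    then show "\<exists>x. P x \<and> x < t" by (intro exI[of _ "- x"]) simp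
  qed
  show ?thesis using 1 2 by (rule that)
qed

text \<open>A definable pigeonhole principle: a bounded set without accumulation points behaves like
  a finite one. If the images accumulated at \<open>y\<close>, let \<open>s\<close> be the supremum
  of the \<open>q\<close> such that, close to \<open>y\<close>, only arguments above
  \<open>q\<close> contribute images other than \<open>y\<close>. The only argument near
  \<open>s\<close> can be \<open>s\<close> itself, and it has at most one image, so \<open>q\<close>
  can be pushed beyond \<open>s\<close>.\<close>

lemma no_acc_point_image:
  assumes X: "def_pred M (\<lambda>e. e 0 \<in> X)" and R: "def_pred M (\<lambda>e. R (e 0) (e 1))"
    and bdd: "\<And>x. x \<in> X \<Longrightarrow> lo \<le> x \<and> x \<le> hi"
    and acc: "no_acc_point X"
    and func: "\<And>p z z'. p \<in> X \<Longrightarrow> R p z \<Longrightarrow> R p z' \<Longrightarrow> z = z'"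
  shows "no_acc_point {z. \<exists>p\<in>X. R p z}"
  unfolding no_acc_point_def
proof (rule allI, rule ccontr)
  fix y
  assume "\<not> (\<exists>\<epsilon>>0. \<forall>z\<in>{z. \<exists>p\<in>X. R p z}. \<bar>z - y\<bar> < \<epsilon> \<longrightarrow> z = y)"
  then have ac: "\<exists>p z. p \<in> X \<and> R p z \<and> \<bar>z - y\<bar> < \<epsilon> \<and> z \<noteq> y" if "\<epsilon> > 0" for \<epsilon>
    using that by blast
  define P where "P q \<longleftrightarrow> (\<exists>\<delta>. 0 < \<delta> \<and> (\<forall>p. p \<in> X \<longrightarrow> (\<forall>z. R p z \<longrightarrow> z \<noteq> y \<longrightarrow> \<bar>z - y\<bar> < \<delta> \<longrightarrow> q < p)))" for q
  have "def_pred M (\<lambda>e. P (e 0))"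
    unfolding P_def
    by (rule def_intros def_pred_unary[of M "\<lambda>x. x \<in> X", OF X] def_pred_binrel[where R = R, OF R])+
  moreover have "P (lo - 1)"
    unfolding P_def using bdd by (intro exI[of _ 1]) (auto intro: less_le_trans[of "lo - 1" lo])
  moreover have "\<forall>q. P q \<longrightarrow> q \<le> hi"
  proof (intro allI impI)
    fix q assume "P q"
    then obtain \<delta> where "\<delta> > 0" "\<forall>p. p \<in> X \<longrightarrow> (\<forall>z. R p z \<longrightarrow> z \<noteq> y \<longrightarrow> \<bar>z - y\<bar> < \<delta> \<longrightarrow> q < p)"
      unfolding P_def by blast
    moreover obtain p z where "p \<in> X" "R p z" "\<bar>z - y\<bar> < \<delta>" "z \<noteq> y" using ac[OF \<open>\<delta> > 0\<close>] by blast
    ultimately have "q < p" by blast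
    then show "q \<le> hi" using bdd[OF \<open>p \<in> X\<close>] by simp
  qed
  ultimately obtain s where s: "\<forall>q. P q \<longrightarrow> q \<le> s" "\<forall>t<s. \<exists>q. P q \<and> t < q"
    by (rule def_sup)
  obtain \<epsilon> where eps: "\<epsilon> > 0" "\<forall>p\<in>X. \<bar>p - s\<bar> < \<epsilon> \<longrightarrow> p = s" using acc unfolding no_acc_point_def by blast
  have "s - \<epsilon> < s" using eps by simp
  then obtain q where q: "P q" "s - \<epsilon> < q" using s(2) by blast
  then obtain \<delta> where d: "\<delta> > 0" "\<forall>p. p \<in> X \<longrightarrow> (\<forall>z. R p z \<longrightarrow> z \<noteq> y \<longrightarrow> \<bar>z - y\<bar> < \<delta> \<longrightarrow> q < p)"
    unfolding P_def by blast
  \<comment> \<open>If \<open>s\<close> has an image other than \<open>y\<close>, shrinking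
    \<open>\<delta>\<close> keeps this single value away.\<close>
  obtain \<delta>' where d': "\<delta>' > 0" "\<delta>' \<le> \<delta>" "\<forall>z. s \<in> X \<longrightarrow> R s z \<longrightarrow> z \<noteq> y \<longrightarrow> \<delta>' \<le> \<bar>z - y\<bar>"
  proof (cases "\<exists>z. s \<in> X \<and> R s z \<and> z \<noteq> y")
    case True
    then obtain z where z: "s \<in> X" "R s z" "z \<noteq> y" by blast
    have "\<forall>z'. s \<in> X \<longrightarrow> R s z' \<longrightarrow> z' \<noteq> y \<longrightarrow> min \<delta> \<bar>z - y\<bar> \<le> \<bar>z' - y\<bar>"
      using func[OF z(1,2)] by (metis min.cobounded2)
    moreover have "min \<delta> \<bar>z - y\<bar> > 0" "min \<delta> \<bar>z - y\<bar> \<le> \<delta>" using z d(1) by auto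
    ultimately show ?thesis using that by blast
  next
    case False
    then show ?thesis using that[of \<delta>] d(1) by blast
  qed
  have "s + \<epsilon> / 2 < p" if p: "p \<in> X" "R p z" "z \<noteq> y" "\<bar>z - y\<bar> < \<delta>'" for p z
  proof -
    have "\<bar>z - y\<bar> < \<delta>" using p(4) d'(2) by simp
    then have "q < p" using d(2) p by blast
    moreover have "p \<noteq> s" using d'(3) p by (metis not_le)
    ultimately have "\<not> \<bar>p - s\<bar> < \<epsilon>" "s - \<epsilon> < p" using eps(2) p(1) q(2) by auto
    then have "s + \<epsilon> \<le> p" by (simp add: abs_if split: if_splits)
    moreover have "\<epsilon> / 2 < \<epsilon>" using eps by simp
    ultimately show ?thesis by linarith
  qed
  then have "P (s + \<epsilon> / 2)" unfolding P_def using d'(1) by blast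
  then have "s + \<epsilon> / 2 \<le> s" using s(1) by blast
  then show False using eps by simp
qed

lemma closed_sup_mem:
  assumes "closed_ivl X" "\<forall>t<s. \<exists>x\<in>X. x \<le> s \<and> t < x"
  shows "s \<in> X"
proof (rule ccontr)
  assume "s \<notin> X"
  then obtain \<epsilon> where eps: "\<epsilon> > 0" "\<forall>y. \<bar>y - s\<bar> < \<epsilon> \<longrightarrow> y \<notin> X" using assms(1) unfolding closed_ivl_def by blast
  have "s - \<epsilon> < s" using eps by simp
  then obtain x where x: "x \<in> X" "x \<le> s" "s - \<epsilon> < x" using assms(2) by blast
  then have "\<bar>x - s\<bar> < \<epsilon>" by (simp add: abs_if)
  then show False using eps x by blast
qed

lemma closed_inf_mem:
  assumes "closed_ivl X" "\<forall>t>s. \<exists>x\<in>X. s \<le> x \<and> x < t"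
  shows "s \<in> X"
proof (rule ccontr)
  assume "s \<notin> X"
  then obtain \<epsilon> where eps: "\<epsilon> > 0" "\<forall>y. \<bar>y - s\<bar> < \<epsilon> \<longrightarrow> y \<notin> X" using assms(1) unfolding closed_ivl_def by blast
  have "s + \<epsilon> > s" using eps by simp
  then obtain x where x: "x \<in> X" "s \<le> x" "x < s + \<epsilon>" using assms(2) by blast
  then have "\<bar>x - s\<bar> < \<epsilon>" by (simp add: abs_if)
  then show False using eps x by blast
qed

section \<open>Gaps of closed subsets of the line\<close>

definition gap :: "'a set \<Rightarrow> 'a \<Rightarrow> 'a \<Rightarrow> bool" where
  "gap X u v \<longleftrightarrow> u \<in> X \<and> v \<in> X \<and> u < v \<and> (\<forall>z. u < z \<longrightarrow> z < v \<longrightarrow> z \<notin> X)"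

lemma gap_exists:
  assumes X: "def_pred M (\<lambda>e. e 0 \<in> X)" "closed_ivl X"
    and m: "p \<in> X" "q \<in> X" "p < m" "m < q" "m \<notin> X"
  obtains u v where "p \<le> u" "u < m" "m < v" "v \<le> q" "gap X u v"
proof -
  have "def_pred M (\<lambda>e. e 0 \<in> X \<and> e 0 < m)" by (rule def_intros X(1))+
  moreover have "p \<in> X \<and> p < m" using m by blast
  moreover have "\<forall>x. x \<in> X \<and> x < m \<longrightarrow> x \<le> m" by simp
  ultimately obtain u where u: "\<forall>x. x \<in> X \<and> x < m \<longrightarrow> x \<le> u" "\<forall>t<u. \<exists>x. (x \<in> X \<and> x < m) \<and> t < x"
    by (rule def_sup)
  have "u \<in> X" by (rule closed_sup_mem[OF X(2)]) (use u in blast)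
  have "u \<le> m"
  proof (rule ccontr)
    assume "\<not> u \<le> m"
    then show False using u(2) by (metis less_asym not_le)
  qed
  then have "u < m" using \<open>u \<in> X\<close> m(5) by (cases "u = m") auto
  have "def_pred M (\<lambda>e. e 0 \<in> X \<and> m < e 0)" by (rule def_intros X(1))+
  moreover have "q \<in> X \<and> m < q" using m by blast
  moreover have "\<forall>x. x \<in> X \<and> m < x \<longrightarrow> m \<le> x" by simp
  ultimately obtain v where v: "\<forall>x. x \<in> X \<and> m < x \<longrightarrow> v \<le> x" "\<forall>t>v. \<exists>x. (x \<in> X \<and> m < x) \<and> x < t"
    by (rule def_inf)
  have "v \<in> X" by (rule closed_inf_mem[OF X(2)]) (use v in blast)
  have "m \<le> v"
  proof (rule ccontr)
    assume "\<not> m \<le> v"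
    then show False using v(2) by (metis less_asym not_le)
  qed
  then have "m < v" using \<open>v \<in> X\<close> m(5) by (cases "v = m") auto
  have "z \<notin> X" if "u < z" "z < v" for z
    using that u(1) v(1) m(5) by (metis linorder_neqE not_le)
  then have "gap X u v" using \<open>u \<in> X\<close> \<open>v \<in> X\<close> \<open>u < m\<close> \<open>m < v\<close> unfolding gap_def by simp
  moreover have "p \<le> u" "v \<le> q" using u(1) v(1) m by blast+
  ultimately show ?thesis using that \<open>u < m\<close> \<open>m < v\<close> by blast
qed

lemma gap_between:
  assumes X: "def_pred M (\<lambda>e. e 0 \<in> X)" "closed_ivl X" "nowhere_dense_ivl X"
    and "p \<in> X" "q \<in> X" "p < q"
  obtains u v where "p \<le> u" "v \<le> q" "gap X u v"
proof -
  obtain c d where cd: "p \<le> c" "c < d" "d \<le> q" "{c<..<d} \<inter> X = {}"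
    using X(3) \<open>p < q\<close> unfolding nowhere_dense_ivl_def by meson
  obtain m where m: "c < m" "m < d" using dense[OF cd(2)] by blast
  then have "m \<notin> X" using cd(4) by auto
  moreover have "p < m" "m < q" using m cd by auto
  ultimately obtain u v where "p \<le> u" "u < m" "m < v" "v \<le> q" "gap X u v"
    using gap_exists[OF X(1,2) assms(4,5), of m] by blast
  then show ?thesis using that by blast
qed

lemma gap_unique: "gap X u v \<Longrightarrow> gap X u v' \<Longrightarrow> v = v'"
  unfolding gap_def by (metis linorder_neqE)

text \<open>A definable stand-in for the natural numbers.\<close>

definition pseudo_N :: "'a set \<Rightarrow> bool" where
  "pseudo_N N \<longleftrightarrow> def_pred M (\<lambda>e. e 0 \<in> N) \<and> no_acc_point N \<and> (\<forall>t. \<exists>x\<in>N. t \<le> x)"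

text \<open>If \<open>X\<close> accumulates at \<open>c\<close>, its gaps near \<open>c\<close>
  become arbitrarily short, and the reciprocals of their lengths are unbounded. Reciprocals up to a
  given bound come from long gaps in a bounded interval; the left ends of these are separated, so
  \<open>no_acc_point_image\<close> applies. The reciprocals would thus form a
  \<open>pseudo_N\<close>.\<close>

lemma nowhere_dense_no_acc_point:
  assumes no_N: "\<And>N. \<not> pseudo_N N"
    and X: "def_pred M (\<lambda>e. e 0 \<in> X)" "closed_ivl X" "nowhere_dense_ivl X"
  shows "no_acc_point X"
proof (rule ccontr)
  assume "\<not> no_acc_point X"
  then obtain c where c: "\<And>\<epsilon>. \<epsilon> > 0 \<Longrightarrow> \<exists>y\<in>X. \<bar>y - c\<bar> < \<epsilon> \<and> y \<noteq> c"
    unfolding no_acc_point_def by metis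
  define G where "G u v \<longleftrightarrow> c - 1 \<le> u \<and> v \<le> c + 1 \<and> gap X u v" for u v
  have defX: "def_pred M (\<lambda>e. t e \<in> X)" if "def_term M t" for t
    by (rule def_pred_unary[of M "\<lambda>x. x \<in> X", OF X(1) that])
  have defG: "def_pred M (\<lambda>e. G (t e) (s e))" if "def_term M t" "def_term M s" for t s
  proof -
    have "def_pred M (\<lambda>e. G (e 0) (e 1))"
      unfolding G_def gap_def by (rule def_intros defX)+
    then show ?thesis using that by (rule def_pred_binrel)
  qed
  define R where "R u t \<longleftrightarrow> (\<exists>v. G u v \<and> t * (v - u) = 1)" for u t
  define N where "N = {t. \<exists>u. R u t}"
  have defR: "def_pred M (\<lambda>e. R (e 0) (e 1))"
    unfolding R_def by (rule def_intros defG)+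
  have "def_pred M (\<lambda>e. e 0 \<in> N)"
    unfolding N_def mem_Collect_eq R_def by (rule def_intros defG)+
  moreover have "no_acc_point N"
    unfolding no_acc_point_def
  proof
    fix x :: 'a
    \<comment> \<open>Reciprocals at distance less than \<open>1\<close> from \<open>x\<close> are
      at most \<open>T\<close>, so they come from gaps of length at least
      \<open>1 / T\<close>.\<close>
    define T where "T = \<bar>x\<bar> + 1"
    have T: "T > 0" unfolding T_def by (simp add: add_nonneg_pos)
    define P where "P = {u. \<exists>v. G u v \<and> 1 / T \<le> v - u}"
    have "no_acc_point P"
    proof (rule no_acc_point_separated)
      show "1 / T > 0" using T by simp
      fix u v assume "u \<in> P" "v \<in> P" "u < v"
      then obtain u' where u': "G u u'" "1 / T \<le> u' - u" unfolding P_def by blast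
      have "v \<in> X" using \<open>v \<in> P\<close> unfolding P_def G_def gap_def by blast
      then have "u' \<le> v" using u'(1) \<open>u < v\<close> unfolding G_def gap_def by (meson not_le)
      then show "1 / T \<le> v - u" using u'(2) by simp
    qed
    have "no_acc_point {z. \<exists>p\<in>P. R p z}"
    proof (rule no_acc_point_image[where lo = "c - 1" and hi = "c + 1"])
      show "def_pred M (\<lambda>e. e 0 \<in> P)"
        unfolding P_def mem_Collect_eq by (rule def_intros defG)+
      show "def_pred M (\<lambda>e. R (e 0) (e 1))" by (rule defR)
      show "c - 1 \<le> u \<and> u \<le> c + 1" if "u \<in> P" for u
        using that unfolding P_def G_def gap_def by force
      show "no_acc_point P" by fact
      show "z = z'" if "R p z" "R p z'" for p z z'
      proof -
        obtain v v' where v: "G p v" "z * (v - p) = 1" "G p v'" "z' * (v' - p) = 1"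
          using \<open>R p z\<close> \<open>R p z'\<close> unfolding R_def by blast
        then have "v = v'" unfolding G_def using gap_unique by blast
        moreover have "v - p \<noteq> 0" using v(2) by auto
        ultimately show "z = z'" using v(2,4) by (metis mult_right_cancel)
      qed
    qed
    then obtain \<epsilon> where eps: "\<epsilon> > 0" "\<forall>z\<in>{z. \<exists>p\<in>P. R p z}. \<bar>z - x\<bar> < \<epsilon> \<longrightarrow> z = x"
      unfolding no_acc_point_def by meson
    have "z = x" if z: "z \<in> N" "\<bar>z - x\<bar> < min \<epsilon> 1" for z
    proof -
      obtain u v where v: "G u v" "z * (v - u) = 1" using z(1) unfolding N_def R_def by blast
      have vu: "v - u > 0" using v(1) unfolding G_def gap_def by simp
      have "z \<le> T" using z(2) unfolding T_def by (simp add: abs_if split: if_splits)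
      have "1 \<le> T * (v - u)" using mult_right_mono[OF \<open>z \<le> T\<close>, of "v - u"] vu v(2) by simp
      then have "1 / T \<le> v - u" using T by (simp add: field_simps)
      then have "u \<in> P" unfolding P_def using v(1) by blast
      moreover have "R u z" unfolding R_def using v by blast
      ultimately have "z \<in> {z. \<exists>p\<in>P. R p z}" by blast
      moreover have "\<bar>z - x\<bar> < \<epsilon>" using z(2) by simp
      ultimately show "z = x" using eps(2) by blast
    qed
    then show "\<exists>\<epsilon>>0. \<forall>y\<in>N. \<bar>y - x\<bar> < \<epsilon> \<longrightarrow> y = x"
      using eps(1) by (intro exI[of _ "min \<epsilon> 1"]) simp
  qed
  moreover have "\<exists>x\<in>N. t \<le> x" for t
  proof -
    define T where "T = max t 1"
    \<comment> \<open>The bound \<open>1\<close> keeps the gap inside the window from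
      \<open>c - 1\<close> to \<open>c + 1\<close>; the bound \<open>1 / T\<close> makes its
      reciprocal length at least \<open>T\<close>.\<close>
    define d where "d = min 1 (1 / T)"
    have T: "T > 0" unfolding T_def by (simp add: less_max_iff_disj)
    then have d: "d > 0" "d \<le> 1" "d \<le> 1 / T" unfolding d_def by simp_all
    obtain y1 where y1: "y1 \<in> X" "\<bar>y1 - c\<bar> < d / 2" "y1 \<noteq> c" using c[of "d / 2"] d by auto
    \<comment> \<open>Being strictly closer to \<open>c\<close>, the point \<open>y2\<close> differs
      from \<open>y1\<close>; the required gap lies between the two.\<close>
    obtain y2 where y2: "y2 \<in> X" "\<bar>y2 - c\<bar> < \<bar>y1 - c\<bar>" "y2 \<noteq> c" using c[of "\<bar>y1 - c\<bar>"] y1 by auto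
    define p q where "p = min y1 y2" and "q = max y1 y2"
    have pq: "p \<in> X" "q \<in> X" "p < q" using y1 y2 unfolding p_def q_def min_def max_def by auto
    have y2': "\<bar>y2 - c\<bar> < d / 2" using y1(2) y2(2) by simp
    have near: "c - d / 2 < p" "q < c + d / 2"
    proof -
      have "c - d / 2 < y1" "y1 < c + d / 2" "c - d / 2 < y2" "y2 < c + d / 2"
        using y1(2) y2' unfolding abs_less_iff by linarith+
      then show "c - d / 2 < p" "q < c + d / 2" unfolding p_def q_def by simp_all
    qed
    obtain u v where uv: "p \<le> u" "v \<le> q" "gap X u v" using gap_between[OF X pq] .
    have vu: "v - u > 0" using uv(3) unfolding gap_def by simp
    have "G u v" unfolding G_def using uv near d(2) by simp
    then have "1 / (v - u) \<in> N" unfolding N_def R_def using vu by auto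
    moreover have "t \<le> 1 / (v - u)"
    proof -
      have "v - u \<le> d" using uv near by simp
      then have "v - u \<le> 1 / T" using d(3) by simp
      then have "T \<le> 1 / (v - u)" using vu T by (simp add: field_simps)
      then show ?thesis unfolding T_def by simp
    qed
    ultimately show ?thesis by blast
  qed
  ultimately show False using no_N unfolding pseudo_N_def by blast
qed

text \<open>Left ends of gaps may accumulate at one another, but no other midpoint lies within half
  a gap of a given midpoint; hence midpoints serve as the discrete coordinate. Left ends are all
  that is needed: on an interval without them the union has at most one point, because two points
  would lie in a common closed set of the family with index in \<open>N\<close>, which has a gap
  between them.\<close>

lemma increasing_union_with_pseudo_N:
  assumes N: "pseudo_N N"
    and R: "def_pred M (\<lambda>e. R (e 0) (e 1))"
    and closed: "\<And>t. t > 0 \<Longrightarrow> closed_ivl {x. R t x}"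
    and nd: "\<And>t. t > 0 \<Longrightarrow> nowhere_dense_ivl {x. R t x}"
    and mono: "\<And>s t x. 0 < s \<Longrightarrow> s \<le> t \<Longrightarrow> R s x \<Longrightarrow> R t x"
  shows "nowhere_dense_ivl {x. \<exists>t>0. R t x}"
proof -
  have defR: "def_pred M (\<lambda>e. R (t e) (s e))" if "def_term M t" "def_term M s" for t s
    using R that by (rule def_pred_binrel)
  have defN: "def_pred M (\<lambda>e. t e \<in> N)" if "def_term M t" for t
    using N def_pred_unary[of M "\<lambda>x. x \<in> N", OF _ that] unfolding pseudo_N_def by blast
  have defX: "def_pred M (\<lambda>e. e 0 \<in> {x. R t x})" for t
    unfolding mem_Collect_eq by (rule def_intros defR)+
  define G where "G t m u \<longleftrightarrow> t \<in> N \<and> 0 < t \<and> (\<exists>v. gap {x. R t x} u v \<and> 2 * m = u + v)" for t m u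
  \<comment> \<open>Gaps of one set with a common midpoint overlap and therefore coincide; so the
    left end is a function of index and midpoint.\<close>
  have G_unique: "u = u'" if G: "G t m u" "G t m u'" for t m u u'
  proof -
    obtain v v' where v: "gap {x. R t x} u v" "2 * m = u + v" "gap {x. R t x} u' v'" "2 * m = u' + v'"
      using G unfolding G_def by blast
    then have "u < v" "u' < v'" "R t u" "R t u'" unfolding gap_def by auto
    show ?thesis
    proof (rule ccontr)
      assume "u \<noteq> u'"
      then consider "u < u'" | "u' < u" by (rule linorder_neqE) auto
      then show False
      proof cases
        case 1
        then have "v \<le> u'" using v(1) \<open>R t u'\<close> unfolding gap_def by (metis mem_Collect_eq not_le)
        then show False using v(2,4) \<open>u < v\<close> \<open>u' < v'\<close> by linarith
      next
        case 2
        then have "v' \<le> u" using v(3) \<open>R t u\<close> unfolding gap_def by (metis mem_Collect_eq not_le)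
        then show False using v(2,4) \<open>u < v\<close> \<open>u' < v'\<close> by linarith
      qed
    qed
  qed
  define D where "D = {p \<in> carrier_vec 2. \<exists>u. G (p $ 0) (p $ 1) u}"
  define g where "g p = (THE u. G (p $ 0) (p $ 1) u)" for p :: "'a vec"
  have g: "g p = u" if "G (p $ 0) (p $ 1) u" for p u
    unfolding g_def using that by (rule the_equality) (rule G_unique[OF _ that])
  have defG: "def_pred M (\<lambda>e. G (t e) (m e) (u e))" if "def_term M t" "def_term M m" "def_term M u" for t m u
  proof -
    have "def_pred M (\<lambda>e. G (vec 3 e $ 0) (vec 3 e $ 1) (vec 3 e $ 2))"
    proof -
      have "def_pred M (\<lambda>e. G (e 0) (e 1) (e 2))"
        unfolding G_def gap_def mem_Collect_eq by (rule def_intros defR defN)+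
      then show ?thesis by simp
    qed
    moreover have "def_vec M 3 (\<lambda>e. vec 3 (\<lambda>i. if i = 0 then t e else if i = 1 then m e else u e))"
    proof (rule def_vec_vec)
      fix i assume "i < (3::nat)"
      show "def_term M (\<lambda>e. if i = 0 then t e else if i = 1 then m e else u e)"
        using that by (cases "i = 0"; cases "i = 1") simp_all
    qed
    ultimately have "def_pred M (\<lambda>e. (\<lambda>x. G (x $ 0) (x $ 1) (x $ 2)) (vec 3 (\<lambda>i. if i = 0 then t e else if i = 1 then m e else u e)))"
      by (rule def_pred_subst_vec[where R = "\<lambda>x. G (x $ 0) (x $ 1) (x $ 2)"])
    then show ?thesis by simp
  qed
  have "definable M 2 D"
    unfolding definable_iff_def_set
  proof
    show "D \<subseteq> carrier_vec 2" unfolding D_def by blast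
    have "def_pred M (\<lambda>e. \<exists>u. G (e 0) (e 1) u)" by (rule def_intros defG)+
    then show "def_set M 2 D" unfolding def_set_def D_def by simp
  qed
  moreover have "discrete_in (vec_topology 2) D"
  proof (rule discrete_in_vec_topology)
    show "D \<subseteq> carrier_vec 2" unfolding D_def by blast
    fix p assume p: "p \<in> D"
    then obtain u v where u: "p $ 0 \<in> N" "0 < p $ 0" "gap {x. R (p $ 0) x} u v" "2 * p $ 1 = u + v"
      unfolding D_def G_def by blast
    have "u < v" using u(3) unfolding gap_def by blast
    obtain \<epsilon> where eps: "\<epsilon> > 0" "\<forall>y\<in>N. \<bar>y - p $ 0\<bar> < \<epsilon> \<longrightarrow> y = p $ 0"
      using N unfolding pseudo_N_def no_acc_point_def by blast
    define r where "r = min \<epsilon> ((v - u) / 2)"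
    have "q = p" if q: "q \<in> cube 2 p r" "q \<in> D" for q
    proof -
      obtain u' v' where u': "q $ 0 \<in> N" "0 < q $ 0" "gap {x. R (q $ 0) x} u' v'" "2 * q $ 1 = u' + v'"
        using q(2) unfolding D_def G_def by blast
      have ab: "\<bar>q $ 0 - p $ 0\<bar> < r" "\<bar>q $ 1 - p $ 1\<bar> < r" using q(1) unfolding cube_def by auto
      have t: "q $ 0 = p $ 0" using ab(1) eps(2) u'(1) unfolding r_def by simp
      have ab': "\<bar>q $ 1 - p $ 1\<bar> < (v - u) / 2" using ab(2) unfolding r_def by simp
      \<comment> \<open>The midpoint of the gap coded by \<open>q\<close> lies inside the gap coded
        by \<open>p\<close>, and gaps with a common interior point are equal.\<close>
      have ab2: "u < q $ 1" "q $ 1 < v"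
        using ab' u(4) unfolding abs_less_iff by (simp_all add: field_simps)
      have "u' < v'" "R (p $ 0) u'" "R (p $ 0) v'" using u'(3) t unfolding gap_def by auto
      then have "u' < q $ 1" "q $ 1 < v'" using u'(4) by (simp_all add: field_simps)
      have "u' \<le> u" using u(3) \<open>R (p $ 0) u'\<close> \<open>u' < q $ 1\<close> ab2 unfolding gap_def
        by (metis less_trans mem_Collect_eq not_le)
      have "v \<le> v'" using u(3) \<open>R (p $ 0) v'\<close> \<open>q $ 1 < v'\<close> ab2 unfolding gap_def
        by (metis less_trans mem_Collect_eq not_le)
      have "R (p $ 0) u" "R (p $ 0) v" using u(3) unfolding gap_def by auto
      then have "u \<le> u'" "v' \<le> v" using u'(3) t ab2 \<open>u' < q $ 1\<close> \<open>q $ 1 < v'\<close> unfolding gap_def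
        by (metis less_trans mem_Collect_eq not_le)+
      then have "u = u'" "v = v'" using \<open>u' \<le> u\<close> \<open>v \<le> v'\<close> by auto
      then have "q $ 1 = p $ 1" using u(4) u'(4) by simp
      show "q = p"
      proof (rule eq_vecI)
        have c: "q \<in> carrier_vec 2" "p \<in> carrier_vec 2" using p q unfolding D_def by auto
        then show "dim_vec q = dim_vec p" by simp
        fix i assume "i < dim_vec p"
        then have "i = 0 \<or> i = 1" using c by auto
        then show "q $ i = p $ i" using t \<open>q $ 1 = p $ 1\<close> by auto
      qed
    qed
    moreover have "r > 0" unfolding r_def using eps(1) \<open>u < v\<close> by simp
    ultimately show "\<exists>r>0. cube 2 p r \<inter> D \<subseteq> {p}" by blast
  qed
  moreover have "definable_map M 2 1 D (\<lambda>x. point_vec (g x))"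
    unfolding definable_map_def definable_iff_def_set
  proof (intro conjI)
    show "D \<subseteq> carrier_vec 2" unfolding D_def by blast
    show "(\<lambda>x. point_vec (g x)) ` D \<subseteq> carrier_vec 1" by (auto simp: point_vec_def)
    have "x @\<^sub>v point_vec (g x) \<in> carrier_vec (2 + 1)" if "x \<in> D" for x
    proof (rule append_carrier_vec)
      show "x \<in> carrier_vec 2" using \<open>x \<in> D\<close> unfolding D_def by blast
    qed (simp add: point_vec_def)
    then show "(\<lambda>x. x @\<^sub>v point_vec (g x)) ` D \<subseteq> carrier_vec (2 + 1)" by (rule image_subsetI)
    have mem: "vec (2 + 1) e \<in> (\<lambda>x. x @\<^sub>v point_vec (g x)) ` D \<longleftrightarrow> G (e 0) (e 1) (e 2)" for e
    proof
      assume "vec (2 + 1) e \<in> (\<lambda>x. x @\<^sub>v point_vec (g x)) ` D"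
      then obtain x where x: "x \<in> D" "vec (2 + 1) e = x @\<^sub>v point_vec (g x)" by (elim imageE)
      have c: "dim_vec x = 2" using x(1) unfolding D_def by auto
      have i: "vec (2 + 1) e $ i = (x @\<^sub>v point_vec (g x)) $ i" for i using x(2) by simp
      have "e 0 = x $ 0" "e 1 = x $ 1" "e 2 = g x"
        using i[of 0] i[of 1] i[of 2] c by (simp_all add: point_vec_def)
      moreover obtain u where "G (x $ 0) (x $ 1) u" using x(1) unfolding D_def by blast
      ultimately show "G (e 0) (e 1) (e 2)" using g by simp
    next
      assume G: "G (e 0) (e 1) (e 2)"
      then have "vec 2 e \<in> D" unfolding D_def by auto
      moreover have "g (vec 2 e) = e 2" by (rule g) (use G in simp)
      moreover have "vec (2 + 1) e = vec 2 e @\<^sub>v point_vec (e 2)"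
      proof (rule eq_vecI)
        show "dim_vec (vec (2 + 1) e) = dim_vec (vec 2 e @\<^sub>v point_vec (e 2))" by (simp add: point_vec_def)
        fix i assume i: "i < dim_vec (vec 2 e @\<^sub>v point_vec (e 2))"
        then have "i < 3" by (simp add: point_vec_def)
        then show "vec (2 + 1) e $ i = (vec 2 e @\<^sub>v point_vec (e 2)) $ i"
          by (cases "i < 2") (auto simp: point_vec_def less_Suc_eq numeral_3_eq_3 numeral_2_eq_2)
      qed
      ultimately show "vec (2 + 1) e \<in> (\<lambda>x. x @\<^sub>v point_vec (g x)) ` D"
        by (intro image_eqI[of _ _ "vec 2 e"]) simp_all
    qed
    show "def_set M (2 + 1) ((\<lambda>x. x @\<^sub>v point_vec (g x)) ` D)"
      unfolding def_set_def mem by (rule defG def_intros)+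
  qed
  ultimately have "nowhere_dense_in euclidean (g ` D)"
    using restrained unfolding restrained_def by blast
  then have ndg: "nowhere_dense_ivl (g ` D)" by (rule nowhere_dense_in_euclidean)
  have left_end: "u \<in> g ` D" if "t \<in> N" "t > 0" "gap {x. R t x} u v" for t u v
  proof -
    define p where "p = vec 2 (\<lambda>i. if i = 0 then t else (u + v) / 2)"
    have "G (p $ 0) (p $ 1) u" unfolding G_def p_def using that by auto
    moreover from this have "p \<in> D" unfolding D_def p_def by auto
    ultimately show ?thesis using g by blast
  qed
  show ?thesis
    unfolding nowhere_dense_ivl_def
  proof (intro allI impI)
    fix a b :: 'a assume "a < b"
    then obtain c d where cd: "a \<le> c" "c < d" "d \<le> b" "{c<..<d} \<inter> g ` D = {}"
      using ndg unfolding nowhere_dense_ivl_def by meson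
    have single: "\<not> p < q" if p: "p \<in> {c<..<d}" "s > 0" "R s p" and q: "q \<in> {c<..<d}" "s' > 0" "R s' q" for p q s s'
    proof
      assume "p < q"
      \<comment> \<open>Unboundedness of \<open>N\<close> supplies an index in \<open>N\<close> at
        which both points are present.\<close>
      obtain t where t: "t \<in> N" "max s s' \<le> t" using N unfolding pseudo_N_def by blast
      then have "t > 0" "R t p" "R t q" using p q mono[of s t p] mono[of s' t q] by auto
      then have "p \<in> {x. R t x}" "q \<in> {x. R t x}" by simp_all
      then obtain u v where uv: "p \<le> u" "v \<le> q" "gap {x. R t x} u v"
        by (rule gap_between[OF defX closed[OF \<open>t > 0\<close>] nd[OF \<open>t > 0\<close>] _ _ \<open>p < q\<close>])
      then have "u < v" unfolding gap_def by blast
      then have "u \<in> {c<..<d}" using uv p q by simp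
      then show False using cd(4) left_end[OF t(1) \<open>t > 0\<close> uv(3)] by blast
    qed
    \<comment> \<open>At most one point \<open>p\<close> of the union lies in the interval, so the
      part to the right of \<open>p\<close> is free of it.\<close>
    show "\<exists>c d. a \<le> c \<and> c < d \<and> d \<le> b \<and> {c<..<d} \<inter> {x. \<exists>t>0. R t x} = {}"
    proof (cases "\<exists>p s. p \<in> {c<..<d} \<and> s > 0 \<and> R s p")
      case False
      then have "{c<..<d} \<inter> {x. \<exists>t>0. R t x} = {}" by blast
      with cd(1,2,3) show ?thesis by (intro exI[of _ c] exI[of _ d] conjI)
    next
      case True
      then obtain p s where p: "p \<in> {c<..<d}" "s > 0" "R s p" by blast
      have "{p<..<d} \<inter> {x. \<exists>t>0. R t x} = {}"
      proof (rule ccontr)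
        assume "{p<..<d} \<inter> {x. \<exists>t>0. R t x} \<noteq> {}"
        then obtain q s' where q: "q \<in> {p<..<d}" "s' > 0" "R s' q" by blast
        have "q \<in> {c<..<d}" using p(1) q(1) by simp
        from single[OF p this q(2,3)] q(1) show False by simp
      qed
      moreover have "a \<le> p" "p < d" using p(1) cd(1) by simp_all
      ultimately show ?thesis using cd(3) by (intro exI[of _ p] exI[of _ d] conjI)
    qed
  qed
qed

text \<open>Each point of the union has a time of birth, the infimum of the indices at which it is
  present. Without a \<open>pseudo_N\<close> every single set of the family has no accumulation
  points, so by \<open>no_acc_point_image\<close> the births of the points of a bounded interval
  have none either. Not forming a \<open>pseudo_N\<close>, they are bounded above, and a single set
  exhausts the union on that interval.\<close>

lemma increasing_union_without_pseudo_N: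
  assumes no_N: "\<And>N. \<not> pseudo_N N"
    and R: "def_pred M (\<lambda>e. R (e 0) (e 1))"
    and closed: "\<And>t. t > 0 \<Longrightarrow> closed_ivl {x. R t x}"
    and nd: "\<And>t. t > 0 \<Longrightarrow> nowhere_dense_ivl {x. R t x}"
    and mono: "\<And>s t x. 0 < s \<Longrightarrow> s \<le> t \<Longrightarrow> R s x \<Longrightarrow> R t x"
  shows "nowhere_dense_ivl {x. \<exists>t>0. R t x}"
  unfolding nowhere_dense_ivl_def
proof (intro allI impI)
  fix a b :: 'a assume ab: "a < b"
  have defR: "def_pred M (\<lambda>e. R (t e) (s e))" if "def_term M t" "def_term M s" for t s
    using R that by (rule def_pred_binrel)
  have defX: "def_pred M (\<lambda>e. e 0 \<in> {x. R t x})" for t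
    unfolding mem_Collect_eq by (rule def_intros defR)+
  define birth where "birth x \<beta> \<longleftrightarrow> (\<forall>t. 0 < t \<longrightarrow> R t x \<longrightarrow> \<beta> \<le> t) \<and>
    (\<forall>s. \<beta> < s \<longrightarrow> (\<exists>t. 0 < t \<and> t < s \<and> R t x))" for x \<beta>
  have def_birth: "def_pred M (\<lambda>e. birth (t e) (s e))" if "def_term M t" "def_term M s" for t s
  proof -
    have "def_pred M (\<lambda>e. birth (e 0) (e 1))"
      unfolding birth_def by (rule def_intros defR)+
    then show ?thesis using that by (rule def_pred_binrel)
  qed
  have birth_unique: "\<beta> = \<beta>'" if "birth x \<beta>" "birth x \<beta>'" for x \<beta> \<beta>'
  proof -
    have "\<not> \<beta> < \<beta>'" if "birth x \<beta>" "birth x \<beta>'" for \<beta> \<beta>'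
      using that unfolding birth_def by (meson not_le)
    then show ?thesis using that by (meson linorder_neqE)
  qed
  define B where "B = {\<beta>. \<exists>x. a < x \<and> x < b \<and> birth x \<beta>}"
  have defB: "def_pred M (\<lambda>e. e 0 \<in> B)"
    unfolding B_def mem_Collect_eq by (rule def_intros def_birth)+
  have "no_acc_point B"
    unfolding no_acc_point_def
  proof
    fix y :: 'a
    \<comment> \<open>Points born at distance less than \<open>1\<close> from \<open>y\<close> are
      already present at index \<open>s\<close>; the maximum with \<open>1\<close> keeps the index
      positive.\<close>
    define s where "s = max (y + 1) 1"
    have s: "s > 0" "y + 1 \<le> s" unfolding s_def by (auto simp: less_max_iff_disj)
    define P where "P = {x. a < x \<and> x < b \<and> R s x}"
    have "no_acc_point {x. R s x}"
      by (rule nowhere_dense_no_acc_point[OF no_N defX closed[OF s(1)] nd[OF s(1)]])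
    then have "no_acc_point P" by (rule no_acc_point_subset) (auto simp: P_def)
    have "no_acc_point {\<beta>. \<exists>p\<in>P. birth p \<beta>}"
    proof (rule no_acc_point_image[where lo = a and hi = b])
      show "def_pred M (\<lambda>e. e 0 \<in> P)"
        unfolding P_def mem_Collect_eq by (rule def_intros defR)+
      show "def_pred M (\<lambda>e. birth (e 0) (e 1))" by (rule def_birth def_intros)+
      show "a \<le> x \<and> x \<le> b" if "x \<in> P" for x using that unfolding P_def by auto
      show "no_acc_point P" by fact
      show "z = z'" if "birth p z" "birth p z'" for p z z' using that by (rule birth_unique)
    qed
    then obtain \<epsilon> where eps: "\<epsilon> > 0" "\<forall>\<beta>\<in>{\<beta>. \<exists>p\<in>P. birth p \<beta>}. \<bar>\<beta> - y\<bar> < \<epsilon> \<longrightarrow> \<beta> = y"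
      unfolding no_acc_point_def by meson
    have "\<beta> = y" if beta: "\<beta> \<in> B" "\<bar>\<beta> - y\<bar> < min \<epsilon> 1" for \<beta>
    proof -
      obtain x where x: "a < x" "x < b" "birth x \<beta>" using beta(1) unfolding B_def by blast
      have "\<beta> < s" using beta(2) s(2) by (simp add: abs_if split: if_splits)
      then obtain t where "0 < t" "t < s" "R t x" using x(3) unfolding birth_def by blast
      then have "R s x" using mono[of t s x] by simp
      then have "x \<in> P" using x unfolding P_def by blast
      then show ?thesis using eps(2) x(3) beta(2) by auto
    qed
    then show "\<exists>\<epsilon>>0. \<forall>z\<in>B. \<bar>z - y\<bar> < \<epsilon> \<longrightarrow> z = y"
      using eps(1) by (intro exI[of _ "min \<epsilon> 1"]) simp
  qed
  then obtain T where T: "\<not> (\<exists>x\<in>B. T \<le> x)"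
    using no_N[of B] defB unfolding pseudo_N_def by blast
  define T' where "T' = max T 1"
  have T': "T' > 0" "T \<le> T'" unfolding T'_def by (auto simp: less_max_iff_disj)
  have sub: "R T' x" if x: "a < x" "x < b" and t: "t > 0" "R t x" for x t
  proof -
    have "def_pred M (\<lambda>e. 0 < e 0 \<and> R (e 0) x)" by (rule def_intros defR)+
    moreover have "0 < t \<and> R t x" using t by blast
    moreover have "\<forall>t. 0 < t \<and> R t x \<longrightarrow> 0 \<le> t" by simp
    ultimately obtain \<beta> where beta: "\<forall>t. 0 < t \<and> R t x \<longrightarrow> \<beta> \<le> t" "\<forall>s>\<beta>. \<exists>t. (0 < t \<and> R t x) \<and> t < s"
      by (rule def_inf)
    then have "birth x \<beta>" unfolding birth_def by blast
    then have "\<beta> \<in> B" unfolding B_def using x by blast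
    \<comment> \<open>Strictness matters, as the infimum need not be attained: there is still some
      \<open>t' < T'\<close> at which \<open>x\<close> is present.\<close>
    then have "\<beta> < T'" using T T'(2) by (meson less_le_trans not_le)
    then obtain t' where "0 < t'" "R t' x" "t' < T'" using beta(2) by blast
    then show ?thesis using mono[of t' T' x] by simp
  qed
  obtain c d where cd: "a \<le> c" "c < d" "d \<le> b" "{c<..<d} \<inter> {x. R T' x} = {}"
    using nd[OF T'(1)] ab unfolding nowhere_dense_ivl_def by meson
  have "{c<..<d} \<inter> {x. \<exists>t>0. R t x} = {}"
  proof (rule ccontr)
    assume "{c<..<d} \<inter> {x. \<exists>t>0. R t x} \<noteq> {}"
    then obtain x t where x: "c < x" "x < d" "t > 0" "R t x" by auto
    then have "R T' x" using sub[of x t] cd by simp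
    then show False using cd(4) x by auto
  qed
  with cd(1,2,3) show "\<exists>c d. a \<le> c \<and> c < d \<and> d \<le> b \<and> {c<..<d} \<inter> {x. \<exists>t>0. R t x} = {}"
    by (intro exI[of _ c] exI[of _ d] conjI)
qed

lemma increasing_union_ivl:
  assumes "def_pred M (\<lambda>e. R (e 0) (e 1))"
    and "\<And>t. t > 0 \<Longrightarrow> closed_ivl {x. R t x}"
    and "\<And>t. t > 0 \<Longrightarrow> nowhere_dense_ivl {x. R t x}"
    and "\<And>s t x. 0 < s \<Longrightarrow> s \<le> t \<Longrightarrow> R s x \<Longrightarrow> R t x"
  shows "nowhere_dense_ivl {x. \<exists>t>0. R t x}"
proof (cases "\<exists>N. pseudo_N N")
  case True
  then obtain N where "pseudo_N N" ..
  then show ?thesis using assms by (rule increasing_union_with_pseudo_N)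
next
  case False
  then have "\<And>N. \<not> pseudo_N N" by blast
  then show ?thesis using assms by (rule increasing_union_without_pseudo_N)
qed

end

section \<open>Increasing unions of nowhere dense sets in several dimensions\<close>

lemma def_pred_carrier:
  assumes "def_vec M n v" shows "def_pred M (\<lambda>e. v e \<in> carrier_vec n)"
proof -
  have "v e \<in> carrier_vec n \<longleftrightarrow> True" for e using def_vec_carrier[OF assms] by blast
  then show ?thesis using def_pred_const[of M True] by (simp only:)
qed

lemma cube_center_radius: "y \<in> cube n x r \<Longrightarrow> i < n \<Longrightarrow> \<bar>y $ i - x $ i\<bar> < r"
  by (simp add: cube_def)

lemma vCons_decompose:
  assumes "v \<in> carrier_vec (Suc n)"
  obtains a x where "v = vCons a x" "x \<in> carrier_vec n"
proof -
  have "v = vCons (v $ 0) (vec n (\<lambda>i. v $ Suc i))"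
  proof (rule eq_vecI)
    show "dim_vec v = dim_vec (vCons (v $ 0) (vec n (\<lambda>i. v $ Suc i)))" using assms by simp
    fix i assume "i < dim_vec (vCons (v $ 0) (vec n (\<lambda>i. v $ Suc i)))"
    then show "v $ i = vCons (v $ 0) (vec n (\<lambda>i. v $ Suc i)) $ i" by (cases i) simp_all
  qed
  moreover have "vec n (\<lambda>i. v $ Suc i) \<in> carrier_vec n" by simp
  ultimately show ?thesis by (rule that)
qed

lemma vCons_in_cube:
  assumes "x \<in> carrier_vec n"
  shows "vCons w x \<in> cube (Suc n) (vCons c u) r \<longleftrightarrow> \<bar>w - c\<bar> < r \<and> x \<in> cube n u r"
  unfolding cube_def using assms by (auto simp: All_less_Suc2)

lemma cube_vConsE:
  assumes "y \<in> cube (Suc n) (vCons c u) r"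
  obtains w x where "y = vCons w x" "\<bar>w - c\<bar> < r" "x \<in> cube n u r"
proof -
  obtain w x where y: "y = vCons w x" "x \<in> carrier_vec n"
    by (rule vCons_decompose[OF cube_carrier[OF assms]])
  then have "\<bar>w - c\<bar> < r \<and> x \<in> cube n u r" using assms vCons_in_cube[OF y(2)] by metis
  then show ?thesis using that y(1) by blast
qed

lemma nowhere_dense_cubesI_dense:
  assumes "\<And>x r. x \<in> carrier_vec n \<Longrightarrow> r > 0 \<Longrightarrow> dense_in_cube n S x r \<Longrightarrow> False"
  shows "nowhere_dense_cubes n S"
  unfolding nowhere_dense_cubes_def using assms by blast

lemma not_nowhere_denseE:
  assumes "\<not> nowhere_dense_cubes n S"
  obtains x r where "x \<in> carrier_vec n" "r > 0" "dense_in_cube n S x r"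
  using assms unfolding nowhere_dense_cubes_def by blast

lemma dense_in_cube_meets:
  assumes "dense_in_cube n S x r" "y \<in> carrier_vec n" "s > 0" "cube n y s \<subseteq> cube n x r"
  obtains z where "z \<in> cube n y s" "z \<in> S"
  using assms unfolding dense_in_cube_def by blast

lemma dense_subcube:
  assumes S: "S \<subseteq> cube n u r" and d: "dense_in_cube n S x s" "x \<in> carrier_vec n" "s > 0"
  obtains y t where "y \<in> carrier_vec n" "t > 0" "cube n y t \<subseteq> cube n x s" "cube n y t \<subseteq> cube n u r"
    "dense_in_cube n S y t"
proof -
  obtain z where z: "z \<in> cube n x s" "z \<in> S" by (rule dense_in_cube_meets[OF d(1-3) order_refl])
  obtain t where t: "t > 0" "cube n z t \<subseteq> cube n x s" "cube n z t \<subseteq> cube n u r"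
    using z S by (elim cube_refine[of z n x s u r]) blast+
  show ?thesis using t cube_carrier[OF z(1)] dense_in_subcube[OF d(1) t(2)] by (intro that)
qed

lemma cube_not_nowhere_dense:
  assumes "x \<in> carrier_vec n" "r > 0" "cube n x r \<subseteq> S"
  shows "\<not> nowhere_dense_cubes n S"
proof
  assume "nowhere_dense_cubes n S"
  then obtain y s where "y \<in> carrier_vec n" "s > 0" "cube n y s \<subseteq> cube n x r" "cube n y s \<inter> S = {}"
    using assms(1,2) by (rule nowhere_dense_cubesD)
  then show False using center_in_cube[of y n s] assms(3) by blast
qed

context restrained_expansion
begin

text \<open>This replaces the countably many rational intervals of the classical argument. Let
  \<open>\<sigma>\<close> be the supremum of the \<open>z\<close> that bound all left ends from
  below over some subcube. Over a cube that nearly realizes \<open>\<sigma>\<close> the left ends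
  are not much below \<open>\<sigma>\<close>, while each of its subcubes has a left end not much
  above \<open>\<sigma>\<close>. Intervals of length \<open>\<delta>\<close> that begin so close
  together share a closed interval of half the length.\<close>

lemma uniform_interval:
  assumes W: "def_set M (Suc n) W" and Y: "def_set M n Y"
    and u: "u \<in> carrier_vec n" "r > 0" "dense_in_cube n Y u r" and "\<delta> > 0"
    and good: "\<And>x. x \<in> Y \<Longrightarrow>
      \<exists>z. lo \<le> z \<and> z + \<delta> \<le> hi \<and> (\<forall>w. z < w \<longrightarrow> w < z + \<delta> \<longrightarrow> vCons w x \<in> W)"
  obtains v s z where "v \<in> carrier_vec n" "s > 0" "cube n v s \<subseteq> cube n u r" "lo \<le> z" "z + \<delta> / 2 \<le> hi"
    "dense_in_cube n {x \<in> Y. \<forall>w. z \<le> w \<longrightarrow> w \<le> z + \<delta> / 2 \<longrightarrow> vCons w x \<in> W} v s"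
proof -
  define g where "g x z \<longleftrightarrow> lo \<le> z \<and> z + \<delta> \<le> hi \<and> (\<forall>w. z < w \<longrightarrow> w < z + \<delta> \<longrightarrow> vCons w x \<in> W)" for x z
  define P where "P z \<longleftrightarrow> (\<exists>v\<in>carrier_vec n. \<exists>s. 0 < s \<and>
      (\<forall>x\<in>carrier_vec n. x \<in> cube n v s \<longrightarrow> x \<in> cube n u r) \<and>
      (\<forall>x\<in>carrier_vec n. x \<in> cube n v s \<longrightarrow> x \<in> Y \<longrightarrow> (\<forall>z'. g x z' \<longrightarrow> z \<le> z')))" for z
  have "def_pred M (\<lambda>e. P (e 0))"
    unfolding P_def g_def
    by (rule def_intros def_pred_mem_cube def_set_mem[OF W] def_set_mem[OF Y] def_vec_const[OF u(1)])+
  moreover have "P lo"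
    unfolding P_def g_def using u by (intro bexI[of _ u] exI[of _ r]) auto
  moreover have "\<forall>z. P z \<longrightarrow> z \<le> hi"
  proof (intro allI impI)
    fix z assume "P z"
    then obtain v s where v: "v \<in> carrier_vec n" "0 < s" "cube n v s \<subseteq> cube n u r"
      "\<forall>x\<in>carrier_vec n. x \<in> cube n v s \<longrightarrow> x \<in> Y \<longrightarrow> (\<forall>z'. g x z' \<longrightarrow> z \<le> z')"
      unfolding P_def using cube_carrier by blast
    obtain x where x: "x \<in> cube n v s" "x \<in> Y" by (rule dense_in_cube_meets[OF u(3) v(1-3)])
    obtain z' where z': "g x z'" using good[OF x(2)] unfolding g_def by blast
    then have "z \<le> z'" using v(4) x cube_carrier[OF x(1)] by blast
    then show "z \<le> hi" using z' \<open>\<delta> > 0\<close> unfolding g_def by linarith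
  qed
  ultimately obtain \<sigma> where sigma: "\<forall>z. P z \<longrightarrow> z \<le> \<sigma>" "\<forall>t<\<sigma>. \<exists>z. P z \<and> t < z"
    by (rule def_sup)
  have "\<sigma> - \<delta> / 8 < \<sigma>" using \<open>\<delta> > 0\<close> by simp
  then obtain z1 where z1: "P z1" "\<sigma> - \<delta> / 8 < z1" using sigma(2) by blast
  then obtain v s where v: "v \<in> carrier_vec n" "0 < s" "cube n v s \<subseteq> cube n u r"
    "\<forall>x\<in>carrier_vec n. x \<in> cube n v s \<longrightarrow> x \<in> Y \<longrightarrow> (\<forall>z'. g x z' \<longrightarrow> z1 \<le> z')"
    unfolding P_def using cube_carrier by blast
  \<comment> \<open>An interval of length \<open>\<delta>\<close> with left end between
    \<open>\<sigma> - \<delta> / 8\<close> and \<open>\<sigma> + \<delta> / 8\<close> contains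
    everything from \<open>\<sigma> + \<delta> / 4\<close> to
    \<open>\<sigma> + 3 * \<delta> / 4\<close>.\<close>
  define z where "z = \<sigma> + \<delta> / 4"
  define G where "G = {x \<in> Y. \<forall>w. z \<le> w \<longrightarrow> w \<le> z + \<delta> / 2 \<longrightarrow> vCons w x \<in> W}"
  have key: "\<exists>x z'. x \<in> cube n y t \<and> x \<in> G \<and> g x z' \<and> z1 \<le> z' \<and> z' < \<sigma> + \<delta> / 8"
    if y: "y \<in> carrier_vec n" "t > 0" "cube n y t \<subseteq> cube n v s" for y t
  proof -
    have "\<not> \<sigma> + \<delta> / 8 \<le> \<sigma>" using \<open>\<delta> > 0\<close> by simp
    then have "\<not> P (\<sigma> + \<delta> / 8)" using sigma(1) by blast
    then obtain x z' where x: "x \<in> carrier_vec n" "x \<in> cube n y t" "x \<in> Y" "g x z'" "\<not> \<sigma> + \<delta> / 8 \<le> z'"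
      unfolding P_def using y v(3) by blast
    have z': "z1 \<le> z'" using v(4) x y(3) by blast
    have "vCons w x \<in> W" if "z \<le> w" "w \<le> z + \<delta> / 2" for w
    proof -
      have "z' < w" using that(1) x(5) \<open>\<delta> > 0\<close> unfolding z_def by linarith
      moreover have "w < z' + \<delta>" using that(2) z1(2) z' \<open>\<delta> > 0\<close> unfolding z_def by linarith
      ultimately show ?thesis using x(4) unfolding g_def by blast
    qed
    then have "x \<in> G" unfolding G_def using x(3) by blast
    then show ?thesis using x z' by (intro exI[of _ x] exI[of _ z']) simp
  qed
  obtain x z' where x: "g x z'" "z1 \<le> z'" "z' < \<sigma> + \<delta> / 8"
    using key[OF v(1,2) order_refl] by blast
  have "lo \<le> z" using x \<open>\<delta> > 0\<close> unfolding g_def z_def by linarith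
  moreover have "z + \<delta> / 2 \<le> hi" using x z1(2) \<open>\<delta> > 0\<close> unfolding g_def z_def by linarith
  moreover have "dense_in_cube n G v s" unfolding dense_in_cube_def using key by blast
  ultimately show ?thesis using that[OF v(1-3)] unfolding G_def by blast
qed

lemma closed_fibre_ivl:
  assumes B: "closed_cubes (Suc n) B" and x: "x \<in> carrier_vec n"
  shows "closed_ivl {w. lo \<le> w \<and> w \<le> hi \<and> vCons w x \<in> B}"
  unfolding closed_ivl_def
proof (intro allI impI)
  fix w assume "w \<notin> {w. lo \<le> w \<and> w \<le> hi \<and> vCons w x \<in> B}"
  then consider "w < lo" | "hi < w" | "vCons w x \<notin> B" by force
  then show "\<exists>\<epsilon>>0. \<forall>y. \<bar>y - w\<bar> < \<epsilon> \<longrightarrow> y \<notin> {w. lo \<le> w \<and> w \<le> hi \<and> vCons w x \<in> B}"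
  proof cases
    case 1
    then show ?thesis by (intro exI[of _ "lo - w"]) (auto simp: abs_less_iff)
  next
    case 2
    then show ?thesis by (intro exI[of _ "w - hi"]) (auto simp: abs_less_iff)
  next
    case 3
    have "vCons w x \<in> carrier_vec (Suc n)" using x by simp
    then obtain \<epsilon> where eps: "\<epsilon> > 0" "cube (Suc n) (vCons w x) \<epsilon> \<inter> B = {}"
      using B 3 unfolding closed_cubes_def by blast
    have "vCons y x \<notin> B" if "\<bar>y - w\<bar> < \<epsilon>" for y
    proof -
      have "vCons y x \<in> cube (Suc n) (vCons w x) \<epsilon>"
        unfolding vCons_in_cube[OF x] using that center_in_cube[OF x eps(1)] by blast
      then show ?thesis using eps(2) by blast
    qed
    then show ?thesis using eps(1) by blast
  qed
qed

text \<open>The tube lemma, with a supremum in place of the compactness of the interval. Let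
  \<open>s\<close> be the supremum of the heights \<open>q\<close> up to which the fibres over some
  cube around \<open>x\<close> avoid \<open>A\<close>. A small cube around the point of height
  \<open>s\<close> over \<open>x\<close> is disjoint from \<open>A\<close> and carries the property
  beyond \<open>s\<close>.\<close>

lemma closed_projection_step:
  assumes A: "def_set M (Suc n) A" "closed_cubes (Suc n) A"
  shows "closed_cubes n {x \<in> carrier_vec n. \<exists>w. a \<le> w \<and> w \<le> b \<and> vCons w x \<in> A}"
  unfolding closed_cubes_def
proof
  let ?S = "{x \<in> carrier_vec n. \<exists>w. a \<le> w \<and> w \<le> b \<and> vCons w x \<in> A}"
  fix x assume "x \<in> carrier_vec n - ?S"
  then have x: "x \<in> carrier_vec n" "\<And>w. a \<le> w \<Longrightarrow> w \<le> b \<Longrightarrow> vCons w x \<notin> A" by blast+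
  define P where "P q \<longleftrightarrow> (\<exists>r. 0 < r \<and> (\<forall>x'\<in>carrier_vec n. x' \<in> cube n x r \<longrightarrow>
      (\<forall>w. a \<le> w \<longrightarrow> w \<le> b \<longrightarrow> w \<le> q \<longrightarrow> \<not> vCons w x' \<in> A)))" for q
  have "P b"
  proof (rule ccontr)
    assume nb: "\<not> P b"
    have "def_pred M (\<lambda>e. P (e 0))"
      unfolding P_def by (rule def_intros def_pred_mem_cube def_set_mem[OF A(1)] def_vec_const[OF x(1)])+
    moreover have below_a: "P q" if "q < a" for q
      unfolding P_def using that by (intro exI[of _ 1]) auto
    then have "P (a - 1)" by simp
    moreover have "\<forall>q. P q \<longrightarrow> q \<le> b"
    proof (intro allI impI, rule ccontr)
      fix q assume "P q" "\<not> q \<le> b"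
      have "P b"
      proof -
        obtain r where "0 < r" "\<forall>x'\<in>carrier_vec n. x' \<in> cube n x r \<longrightarrow>
            (\<forall>w. a \<le> w \<longrightarrow> w \<le> b \<longrightarrow> w \<le> q \<longrightarrow> \<not> vCons w x' \<in> A)" using \<open>P q\<close> unfolding P_def by blast
        moreover have "w \<le> q" if "w \<le> b" for w using that \<open>\<not> q \<le> b\<close> by simp
        ultimately show ?thesis unfolding P_def by blast
      qed
      then show False using nb by blast
    qed
    ultimately obtain s where s: "\<forall>q. P q \<longrightarrow> q \<le> s" "\<forall>t<s. \<exists>q. P q \<and> t < q"
      by (rule def_sup)
    have "s \<le> b"
    proof (rule ccontr)
      assume "\<not> s \<le> b"
      then show False using s(2) \<open>\<forall>q. P q \<longrightarrow> q \<le> b\<close> by (meson not_le)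
    qed
    have "a \<le> s"
    proof (rule ccontr)
      assume "\<not> a \<le> s"
      then obtain q where "s < q" "q < a" using dense[of s a] by auto
      then show False using below_a[of q] s(1) by (meson not_le)
    qed
    then have "vCons s x \<in> carrier_vec (Suc n) - A" using x \<open>s \<le> b\<close> by simp
    then obtain \<epsilon> where eps: "\<epsilon> > 0" "cube (Suc n) (vCons s x) \<epsilon> \<inter> A = {}"
      using A(2) unfolding closed_cubes_def by blast
    have "s - \<epsilon> < s" using eps(1) by simp
    then obtain q where q: "P q" "s - \<epsilon> < q" using s(2) by blast
    then obtain r where r: "0 < r" "\<forall>x'\<in>carrier_vec n. x' \<in> cube n x r \<longrightarrow>
        (\<forall>w. a \<le> w \<longrightarrow> w \<le> b \<longrightarrow> w \<le> q \<longrightarrow> \<not> vCons w x' \<in> A)" unfolding P_def by blast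
    have "\<not> vCons w x' \<in> A" if x': "x' \<in> carrier_vec n" "x' \<in> cube n x (min r \<epsilon>)"
      and w: "a \<le> w" "w \<le> b" "w \<le> s + \<epsilon> / 2" for x' w
    proof (cases "w \<le> q")
      case True
      moreover have "x' \<in> cube n x r" using x'(2) cube_mono[of "min r \<epsilon>" r n x] by auto
      ultimately show ?thesis using r(2) x'(1) w by blast
    next
      case False
      have "\<bar>w - s\<bar> < \<epsilon>" using False q(2) w(3) eps(1) by (simp add: abs_less_iff)
      moreover have "x' \<in> cube n x \<epsilon>" using x'(2) cube_mono[of "min r \<epsilon>" \<epsilon> n x] by auto
      ultimately have "vCons w x' \<in> cube (Suc n) (vCons s x) \<epsilon>" using vCons_in_cube[OF x'(1)] by blast
      then show ?thesis using eps(2) by blast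
    qed
    then have "P (s + \<epsilon> / 2)" unfolding P_def using r(1) eps(1) by (intro exI[of _ "min r \<epsilon>"]) simp
    then have "s + \<epsilon> / 2 \<le> s" using s(1) by blast
    then show False using eps(1) by simp
  qed
  then obtain r where "0 < r" "\<forall>x'\<in>carrier_vec n. x' \<in> cube n x r \<longrightarrow>
      (\<forall>w. a \<le> w \<longrightarrow> w \<le> b \<longrightarrow> w \<le> b \<longrightarrow> \<not> vCons w x' \<in> A)" unfolding P_def by blast
  then show "\<exists>r>0. cube n x r \<inter> ?S = {}" by (intro exI[of _ r]) blast
qed

lemma def_family_cube_closure:
  assumes A: "def_family M n A" shows "def_family M n (\<lambda>t. cube_closure n (A t))"
proof -
  have eq: "x \<in> cube_closure n (A t) \<longleftrightarrow>
      x \<in> carrier_vec n \<and> (\<forall>r. 0 < r \<longrightarrow> (\<exists>y\<in>carrier_vec n. y \<in> cube n x r \<and> y \<in> A t))" for x t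
    unfolding cube_closure_def using cube_carrier by blast
  show ?thesis unfolding def_family_def eq
    by (rule def_intros def_pred_carrier def_pred_mem_cube def_family_mem[OF A])+
qed

text \<open>Coordinate \<open>0\<close> is split off, and the induction hypothesis is applied three
  times: to restrict to a cube over which all fibres of the individual sets are nowhere dense, to
  find a common interval of heights that the union misses over a dense set of base points, and to
  turn this dense set into a cube.\<close>

theorem increasing_union:
  assumes "def_family M n A" "\<And>t. t > 0 \<Longrightarrow> nowhere_dense_cubes n (A t)"
    and "\<And>s t. 0 < s \<Longrightarrow> s \<le> t \<Longrightarrow> A s \<subseteq> A t"
  shows "nowhere_dense_cubes n {x. \<exists>t>0. x \<in> A t}"
  using assms
proof (induction n arbitrary: A)
  case 0
  show ?case
  proof (rule nowhere_dense_cubesI)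
    fix x :: "'a vec" and r :: 'a assume x: "x \<in> carrier_vec 0" "r > 0"
    \<comment> \<open>In dimension \<open>0\<close> every cube is the whole one-point space, so a
      nowhere dense set misses that point.\<close>
    have cube0: "cube 0 y s = carrier_vec 0" for y and s :: 'a by (simp add: cube_def)
    have "carrier_vec 0 \<inter> A t = {}" if t: "t > 0" for t
    proof -
      obtain y s where "cube 0 y s \<inter> A t = {}" using 0(2)[OF t] x by (rule nowhere_dense_cubesD)
      then show ?thesis unfolding cube0 .
    qed
    then have "cube 0 x 1 \<inter> {x. \<exists>t>0. x \<in> A t} = {}" unfolding cube0 by blast
    moreover have "cube 0 x 1 \<subseteq> cube 0 x r" unfolding cube0 by blast
    ultimately have "(0::'a) < 1 \<and> cube 0 x 1 \<subseteq> cube 0 x r \<and> cube 0 x 1 \<inter> {x. \<exists>t>0. x \<in> A t} = {}"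
      by simp
    then have "\<exists>s>0. cube 0 x s \<subseteq> cube 0 x r \<and> cube 0 x s \<inter> {x. \<exists>t>0. x \<in> A t} = {}" by (rule exI)
    then show "\<exists>y\<in>carrier_vec 0. \<exists>s>0. cube 0 y s \<subseteq> cube 0 x r \<and> cube 0 y s \<inter> {x. \<exists>t>0. x \<in> A t} = {}"
      using x(1) by (rule bexI)
  qed
next
  case (Suc n)
  \<comment> \<open>Taking closures preserves monotonicity and nowhere density; closedness is needed
    for fibres and projections.\<close>
  define B where "B t = cube_closure (Suc n) (A t)" for t
  have defB: "def_family M (Suc n) B" unfolding B_def by (rule def_family_cube_closure[OF Suc.prems(1)])
  have closedB: "closed_cubes (Suc n) (B t)" for t unfolding B_def by (rule closed_cube_closure)
  have ndB: "nowhere_dense_cubes (Suc n) (B t)" if "t > 0" for t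
    unfolding B_def by (rule nowhere_dense_cube_closure[OF Suc.prems(2)[OF that]])
  have monoB: "B s \<subseteq> B t" if "0 < s" "s \<le> t" for s t
    unfolding B_def cube_closure_def using Suc.prems(3)[OF that] by blast
  have nd: "nowhere_dense_cubes (Suc n) {x. \<exists>t>0. x \<in> B t}"
  proof (rule nowhere_dense_cubesI_dense)
    fix p :: "'a vec" and r :: 'a
    assume p: "p \<in> carrier_vec (Suc n)" and r: "r > 0" and dense: "dense_in_cube (Suc n) {x. \<exists>t>0. x \<in> B t} p r"
    obtain c u where cu: "p = vCons c u" "u \<in> carrier_vec n" by (rule vCons_decompose[OF p])
    define lo hi where "lo = c - r" and "hi = c + r"
    have lohi: "lo < hi" unfolding lo_def hi_def using r by simp
    \<comment> \<open>Base points over which \<open>B t\<close> contains an interval of length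
      \<open>1 / t\<close>. Tying the length to the index makes the family increasing.\<close>
    define Z where "Z t = {x \<in> carrier_vec n. x \<in> cube n u r \<and> (\<exists>z. lo \<le> z \<and> z + 1 / t \<le> hi \<and>
        (\<forall>w. z < w \<longrightarrow> w < z + 1 / t \<longrightarrow> vCons w x \<in> B t))}" for t
    have defZ: "def_family M n Z"
      unfolding def_family_def Z_def mem_Collect_eq
      by (rule def_intros def_pred_carrier def_pred_mem_cube def_family_mem[OF defB] def_vec_const[OF cu(2)])+
    have ndZ: "nowhere_dense_cubes n (Z t)" if t: "t > 0" for t
    proof (rule nowhere_dense_cubesI_dense)
      fix x0 r0 assume x0: "x0 \<in> carrier_vec n" "r0 > 0" "dense_in_cube n (Z t) x0 r0"
      have "1 / t > 0" using t by simp
      have good: "\<exists>z. lo \<le> z \<and> z + 1 / t \<le> hi \<and> (\<forall>w. z < w \<longrightarrow> w < z + 1 / t \<longrightarrow> vCons w x \<in> B t)"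
        if "x \<in> Z t" for x using that unfolding Z_def by blast
      obtain v s z where v: "v \<in> carrier_vec n" "s > 0" "cube n v s \<subseteq> cube n x0 r0" "lo \<le> z" "z + 1 / t / 2 \<le> hi"
        "dense_in_cube n {x \<in> Z t. \<forall>w. z \<le> w \<longrightarrow> w \<le> z + 1 / t / 2 \<longrightarrow> vCons w x \<in> B t} v s"
        by (rule uniform_interval[OF def_family_at[OF defB] def_family_at[OF defZ] x0 \<open>1 / t > 0\<close> good])
      define \<eta> where "\<eta> = 1 / t / 4"
      have eta: "\<eta> > 0" "z + 1 / t / 2 = z + 2 * \<eta>" unfolding \<eta>_def using t by simp_all
      \<comment> \<open>A common interval over a dense set of base points, together with closedness,
        would put a whole cube into \<open>B t\<close>.\<close>
      have "cube (Suc n) (vCons (z + \<eta>) v) (min s \<eta>) \<subseteq> B t"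
      proof (rule subsetI, rule ccontr)
        fix y assume y: "y \<in> cube (Suc n) (vCons (z + \<eta>) v) (min s \<eta>)" "y \<notin> B t"
        obtain w x where wx: "y = vCons w x" "\<bar>w - (z + \<eta>)\<bar> < min s \<eta>" "x \<in> cube n v (min s \<eta>)"
          by (rule cube_vConsE[OF y(1)])
        obtain \<epsilon> where eps: "\<epsilon> > 0" "cube (Suc n) y \<epsilon> \<inter> B t = {}"
          using closedB[of t] y(2) cube_carrier[OF y(1)] unfolding closed_cubes_def by blast
        have x: "x \<in> carrier_vec n" "x \<in> cube n v s"
          using wx(3) cube_carrier cube_mono[of "min s \<eta>" s n v] by auto
        obtain \<rho> where rho: "\<rho> > 0" "cube n x \<rho> \<subseteq> cube n v s" "cube n x \<rho> \<subseteq> cube n x \<epsilon>"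
          by (rule cube_refine[OF x(2) center_in_cube[OF x(1) eps(1)]])
        obtain x' where x': "x' \<in> cube n x \<rho>" "x' \<in> {x \<in> Z t. \<forall>w. z \<le> w \<longrightarrow> w \<le> z + 1 / t / 2 \<longrightarrow> vCons w x \<in> B t}"
          by (rule dense_in_cube_meets[OF v(6) x(1) rho(1,2)])
        have "z \<le> w" "w \<le> z + 1 / t / 2" unfolding eta(2) using wx(2) by (auto simp: abs_less_iff)
        then have "vCons w x' \<in> B t" using x'(2) by blast
        moreover have "vCons w x' \<in> cube (Suc n) y \<epsilon>"
          unfolding wx(1) vCons_in_cube[OF cube_carrier[OF x'(1)]] using x'(1) rho(3) eps(1) by auto
        ultimately show False using eps(2) by blast
      qed
      moreover have "min s \<eta> > 0" using v(2) eta(1) by simp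
      moreover have "vCons (z + \<eta>) v \<in> carrier_vec (Suc n)" using v(1) by simp
      ultimately show False using cube_not_nowhere_dense ndB[OF t] by blast
    qed
    have monoZ: "Z s \<subseteq> Z t" if st: "0 < s" "s \<le> t" for s t
    proof
      fix x assume x: "x \<in> Z s"
      then obtain z where z: "lo \<le> z" "z + 1 / s \<le> hi" "\<forall>w. z < w \<longrightarrow> w < z + 1 / s \<longrightarrow> vCons w x \<in> B s"
        unfolding Z_def by blast
      have le: "1 / t \<le> 1 / s" using st by (simp add: frac_le)
      have "vCons w x \<in> B t" if "z < w" "w < z + 1 / t" for w
        using z(3) that le monoB[OF st] by (meson add_left_mono less_le_trans subsetD)
      moreover have "z + 1 / t \<le> hi" using z(2) le by simp
      ultimately show "x \<in> Z t" using x z(1) unfolding Z_def by blast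
    qed
    have "nowhere_dense_cubes n {x. \<exists>t>0. x \<in> Z t}" by (rule Suc.IH[OF defZ ndZ monoZ])
    then obtain u1 r1 where u1: "u1 \<in> carrier_vec n" "r1 > 0" "cube n u1 r1 \<subseteq> cube n u r"
        "cube n u1 r1 \<inter> {x. \<exists>t>0. x \<in> Z t} = {}"
      using cu(2) r by (rule nowhere_dense_cubesD)
    \<comment> \<open>Base points over which some interval of length \<open>1 / s\<close> is missed
      by all \<open>B t\<close> simultaneously.\<close>
    define Y where "Y s = {x \<in> carrier_vec n. x \<in> cube n u1 r1 \<and> (\<exists>z. lo \<le> z \<and> z + 1 / s \<le> hi \<and>
        (\<forall>w. z < w \<longrightarrow> w < z + 1 / s \<longrightarrow> (\<forall>t. 0 < t \<longrightarrow> \<not> vCons w x \<in> B t)))}" for s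
    have defY: "def_family M n Y"
      unfolding def_family_def Y_def mem_Collect_eq
      by (rule def_intros def_pred_carrier def_pred_mem_cube def_family_mem[OF defB] def_vec_const[OF u1(1)])+
    have in_Y: "\<exists>s>0. x \<in> Y s" if x: "x \<in> cube n u1 r1" for x
    proof -
      have xc: "x \<in> carrier_vec n" by (rule cube_carrier[OF x])
      define R where "R t w \<longleftrightarrow> lo \<le> w \<and> w \<le> hi \<and> vCons w x \<in> B t" for t w
      have "nowhere_dense_ivl {w. \<exists>t>0. R t w}"
      proof (rule increasing_union_ivl)
        show "def_pred M (\<lambda>e. R (e 0) (e 1))"
          unfolding R_def by (rule def_intros def_family_mem[OF defB] def_vec_const[OF xc])+
        show closedR: "closed_ivl {w. R t w}" if "t > 0" for t
          unfolding R_def by (rule closed_fibre_ivl[OF closedB xc])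
        show "R t w" if "0 < s" "s \<le> t" "R s w" for s t w
          using that(3) monoB[OF that(1,2)] unfolding R_def by blast
        show "nowhere_dense_ivl {w. R t w}" if t: "t > 0" for t
          unfolding nowhere_dense_ivl_def
        proof (intro allI impI)
          fix a b :: 'a assume ab: "a < b"
          define a' b' where "a' = max a lo" and "b' = min b hi"
          show "\<exists>c d. a \<le> c \<and> c < d \<and> d \<le> b \<and> {c<..<d} \<inter> {w. R t w} = {}"
          proof (cases "a' < b'")
            case False
            then have "b \<le> lo \<or> hi \<le> a" using ab lohi unfolding a'_def b'_def by (simp add: max_def min_def split: if_splits)
            then have "{a<..<b} \<inter> {w. R t w} = {}" unfolding R_def by auto
            then show ?thesis using ab by (intro exI[of _ a] exI[of _ b]) simp
          next
            case True
            \<comment> \<open>\<open>T\<close> is at least \<open>t\<close> and so large that an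
              interval of length \<open>1 / T\<close> fits between \<open>a'\<close> and
              \<open>b'\<close>. Then \<open>x \<notin> Z T\<close> provides a height there off
              \<open>B T\<close>, hence off \<open>B t\<close>.\<close>
            define T where "T = max t (1 / (b' - a'))"
            have T: "T > 0" "t \<le> T" unfolding T_def using t by (auto simp: less_max_iff_disj)
            have "1 / T \<le> b' - a'"
            proof -
              have "1 / (b' - a') \<le> T" unfolding T_def by simp
              then show ?thesis using True T(1) by (simp add: field_simps)
            qed
            moreover have "x \<notin> Z T" using u1(4) x T(1) by blast
            moreover have "lo \<le> a'" "b' \<le> hi" unfolding a'_def b'_def by simp_all
            moreover have "x \<in> cube n u r" using x u1(3) by blast
            ultimately obtain w where w: "a' < w" "w < a' + 1 / T" "vCons w x \<notin> B T"
              unfolding Z_def using xc by force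
            have "w < b'" using w(2) \<open>1 / T \<le> b' - a'\<close> by simp
            have "w \<notin> {w. R t w}" unfolding R_def using w(3) monoB[OF t T(2)] by blast
            then obtain \<epsilon> where eps: "\<epsilon> > 0" "\<forall>y. \<bar>y - w\<bar> < \<epsilon> \<longrightarrow> y \<notin> {w. R t w}"
              using closedR[OF t] unfolding closed_ivl_def by blast
            have "a < w" "w < b" using w(1) \<open>w < b'\<close> unfolding a'_def b'_def by simp_all
            have "{w<..<min b (w + \<epsilon>)} \<inter> {w. R t w} = {}"
            proof -
              have "y \<notin> {w. R t w}" if "y \<in> {w<..<min b (w + \<epsilon>)}" for y
              proof -
                have "\<bar>y - w\<bar> < \<epsilon>" using that by (simp add: abs_less_iff)
                then show ?thesis using eps(2) by blast
              qed
              then show ?thesis by blast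
            qed
            then show ?thesis using \<open>a < w\<close> \<open>w < b\<close> eps(1)
              by (intro exI[of _ w] exI[of _ "min b (w + \<epsilon>)"]) simp
          qed
        qed
      qed
      then obtain c' d' where cd: "lo \<le> c'" "c' < d'" "d' \<le> hi" "{c'<..<d'} \<inter> {w. \<exists>t>0. R t w} = {}"
        using lohi unfolding nowhere_dense_ivl_def by meson
      define s where "s = 1 / (d' - c')"
      have s: "s > 0" "1 / s = d' - c'" unfolding s_def using cd(2) by simp_all
      have "\<not> vCons w x \<in> B t" if "c' < w" "w < c' + 1 / s" "0 < t" for w t
      proof
        assume "vCons w x \<in> B t"
        moreover have "w < d'" using that(2) unfolding s(2) by simp
        ultimately have "R t w" unfolding R_def using that cd by simp
        then show False using cd(4) that \<open>w < d'\<close> by auto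
      qed
      moreover have "c' + 1 / s \<le> hi" unfolding s(2) using cd(3) by simp
      ultimately have "x \<in> Y s" unfolding Y_def using x xc cd(1) by blast
      then show ?thesis using s(1) by blast
    qed
    have monoY: "Y s \<subseteq> Y t" if st: "0 < s" "s \<le> t" for s t
    proof
      fix x assume x: "x \<in> Y s"
      then obtain z where z: "lo \<le> z" "z + 1 / s \<le> hi"
          "\<forall>w. z < w \<longrightarrow> w < z + 1 / s \<longrightarrow> (\<forall>t. 0 < t \<longrightarrow> \<not> vCons w x \<in> B t)"
        unfolding Y_def by blast
      have le: "1 / t \<le> 1 / s" using st by (simp add: frac_le)
      have "w < z + 1 / s" if "w < z + 1 / t" for w using that le by simp
      moreover have "z + 1 / t \<le> hi" using z(2) le by simp
      ultimately show "x \<in> Y t" using x z(1,3) unfolding Y_def by blast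
    qed
    \<comment> \<open>The induction hypothesis in contrapositive form: the union of the
      \<open>Y s\<close> contains a cube.\<close>
    have "\<exists>s>0. \<not> nowhere_dense_cubes n (Y s)"
    proof (rule ccontr)
      assume "\<not> (\<exists>s>0. \<not> nowhere_dense_cubes n (Y s))"
      then have "nowhere_dense_cubes n (Y s)" if "s > 0" for s using that by blast
      then have "nowhere_dense_cubes n {x. \<exists>s>0. x \<in> Y s}" by (rule Suc.IH[OF defY _ monoY])
      moreover have "cube n u1 r1 \<subseteq> {x. \<exists>s>0. x \<in> Y s}" using in_Y by blast
      ultimately show False using cube_not_nowhere_dense[OF u1(1,2)] by blast
    qed
    then obtain s where s: "s > 0" "\<not> nowhere_dense_cubes n (Y s)" by blast
    obtain u2 r2 where u2: "u2 \<in> carrier_vec n" "r2 > 0" "dense_in_cube n (Y s) u2 r2"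
      by (rule not_nowhere_denseE[OF s(2)])
    define W where "W = {v \<in> carrier_vec (Suc n). \<forall>t. 0 < t \<longrightarrow> \<not> v \<in> B t}"
    have defW: "def_set M (Suc n) W"
      unfolding def_set_def W_def mem_Collect_eq
      by (rule def_intros def_pred_carrier def_family_mem[OF defB])+
    have good: "\<exists>z. lo \<le> z \<and> z + 1 / s \<le> hi \<and> (\<forall>w. z < w \<longrightarrow> w < z + 1 / s \<longrightarrow> vCons w x \<in> W)"
      if "x \<in> Y s" for x using that unfolding Y_def W_def by force
    have "1 / s > 0" using s(1) by simp
    obtain v3 s3 z where v3: "v3 \<in> carrier_vec n" "s3 > 0" "cube n v3 s3 \<subseteq> cube n u2 r2" "lo \<le> z" "z + 1 / s / 2 \<le> hi"
      "dense_in_cube n {x \<in> Y s. \<forall>w. z \<le> w \<longrightarrow> w \<le> z + 1 / s / 2 \<longrightarrow> vCons w x \<in> W} v3 s3"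
      by (rule uniform_interval[OF defW def_family_at[OF defY] u2 \<open>1 / s > 0\<close> good])
    define \<eta> where "\<eta> = 1 / s / 4"
    have eta: "\<eta> > 0" "z + 1 / s / 2 = z + 2 * \<eta>" unfolding \<eta>_def using s(1) by simp_all
    define G where "G = {x \<in> Y s. \<forall>w. z \<le> w \<longrightarrow> w \<le> z + 2 * \<eta> \<longrightarrow> vCons w x \<in> W}"
    have denseG: "dense_in_cube n G v3 s3" using v3(6) unfolding eta(2) G_def .
    have "G \<subseteq> cube n u1 r1" unfolding G_def Y_def by blast
    then obtain v4 s4 where v4: "v4 \<in> carrier_vec n" "s4 > 0" "cube n v4 s4 \<subseteq> cube n v3 s3"
        "cube n v4 s4 \<subseteq> cube n u1 r1" "dense_in_cube n G v4 s4"
      using denseG v3(1,2) by (rule dense_subcube)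
    \<comment> \<open>For each single \<open>t\<close>, the projection along the closed interval of
      heights is closed. It cannot contain a cube, which would meet the dense set
      \<open>G\<close>.\<close>
    define C where "C t = {x \<in> carrier_vec n. \<exists>w. z \<le> w \<and> w \<le> z + 2 * \<eta> \<and> vCons w x \<in> B t}" for t
    define C' where "C' t = {x \<in> carrier_vec n. x \<in> cube n v4 s4 \<and> x \<in> C t}" for t
    have defC: "def_family M n C"
      unfolding def_family_def C_def mem_Collect_eq
      by (rule def_intros def_pred_carrier def_family_mem[OF defB])+
    have defC': "def_family M n C'"
      unfolding def_family_def C'_def mem_Collect_eq
      by (rule def_intros def_pred_carrier def_pred_mem_cube def_family_mem[OF defC] def_vec_const[OF v4(1)])+
    have ndC': "nowhere_dense_cubes n (C' t)" if t: "t > 0" for t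
    proof (rule nowhere_dense_cubesI_dense)
      fix x5 r5 assume x5: "x5 \<in> carrier_vec n" "r5 > 0" "dense_in_cube n (C' t) x5 r5"
      have "C' t \<subseteq> cube n v4 s4" unfolding C'_def by blast
      then obtain x6 r6 where x6: "x6 \<in> carrier_vec n" "r6 > 0" "cube n x6 r6 \<subseteq> cube n x5 r5"
          "cube n x6 r6 \<subseteq> cube n v4 s4" "dense_in_cube n (C' t) x6 r6"
        using x5(3,1,2) by (rule dense_subcube)
      have "dense_in_cube n (C t) x6 r6" using x6(5) unfolding dense_in_cube_def C'_def by blast
      moreover have "closed_cubes n (C t)"
        unfolding C_def by (rule closed_projection_step[OF def_family_at[OF defB] closedB])
      ultimately have "cube n x6 r6 \<subseteq> C t" by (intro closed_dense_contains_cube)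
      moreover obtain g where "g \<in> cube n x6 r6" "g \<in> G"
        by (rule dense_in_cube_meets[OF v4(5) x6(1,2,4)])
      ultimately show False using t unfolding C_def G_def W_def by blast
    qed
    have monoC': "C' s \<subseteq> C' t" if "0 < s" "s \<le> t" for s t
      using monoB[OF that] unfolding C'_def C_def by blast
    \<comment> \<open>This yields a cube of base points over which no \<open>B t\<close> reaches the
      heights between \<open>z\<close> and \<open>z + 2 * \<eta>\<close>. The resulting box misses
      the union, against the assumed density.\<close>
    have "nowhere_dense_cubes n {x. \<exists>t>0. x \<in> C' t}" by (rule Suc.IH[OF defC' ndC' monoC'])
    then obtain v7 s7 where v7: "v7 \<in> carrier_vec n" "s7 > 0" "cube n v7 s7 \<subseteq> cube n v4 s4"
        "cube n v7 s7 \<inter> {x. \<exists>t>0. x \<in> C' t} = {}"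
      using v4(1,2) by (rule nowhere_dense_cubesD)
    have in7: "w \<in> {z<..<z + 2 * \<eta>} \<and> x \<in> cube n v7 s7"
      if "\<bar>w - (z + \<eta>)\<bar> < min s7 \<eta>" "x \<in> cube n v7 (min s7 \<eta>)" for w x
    proof -
      have "x \<in> cube n v7 s7" using that(2) cube_mono[of "min s7 \<eta>" s7 n v7] by auto
      then show ?thesis using that(1) by (auto simp: abs_less_iff)
    qed
    have sub7: "cube (Suc n) (vCons (z + \<eta>) v7) (min s7 \<eta>) \<subseteq> cube (Suc n) p r"
    proof
      fix y assume y: "y \<in> cube (Suc n) (vCons (z + \<eta>) v7) (min s7 \<eta>)"
      obtain w x where wx: "y = vCons w x" "\<bar>w - (z + \<eta>)\<bar> < min s7 \<eta>" "x \<in> cube n v7 (min s7 \<eta>)"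
        by (rule cube_vConsE[OF y])
      have w: "z < w" "w < z + 2 * \<eta>" "x \<in> cube n v7 s7" using in7[OF wx(2,3)] by auto
      have "\<bar>w - c\<bar> < r" using w v3(4,5) unfolding eta(2) lo_def hi_def by (simp add: abs_less_iff)
      moreover have "x \<in> cube n u r" using w(3) v7(3) v4(4) u1(3) by blast
      ultimately show "y \<in> cube (Suc n) p r"
        unfolding wx(1) cu(1) using vCons_in_cube[OF cube_carrier[OF w(3)]] by blast
    qed
    have c7: "vCons (z + \<eta>) v7 \<in> carrier_vec (Suc n)" using v7(1) by simp
    have "min s7 \<eta> > 0" using v7(2) eta(1) by simp
    then obtain y where y: "y \<in> cube (Suc n) (vCons (z + \<eta>) v7) (min s7 \<eta>)" "y \<in> {x. \<exists>t>0. x \<in> B t}"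
      using dense_in_cube_meets[OF dense c7 _ sub7] by blast
    obtain w x where wx: "y = vCons w x" "\<bar>w - (z + \<eta>)\<bar> < min s7 \<eta>" "x \<in> cube n v7 (min s7 \<eta>)"
      by (rule cube_vConsE[OF y(1)])
    obtain t where t: "t > 0" "y \<in> B t" using y(2) by blast
    have w: "z < w" "w < z + 2 * \<eta>" "x \<in> cube n v7 s7" using in7[OF wx(2,3)] by auto
    have "x \<in> C t" unfolding C_def
      using cube_carrier[OF w(3)] w t(2) unfolding wx(1) by (simp, intro exI[of _ w]) simp
    then have "x \<in> C' t" unfolding C'_def using w(3) v7(3) cube_carrier[OF w(3)] by blast
    then show False using v7(4) w(3) t(1) by blast
  qed
  \<comment> \<open>The \<open>A t\<close> are allowed to contain vectors of other dimensions, which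
    the closure operation discards.\<close>
  have "A t \<inter> carrier_vec (Suc n) \<subseteq> B t" for t
    unfolding B_def cube_closure_def using center_in_cube by blast
  then have sub: "{x. \<exists>t>0. x \<in> A t} \<inter> carrier_vec (Suc n) \<subseteq> {x. \<exists>t>0. x \<in> B t}" by blast
  show ?case
  proof (rule nowhere_dense_cubesI_dense)
    fix x r assume x: "x \<in> carrier_vec (Suc n)" "r > 0" "dense_in_cube (Suc n) {x. \<exists>t>0. x \<in> A t} x r"
    have "dense_in_cube (Suc n) {x. \<exists>t>0. x \<in> B t} x r"
      unfolding dense_in_cube_def
    proof (intro ballI allI impI)
      fix y s assume y: "y \<in> carrier_vec (Suc n)" "s > 0" "cube (Suc n) y s \<subseteq> cube (Suc n) x r"
      obtain z where "z \<in> cube (Suc n) y s" "z \<in> {x. \<exists>t>0. x \<in> A t}"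
        by (rule dense_in_cube_meets[OF x(3) y])
      then show "cube (Suc n) y s \<inter> {x. \<exists>t>0. x \<in> B t} \<noteq> {}" using sub cube_carrier[of z "Suc n" y s] by blast
    qed
    then show False using nd x(1,2) unfolding nowhere_dense_cubes_def by blast
  qed
qed

end

section \<open>Difference quotients\<close>

definition shift :: "nat \<Rightarrow> 'a::linordered_field vec \<Rightarrow> nat \<Rightarrow> 'a \<Rightarrow> 'a vec" where
  "shift n x j h = vec n (\<lambda>i. if i = j then x $ i + h else x $ i)"

lemma shift_carrier [simp]: "shift n x j h \<in> carrier_vec n"
  by (simp add: shift_def)

lemma shift_index: "i < n \<Longrightarrow> shift n x j h $ i = (if i = j then x $ i + h else x $ i)"
  by (simp add: shift_def)

lemma shift_shift: "shift n (shift n x j h) j k = shift n x j (h + k)"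
  by (rule eq_vecI) (simp_all add: shift_def)

lemma shift_zero: "x \<in> carrier_vec n \<Longrightarrow> shift n x j 0 = x"
  by (rule eq_vecI) (simp_all add: shift_def)

lemma shift_in_cube:
  "x \<in> cube n u r \<Longrightarrow> j < n \<Longrightarrow> \<bar>x $ j + h - u $ j\<bar> < r \<Longrightarrow> shift n x j h \<in> cube n u r"
  unfolding cube_def by (simp add: shift_index)

lemma shift_in_cubeD:
  "shift n x j h \<in> cube n u r \<Longrightarrow> j < n \<Longrightarrow> \<bar>x $ j + h - u $ j\<bar> < r"
  using cube_center_radius[of "shift n x j h" n u r j] by (simp add: shift_index)

lemma shift_cube:
  assumes "y \<in> cube n x \<delta>" shows "shift n y j h \<in> cube n (shift n x j h) \<delta>"
  using assms unfolding cube_def by (simp add: shift_index)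

lemma shift_between:
  assumes "x \<in> cube n u r" "shift n x j k \<in> cube n u r" "j < n" "0 \<le> h" "h \<le> k"
  shows "shift n x j h \<in> cube n u r"
proof (rule shift_in_cube[OF assms(1,3)])
  have "\<bar>x $ j - u $ j\<bar> < r" by (rule cube_center_radius[OF assms(1,3)])
  moreover have "\<bar>x $ j + k - u $ j\<bar> < r" by (rule shift_in_cubeD[OF assms(2,3)])
  ultimately show "\<bar>x $ j + h - u $ j\<bar> < r" using assms(4,5) unfolding abs_less_iff by linarith
qed

lemma shift_small_in_cube:
  assumes "x \<in> carrier_vec n" "j < n" "\<bar>h\<bar> < r" shows "shift n x j h \<in> cube n x r"
  using assms unfolding cube_def by (auto simp: shift_index)

lemma def_vec_shift:
  assumes "def_vec M n v" "def_term M h"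
  shows "def_vec M n (\<lambda>e. shift n (v e) j (h e))"
  unfolding shift_def
proof (rule def_vec_vec)
  fix i assume i: "i < n"
  show "def_term M (\<lambda>e. if i = j then v e $ i + h e else v e $ i)"
    using def_term_vec_nth[OF assms(1) i] assms(2) by (cases "i = j") (simp_all add: def_term_add)
qed

definition cont_at :: "nat \<Rightarrow> ('a::linordered_field vec \<Rightarrow> 'a) \<Rightarrow> 'a vec \<Rightarrow> bool" where
  "cont_at n \<phi> x \<longleftrightarrow> (\<forall>\<epsilon>>0. \<exists>\<delta>>0. \<forall>y\<in>cube n x \<delta>. \<bar>\<phi> y - \<phi> x\<bar> < \<epsilon>)"

lemma cont_atE:
  assumes "cont_at n \<phi> x" "\<epsilon> > 0"
  obtains \<delta> where "\<delta> > 0" "\<forall>y\<in>cube n x \<delta>. \<bar>\<phi> y - \<phi> x\<bar> < \<epsilon>"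
  using assms unfolding cont_at_def by blast

lemma cont_at_uminus: "cont_at n \<phi> x \<Longrightarrow> cont_at n (\<lambda>y. - \<phi> y) x"
  unfolding cont_at_def by (simp add: abs_minus_commute)

definition incr :: "nat \<Rightarrow> ('a::linordered_field vec \<Rightarrow> 'a) \<Rightarrow> nat \<Rightarrow> 'a vec \<Rightarrow> 'a \<Rightarrow> 'a" where
  "incr n \<phi> j x h = \<phi> (shift n x j h) - \<phi> x"

lemma incr_add: "incr n \<phi> j x (h + k) = incr n \<phi> j x h + incr n \<phi> j (shift n x j h) k"
  unfolding incr_def by (simp add: shift_shift)

lemma def_fun_shift:
  assumes "def_fun M n \<phi>" "def_vec M n v" "def_term M h"
  shows "def_term M (\<lambda>e. incr n \<phi> j (v e) (h e))"
  unfolding incr_def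
  by (intro def_term_diff def_fun_app[OF assms(1)] def_vec_shift assms)

lemma def_fun_uminus: "def_fun M n \<phi> \<Longrightarrow> def_fun M n (\<lambda>x. - \<phi> x)"
  unfolding def_fun_def by (rule def_term_uminus)

lemma incr_continuous:
  assumes "cont_at n \<phi> x" "cont_at n \<phi> (shift n x j h)" "\<epsilon> > 0"
  obtains \<delta> where "\<delta> > 0" "\<forall>y\<in>cube n x \<delta>. \<bar>incr n \<phi> j y h - incr n \<phi> j x h\<bar> < \<epsilon>"
proof -
  have e: "\<epsilon> / 2 > 0" using assms(3) by simp
  obtain \<delta>1 where d1: "\<delta>1 > 0" "\<forall>y\<in>cube n x \<delta>1. \<bar>\<phi> y - \<phi> x\<bar> < \<epsilon> / 2"
    by (rule cont_atE[OF assms(1) e])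
  obtain \<delta>2 where d2: "\<delta>2 > 0" "\<forall>y\<in>cube n (shift n x j h) \<delta>2. \<bar>\<phi> y - \<phi> (shift n x j h)\<bar> < \<epsilon> / 2"
    by (rule cont_atE[OF assms(2) e])
  have "\<bar>incr n \<phi> j y h - incr n \<phi> j x h\<bar> < \<epsilon>" if y: "y \<in> cube n x (min \<delta>1 \<delta>2)" for y
  proof -
    have "y \<in> cube n x \<delta>1" "y \<in> cube n x \<delta>2"
      using y cube_mono[of "min \<delta>1 \<delta>2" \<delta>1 n x] cube_mono[of "min \<delta>1 \<delta>2" \<delta>2 n x] by auto
    then have "\<bar>\<phi> y - \<phi> x\<bar> < \<epsilon> / 2" "\<bar>\<phi> (shift n y j h) - \<phi> (shift n x j h)\<bar> < \<epsilon> / 2"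
      using d1(2) d2(2) shift_cube by blast+
    then show ?thesis unfolding incr_def abs_less_iff by linarith
  qed
  moreover have "min \<delta>1 \<delta>2 > 0" using d1(1) d2(1) by simp
  ultimately show ?thesis using that by blast
qed

text \<open>Consider the last point up to which the function increases at rate at least \<open>q\<close>.\<close>

lemma (in restrained_expansion) incr_lower_bound:
  assumes \<phi>: "def_fun M n \<phi>" and j: "j < n"
    and cont: "\<And>y. y \<in> cube n v s \<Longrightarrow> cont_at n \<phi> y"
    and x: "x \<in> cube n v s" "shift n x j k \<in> cube n v s" "0 < k"
    and right: "\<And>y \<eta>. y \<in> cube n v s \<Longrightarrow> \<eta> > 0 \<Longrightarrow> \<exists>h>0. h < \<eta> \<and> q * h < incr n \<phi> j y h"
  shows "q * k \<le> incr n \<phi> j x k"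
proof (rule ccontr)
  assume lt: "\<not> q * k \<le> incr n \<phi> j x k"
  have xc: "x \<in> carrier_vec n" by (rule cube_carrier[OF x(1)])
  define P where "P h \<longleftrightarrow> 0 \<le> h \<and> h \<le> k \<and> q * h \<le> incr n \<phi> j x h" for h
  have "def_pred M (\<lambda>e. P (e 0))"
    unfolding P_def by (rule def_intros def_fun_shift[OF \<phi>] def_vec_const[OF xc])+
  moreover have "P 0" unfolding P_def incr_def using x(3) by (simp add: shift_zero[OF xc])
  moreover have "\<forall>h. P h \<longrightarrow> h \<le> k" unfolding P_def by simp
  ultimately obtain \<sigma> where sigma: "\<forall>h. P h \<longrightarrow> h \<le> \<sigma>" "\<forall>t<\<sigma>. \<exists>h. P h \<and> t < h"
    by (rule def_sup)
  have "0 \<le> \<sigma>" using sigma(1) \<open>P 0\<close> by blast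
  have "\<sigma> \<le> k"
  proof (rule ccontr)
    assume "\<not> \<sigma> \<le> k"
    then show False using sigma(2) \<open>\<forall>h. P h \<longrightarrow> h \<le> k\<close> by (meson not_le)
  qed
  have y: "shift n x j \<sigma> \<in> cube n v s" by (rule shift_between[OF x(1,2) j \<open>0 \<le> \<sigma>\<close> \<open>\<sigma> \<le> k\<close>])
  \<comment> \<open>The supremum is attained by continuity: a deficit \<open>\<eta>\<close> at
    \<open>\<sigma>\<close> would leave a deficit at every \<open>h\<close> slightly below
    \<open>\<sigma>\<close>.\<close>
  have "q * \<sigma> \<le> incr n \<phi> j x \<sigma>"
  proof (rule ccontr)
    assume "\<not> q * \<sigma> \<le> incr n \<phi> j x \<sigma>"
    define \<eta> where "\<eta> = q * \<sigma> - incr n \<phi> j x \<sigma>"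
    have eta: "\<eta> / 2 > 0" unfolding \<eta>_def using \<open>\<not> q * \<sigma> \<le> incr n \<phi> j x \<sigma>\<close> by simp
    obtain \<delta> where d: "\<delta> > 0" "\<forall>z\<in>cube n (shift n x j \<sigma>) \<delta>. \<bar>\<phi> z - \<phi> (shift n x j \<sigma>)\<bar> < \<eta> / 2"
      by (rule cont_atE[OF cont[OF y] eta])
    \<comment> \<open>A positive bound for \<open>\<bar>q\<bar>\<close>; with it,
      \<open>q * h\<close> and \<open>q * \<sigma>\<close> differ by at most
      \<open>\<eta> / 2\<close> as long as \<open>h\<close> is within \<open>\<rho>\<close> of
      \<open>\<sigma>\<close>.\<close>
    define K where "K = \<bar>q\<bar> + 1"
    have K: "K > 0" "\<bar>q\<bar> \<le> K" unfolding K_def by (simp_all add: add_nonneg_pos)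
    define \<rho> where "\<rho> = min \<delta> (\<eta> / 2 / K)"
    have "\<eta> / 2 / K > 0" by (rule divide_pos_pos[OF eta K(1)])
    then have rho12: "\<rho> > 0" "\<rho> \<le> \<delta>" unfolding \<rho>_def using d(1) by simp_all
    have "\<rho> * K \<le> \<eta> / 2 / K * K"
      unfolding \<rho>_def using K(1) by (intro mult_right_mono) simp_all
    then have "K * \<rho> \<le> \<eta> / 2" using K(1) by (simp add: mult.commute)
    note rho = rho12 this
    have "\<sigma> - \<rho> < \<sigma>" using rho(1) by simp
    then obtain h where h: "P h" "\<sigma> - \<rho> < h" using sigma(2) by blast
    have "h \<le> \<sigma>" using sigma(1) h(1) by blast
    have "shift n (shift n x j \<sigma>) j (h - \<sigma>) \<in> cube n (shift n x j \<sigma>) \<delta>"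
      by (rule shift_small_in_cube[OF shift_carrier j]) (use h(2) \<open>h \<le> \<sigma>\<close> rho(2) in \<open>simp add: abs_less_iff\<close>)
    then have "shift n x j h \<in> cube n (shift n x j \<sigma>) \<delta>" unfolding shift_shift by simp
    then have "\<bar>\<phi> (shift n x j h) - \<phi> (shift n x j \<sigma>)\<bar> < \<eta> / 2" using d(2) by blast
    then have "\<phi> (shift n x j h) < \<phi> (shift n x j \<sigma>) + \<eta> / 2" unfolding abs_less_iff by linarith
    then have 1: "incr n \<phi> j x h < q * \<sigma> - \<eta> / 2" unfolding incr_def \<eta>_def by (simp add: field_simps)
    have "q * (\<sigma> - h) \<le> \<bar>q\<bar> * (\<sigma> - h)" using \<open>h \<le> \<sigma>\<close> by (intro mult_right_mono) simp_all
    also have "\<dots> \<le> K * (\<sigma> - h)" using \<open>h \<le> \<sigma>\<close> K(2) by (intro mult_right_mono) simp_all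
    also have "\<dots> \<le> K * \<rho>" using h(2) K(1) by (intro mult_left_mono) simp_all
    also have "\<dots> \<le> \<eta> / 2" by (rule rho(3))
    finally have "q * \<sigma> - \<eta> / 2 \<le> q * h" by (simp add: algebra_simps)
    then have "incr n \<phi> j x h < q * h" using 1 by simp
    then show False using h(1) unfolding P_def by simp
  qed
  then have "\<sigma> \<noteq> k" using lt by blast
  then have "\<sigma> < k" using \<open>\<sigma> \<le> k\<close> by simp
  then have "k - \<sigma> > 0" by simp
  then obtain h where h: "h > 0" "h < k - \<sigma>" "q * h < incr n \<phi> j (shift n x j \<sigma>) h"
    using right[OF y] by blast
  have "q * (\<sigma> + h) \<le> incr n \<phi> j x (\<sigma> + h)"
    unfolding incr_add distrib_left using \<open>q * \<sigma> \<le> incr n \<phi> j x \<sigma>\<close> h(3) by simp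
  then have "P (\<sigma> + h)" unfolding P_def using h(1,2) \<open>0 \<le> \<sigma>\<close> by simp
  then have "\<sigma> + h \<le> \<sigma>" using sigma(1) by blast
  then show False using h(1) by simp
qed

section \<open>Bounds and oscillation of slopes on subcubes\<close>

context restrained_expansion
begin

text \<open>\<open>q\<close> depends on the index so that one statement serves two purposes:
  \<open>q t = t\<close> for the existence of a bound, a constant \<open>q\<close> for the
  oscillation. The points from which short steps have slope at most \<open>q t\<close> form an
  increasing family. Either a member is dense somewhere and continuity spreads the bound, or a cube
  avoids the union, and \<open>incr_lower_bound\<close> turns its arbitrarily short steep steps into
  steep steps of every length.\<close>

lemma slope_dichotomy:
  assumes \<phi>: "def_fun M n \<phi>" and j: "j < n" and u: "u \<in> carrier_vec n" "r > 0"
    and cont: "\<And>y. y \<in> cube n u r \<Longrightarrow> cont_at n \<phi> y"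
    and q: "def_term M (\<lambda>e. q (e 0))" "\<And>s t. 0 < s \<Longrightarrow> s \<le> t \<Longrightarrow> q s \<le> q t"
  shows "(\<exists>t>0. \<exists>v\<in>carrier_vec n. \<exists>s>0. cube n v s \<subseteq> cube n u r \<and>
      (\<forall>x h. x \<in> cube n v s \<longrightarrow> shift n x j h \<in> cube n v s \<longrightarrow> 0 < h \<longrightarrow> incr n \<phi> j x h \<le> q t * h)) \<or>
    (\<exists>v\<in>carrier_vec n. \<exists>s>0. cube n v s \<subseteq> cube n u r \<and>
      (\<forall>t>0. \<forall>x h. x \<in> cube n v s \<longrightarrow> shift n x j h \<in> cube n v s \<longrightarrow> 0 < h \<longrightarrow> q t * h \<le> incr n \<phi> j x h))"
proof -
  define E where "E t = {x \<in> carrier_vec n. x \<in> cube n u r \<and> (\<forall>h. 0 < h \<longrightarrow> h < 1 / t \<longrightarrow>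
      shift n x j h \<in> cube n u r \<longrightarrow> incr n \<phi> j x h \<le> q t * h)}" for t
  have defq: "def_term M (\<lambda>e. q (t e))" if t: "def_term M t" for t
    using def_term_subst[OF q(1), of "\<lambda>_. t", OF t] .
  have defE: "def_family M n E"
    unfolding def_family_def E_def mem_Collect_eq
    by (rule def_intros defq def_pred_carrier def_pred_mem_cube def_vec_const[OF u(1)] def_vec_shift def_fun_shift[OF \<phi>])+
  have monoE: "E s \<subseteq> E t" if st: "0 < s" "s \<le> t" for s t
  proof
    fix x assume x: "x \<in> E s"
    have le: "1 / t \<le> 1 / s" using st by (simp add: frac_le)
    have "incr n \<phi> j x h \<le> q t * h" if h: "0 < h" "h < 1 / t" "shift n x j h \<in> cube n u r" for h
    proof -
      have "h < 1 / s" using h(2) le by simp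
      then have "incr n \<phi> j x h \<le> q s * h" using x h unfolding E_def by blast
      also have "\<dots> \<le> q t * h" using q(2)[OF st] h(1) by (intro mult_right_mono) simp_all
      finally show ?thesis .
    qed
    then show "x \<in> E t" using x unfolding E_def by blast
  qed
  show ?thesis
  proof (cases "\<exists>t>0. \<not> nowhere_dense_cubes n (E t)")
    case True
    then obtain t where t: "t > 0" "\<not> nowhere_dense_cubes n (E t)" by blast
    obtain v0 s0 where v0: "v0 \<in> carrier_vec n" "s0 > 0" "dense_in_cube n (E t) v0 s0"
      by (rule not_nowhere_denseE[OF t(2)])
    have "E t \<subseteq> cube n u r" unfolding E_def by blast
    then obtain v s1 where v: "v \<in> carrier_vec n" "s1 > 0" "cube n v s1 \<subseteq> cube n v0 s0"
        "cube n v s1 \<subseteq> cube n u r" "dense_in_cube n (E t) v s1"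
      using v0(3,1,2) by (rule dense_subcube)
    \<comment> \<open>Steps within a cube of radius \<open>s\<close> are shorter than
      \<open>2 * s \<le> 1 / t\<close>, which is the range of the bound defining
      \<open>E t\<close>.\<close>
    define s where "s = min s1 (1 / t / 2)"
    have s: "s > 0" "s \<le> s1" "2 * s \<le> 1 / t" unfolding s_def using v(2) t(1) by (simp_all add: min_def)
    have sub: "cube n v s \<subseteq> cube n v s1" by (rule cube_mono[OF s(2)])
    have "incr n \<phi> j x h \<le> q t * h"
      if x: "x \<in> cube n v s" "shift n x j h \<in> cube n v s" "0 < h" for x h
    proof (rule ccontr)
      assume nle: "\<not> incr n \<phi> j x h \<le> q t * h"
      have "\<bar>x $ j - v $ j\<bar> < s" by (rule cube_center_radius[OF x(1) j])
      moreover have "\<bar>x $ j + h - v $ j\<bar> < s" by (rule shift_in_cubeD[OF x(2) j])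
      ultimately have "h < 2 * s" unfolding abs_less_iff by linarith
      then have ht: "h < 1 / t" using s(3) by simp
      have xu: "x \<in> cube n u r" "shift n x j h \<in> cube n u r" using x sub v(4) by blast+
      have "incr n \<phi> j x h - q t * h > 0" using nle by simp
      then obtain \<delta> where d: "\<delta> > 0"
        "\<forall>y\<in>cube n x \<delta>. \<bar>incr n \<phi> j y h - incr n \<phi> j x h\<bar> < incr n \<phi> j x h - q t * h"
        by (rule incr_continuous[OF cont[OF xu(1)] cont[OF xu(2)]])
      obtain \<delta>' where d': "\<delta>' > 0" "cube n (shift n x j h) \<delta>' \<subseteq> cube n u r" by (rule cube_open[OF xu(2)])
      have xc: "x \<in> carrier_vec n" by (rule cube_carrier[OF x(1)])
      have "min \<delta> \<delta>' > 0" using d(1) d'(1) by simp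
      obtain \<rho> where rho: "\<rho> > 0" "cube n x \<rho> \<subseteq> cube n v s1" "cube n x \<rho> \<subseteq> cube n x (min \<delta> \<delta>')"
        using cube_refine[OF subsetD[OF sub x(1)] center_in_cube[OF xc \<open>min \<delta> \<delta>' > 0\<close>]] by blast
      obtain y where y: "y \<in> cube n x \<rho>" "y \<in> E t"
        by (rule dense_in_cube_meets[OF v(5) xc rho(1,2)])
      have yd: "y \<in> cube n x \<delta>" "y \<in> cube n x \<delta>'"
        using y(1) rho(3) cube_mono[of "min \<delta> \<delta>'" \<delta> n x] cube_mono[of "min \<delta> \<delta>'" \<delta>' n x] by auto
      have "shift n y j h \<in> cube n u r" using shift_cube[OF yd(2)] d'(2) by blast
      then have "incr n \<phi> j y h \<le> q t * h" using y(2) ht x(3) unfolding E_def by blast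
      moreover have "\<bar>incr n \<phi> j y h - incr n \<phi> j x h\<bar> < incr n \<phi> j x h - q t * h" using d(2) yd(1) by blast
      ultimately show False unfolding abs_less_iff by linarith
    qed
    moreover have "cube n v s \<subseteq> cube n u r" using sub v(4) by blast
    ultimately show ?thesis using t(1) v(1) s(1) by blast
  next
    case False
    then have nd: "nowhere_dense_cubes n (E t)" if "t > 0" for t using that by blast
    have "nowhere_dense_cubes n {x. \<exists>t>0. x \<in> E t}" by (rule increasing_union[OF defE nd monoE])
    then obtain v s where v: "v \<in> carrier_vec n" "s > 0" "cube n v s \<subseteq> cube n u r"
        "cube n v s \<inter> {x. \<exists>t>0. x \<in> E t} = {}"
      using u by (rule nowhere_dense_cubesD)
    have "q t * k \<le> incr n \<phi> j x k"
      if t: "t > 0" and x: "x \<in> cube n v s" "shift n x j k \<in> cube n v s" "0 < k" for t x k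
    proof (rule incr_lower_bound[OF \<phi> j _ x])
      show "cont_at n \<phi> y" if "y \<in> cube n v s" for y using cont v(3) that by blast
      fix y \<eta> assume y: "y \<in> cube n v s" and eta: "\<eta> > (0::'a)"
      \<comment> \<open>Steps shorter than \<open>1 / T\<close> are shorter than
        \<open>\<eta>\<close>, and a slope above \<open>q T\<close> is also above
        \<open>q t\<close>.\<close>
      define T where "T = max t (1 / \<eta>)"
      have T: "T > 0" "t \<le> T" "1 / \<eta> \<le> T" unfolding T_def using t by (simp_all add: less_max_iff_disj)
      have "1 / T \<le> \<eta>" using T(1,3) eta by (simp add: field_simps)
      have "y \<notin> E T" using v(4) y T(1) by blast
      moreover have "y \<in> cube n u r" "y \<in> carrier_vec n" using y v(3) cube_carrier by blast+
      ultimately obtain h where h: "0 < h" "h < 1 / T" "\<not> incr n \<phi> j y h \<le> q T * h"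
        unfolding E_def by blast
      have "q t * h \<le> q T * h" using q(2)[OF t T(2)] h(1) by (intro mult_right_mono) simp_all
      then have "q t * h < incr n \<phi> j y h" using h(3) by simp
      then show "\<exists>h>0. h < \<eta> \<and> q t * h < incr n \<phi> j y h"
        using h(1,2) \<open>1 / T \<le> \<eta>\<close> by (intro exI[of _ h]) simp
    qed
    then show ?thesis using v(1-3) by blast
  qed
qed

lemma half_step_in_cube:
  assumes "v \<in> carrier_vec n" "s > 0" "j < n"
  shows "v \<in> cube n v s" "shift n v j (s / 2) \<in> cube n v s" "0 < s / 2"
  using center_in_cube[OF assms(1,2)] shift_small_in_cube[OF assms(1,3), of "s / 2" s] assms(2) by simp_all

lemma slope_bounded_above:
  assumes \<phi>: "def_fun M n \<phi>" and j: "j < n" and u: "u \<in> carrier_vec n" "r > 0"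
    and cont: "\<And>y. y \<in> cube n u r \<Longrightarrow> cont_at n \<phi> y"
  obtains t v s where "v \<in> carrier_vec n" "s > 0" "cube n v s \<subseteq> cube n u r"
    "\<forall>x h. x \<in> cube n v s \<longrightarrow> shift n x j h \<in> cube n v s \<longrightarrow> 0 < h \<longrightarrow> incr n \<phi> j x h \<le> t * h"
proof -
  have "def_term M (\<lambda>e. e 0)" by (rule def_term_var)
  from slope_dichotomy[OF \<phi> j u cont this] consider
    (1) "\<exists>t>0. \<exists>v\<in>carrier_vec n. \<exists>s>0. cube n v s \<subseteq> cube n u r \<and>
      (\<forall>x h. x \<in> cube n v s \<longrightarrow> shift n x j h \<in> cube n v s \<longrightarrow> 0 < h \<longrightarrow> incr n \<phi> j x h \<le> t * h)" |
    (2) "\<exists>v\<in>carrier_vec n. \<exists>s>0. cube n v s \<subseteq> cube n u r \<and>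
      (\<forall>t>0. \<forall>x h. x \<in> cube n v s \<longrightarrow> shift n x j h \<in> cube n v s \<longrightarrow> 0 < h \<longrightarrow> t * h \<le> incr n \<phi> j x h)"
    by fastforce
  then show ?thesis
  proof cases
    case 1
    then show ?thesis using that by blast
  next
    case 2
    then obtain v s where v: "v \<in> carrier_vec n" "s > 0"
      "\<forall>t>0. \<forall>x h. x \<in> cube n v s \<longrightarrow> shift n x j h \<in> cube n v s \<longrightarrow> 0 < h \<longrightarrow> t * h \<le> incr n \<phi> j x h" by blast
    note half = half_step_in_cube[OF v(1,2) j]
    define D where "D = incr n \<phi> j v (s / 2)"
    \<comment> \<open>With slope at least \<open>t\<close>, the step \<open>s / 2\<close> would
      produce an increment of at least \<open>\<bar>D\<bar> + 1\<close>, but the increment is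
      \<open>D\<close>.\<close>
    define t where "t = (\<bar>D\<bar> + 1) / (s / 2)"
    have "t > 0" unfolding t_def using half(3) by (intro divide_pos_pos) (simp_all add: add_nonneg_pos)
    then have "t * (s / 2) \<le> D" using v(3) half unfolding D_def by blast
    moreover have "t * (s / 2) = \<bar>D\<bar> + 1" unfolding t_def using half(3) by simp
    ultimately show ?thesis by linarith
  qed
qed

lemma slope_bounded_below:
  assumes \<phi>: "def_fun M n \<phi>" and j: "j < n" and u: "u \<in> carrier_vec n" "r > 0"
    and cont: "\<And>y. y \<in> cube n u r \<Longrightarrow> cont_at n \<phi> y"
  obtains t v s where "v \<in> carrier_vec n" "s > 0" "cube n v s \<subseteq> cube n u r"
    "\<forall>x h. x \<in> cube n v s \<longrightarrow> shift n x j h \<in> cube n v s \<longrightarrow> 0 < h \<longrightarrow> t * h \<le> incr n \<phi> j x h"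
proof -
  obtain t v s where v: "v \<in> carrier_vec n" "s > 0" "cube n v s \<subseteq> cube n u r"
    "\<forall>x h. x \<in> cube n v s \<longrightarrow> shift n x j h \<in> cube n v s \<longrightarrow> 0 < h \<longrightarrow> incr n (\<lambda>x. - \<phi> x) j x h \<le> t * h"
    by (rule slope_bounded_above[OF def_fun_uminus[OF \<phi>] j u cont_at_uminus[OF cont]])
  have "- t * h \<le> incr n \<phi> j x h" if "x \<in> cube n v s" "shift n x j h \<in> cube n v s" "0 < h" for x h
  proof -
    have "incr n (\<lambda>x. - \<phi> x) j x h \<le> t * h" using v(4) that by blast
    then show ?thesis unfolding incr_def by simp
  qed
  then show ?thesis using that[OF v(1-3)] by blast
qed

lemma slope_oscillation:
  assumes \<phi>: "def_fun M n \<phi>" and j: "j < n" and u: "u \<in> carrier_vec n" "r > 0"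
    and cont: "\<And>y. y \<in> cube n u r \<Longrightarrow> cont_at n \<phi> y" and "\<epsilon> > 0"
  obtains c v s where "v \<in> carrier_vec n" "s > 0" "cube n v s \<subseteq> cube n u r"
    "\<forall>x h. x \<in> cube n v s \<longrightarrow> shift n x j h \<in> cube n v s \<longrightarrow> \<bar>incr n \<phi> j x h - c * h\<bar> \<le> \<epsilon> * \<bar>h\<bar>"
proof -
  \<comment> \<open>The lower slope bound \<open>b\<close> comes first, because it makes the upper
    slope bounds on subcubes bounded below, so that they have an infimum \<open>c\<close>.\<close>
  obtain b u1 r1 where u1: "u1 \<in> carrier_vec n" "r1 > 0" "cube n u1 r1 \<subseteq> cube n u r"
    "\<forall>x h. x \<in> cube n u1 r1 \<longrightarrow> shift n x j h \<in> cube n u1 r1 \<longrightarrow> 0 < h \<longrightarrow> b * h \<le> incr n \<phi> j x h"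
    by (rule slope_bounded_below[OF \<phi> j u cont])
  have cont1: "cont_at n \<phi> y" if "y \<in> cube n u1 r1" for y using cont u1(3) that by blast
  define P where "P q \<longleftrightarrow> (\<exists>v\<in>carrier_vec n. \<exists>s. 0 < s \<and> (\<forall>x\<in>carrier_vec n. x \<in> cube n v s \<longrightarrow> x \<in> cube n u1 r1) \<and>
    (\<forall>x\<in>carrier_vec n. \<forall>h. x \<in> cube n v s \<longrightarrow> shift n x j h \<in> cube n v s \<longrightarrow> 0 < h \<longrightarrow> incr n \<phi> j x h \<le> q * h))" for q
  have PI: "P q" if "v \<in> carrier_vec n" "s > 0" "cube n v s \<subseteq> cube n u1 r1"
    "\<forall>x h. x \<in> cube n v s \<longrightarrow> shift n x j h \<in> cube n v s \<longrightarrow> 0 < h \<longrightarrow> incr n \<phi> j x h \<le> q * h" for q v s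
    unfolding P_def using that by blast
  have PE: "\<exists>v s. v \<in> carrier_vec n \<and> s > 0 \<and> cube n v s \<subseteq> cube n u1 r1 \<and>
    (\<forall>x h. x \<in> cube n v s \<longrightarrow> shift n x j h \<in> cube n v s \<longrightarrow> 0 < h \<longrightarrow> incr n \<phi> j x h \<le> q * h)" if Pq: "P q" for q
    using Pq cube_carrier unfolding P_def by (meson subsetI)
  have "def_pred M (\<lambda>e. P (e 0))"
    unfolding P_def
    by (rule def_intros def_pred_mem_cube def_vec_const[OF u1(1)] def_vec_shift def_fun_shift[OF \<phi>])+
  moreover obtain a where "P a"
  proof -
    obtain t v s where "v \<in> carrier_vec n" "s > 0" "cube n v s \<subseteq> cube n u1 r1"
      "\<forall>x h. x \<in> cube n v s \<longrightarrow> shift n x j h \<in> cube n v s \<longrightarrow> 0 < h \<longrightarrow> incr n \<phi> j x h \<le> t * h"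
      by (rule slope_bounded_above[OF \<phi> j u1(1,2) cont1])
    then have "P t" by (rule PI)
    then show ?thesis by (rule that)
  qed
  moreover have "\<forall>q. P q \<longrightarrow> b \<le> q"
  proof (intro allI impI)
    fix q assume "P q"
    then obtain v s where v: "v \<in> carrier_vec n" "s > 0" "cube n v s \<subseteq> cube n u1 r1"
      "\<forall>x h. x \<in> cube n v s \<longrightarrow> shift n x j h \<in> cube n v s \<longrightarrow> 0 < h \<longrightarrow> incr n \<phi> j x h \<le> q * h"
      using PE by blast
    note half = half_step_in_cube[OF v(1,2) j]
    have "b * (s / 2) \<le> incr n \<phi> j v (s / 2)" using u1(4) half v(3) by blast
    also have "\<dots> \<le> q * (s / 2)" using v(4) half by blast
    finally show "b \<le> q" using half(3) by (rule mult_right_le_imp_le)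
  qed
  ultimately obtain c where c: "\<forall>q. P q \<longrightarrow> c \<le> q" "\<forall>t>c. \<exists>q. P q \<and> q < t"
    by (rule def_inf)
  have "c + \<epsilon> > c" using \<open>\<epsilon> > 0\<close> by simp
  then obtain q where q: "P q" "q < c + \<epsilon>" using c(2) by blast
  then obtain v s where v: "v \<in> carrier_vec n" "s > 0" "cube n v s \<subseteq> cube n u1 r1"
    "\<forall>x h. x \<in> cube n v s \<longrightarrow> shift n x j h \<in> cube n v s \<longrightarrow> 0 < h \<longrightarrow> incr n \<phi> j x h \<le> q * h"
    using PE by blast
  have cont2: "cont_at n \<phi> y" if "y \<in> cube n v s" for y using cont1 v(3) that by blast
  \<comment> \<open>For constant \<open>q\<close> the index is a dummy. The first alternative would
    make \<open>c - \<epsilon>\<close> an upper slope bound on a subcube, below the infimum.\<close>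
  note dich = slope_dichotomy[where q = "\<lambda>_. c - \<epsilon>", OF \<phi> j v(1,2) cont2 def_term_const order_refl]
  have no_upper: False if "v' \<in> carrier_vec n" "s' > 0" "cube n v' s' \<subseteq> cube n v s"
      "\<forall>x h. x \<in> cube n v' s' \<longrightarrow> shift n x j h \<in> cube n v' s' \<longrightarrow> 0 < h \<longrightarrow> incr n \<phi> j x h \<le> (c - \<epsilon>) * h"
    for v' s'
  proof -
    have "cube n v' s' \<subseteq> cube n u1 r1" using that(3) v(3) by blast
    then have "P (c - \<epsilon>)" using PI[OF that(1,2) _ that(4)] by blast
    then have "c \<le> c - \<epsilon>" using c(1) by blast
    then show ?thesis using \<open>\<epsilon> > 0\<close> by simp
  qed
  from dich have "\<exists>v'\<in>carrier_vec n. \<exists>s'>0. cube n v' s' \<subseteq> cube n v s \<and> (\<forall>t>(0::'a).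
      (\<forall>x h. x \<in> cube n v' s' \<longrightarrow> shift n x j h \<in> cube n v' s' \<longrightarrow> 0 < h \<longrightarrow> (c - \<epsilon>) * h \<le> incr n \<phi> j x h))"
  proof
    assume "\<exists>t>(0::'a). \<exists>v'\<in>carrier_vec n. \<exists>s'>0. cube n v' s' \<subseteq> cube n v s \<and>
      (\<forall>x h. x \<in> cube n v' s' \<longrightarrow> shift n x j h \<in> cube n v' s' \<longrightarrow> 0 < h \<longrightarrow> incr n \<phi> j x h \<le> (c - \<epsilon>) * h)"
    then show ?thesis by (elim exE bexE conjE) (drule no_upper, assumption+, erule FalseE)
  qed
  then obtain v' s' where v': "v' \<in> carrier_vec n" "s' > 0" "cube n v' s' \<subseteq> cube n v s"
    and all_t: "\<forall>t>(0::'a). \<forall>x h. x \<in> cube n v' s' \<longrightarrow> shift n x j h \<in> cube n v' s' \<longrightarrow> 0 < h \<longrightarrow> (c - \<epsilon>) * h \<le> incr n \<phi> j x h"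
    by (elim bexE exE conjE)
  have "(0::'a) < 1" by simp
  note lower = all_t[rule_format, OF this]
  have pos: "\<bar>incr n \<phi> j x h - c * h\<bar> \<le> \<epsilon> * h"
    if x: "x \<in> cube n v' s'" "shift n x j h \<in> cube n v' s'" "0 < h" for x h
  proof -
    have "(c - \<epsilon>) * h \<le> incr n \<phi> j x h" by (rule lower[OF x])
    moreover have "incr n \<phi> j x h \<le> q * h" using v(4) v'(3) x by blast
    moreover have "q * h \<le> (c + \<epsilon>) * h" using q(2) x(3) by (intro mult_right_mono) simp_all
    ultimately show ?thesis by (simp add: abs_le_iff algebra_simps)
  qed
  have "\<bar>incr n \<phi> j x h - c * h\<bar> \<le> \<epsilon> * \<bar>h\<bar>"
    if x: "x \<in> cube n v' s'" "shift n x j h \<in> cube n v' s'" for x h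
  proof (cases h "0::'a" rule: linorder_cases)
    case greater
    then show ?thesis using pos[OF x] by simp
  next
    case equal
    then show ?thesis unfolding incr_def using shift_zero[OF cube_carrier[OF x(1)]] by simp
  next
    \<comment> \<open>A negative step from \<open>x\<close> is a positive step from the shifted
      point back to \<open>x\<close>.\<close>
    case less
    have "shift n (shift n x j h) j (- h) = x"
      unfolding shift_shift by (simp add: shift_zero[OF cube_carrier[OF x(1)]])
    then have "\<bar>incr n \<phi> j (shift n x j h) (- h) - c * (- h)\<bar> \<le> \<epsilon> * (- h)"
      using pos[OF x(2), of "- h"] x(1) less by simp
    moreover have "incr n \<phi> j (shift n x j h) (- h) = - incr n \<phi> j x h"
      unfolding incr_def \<open>shift n (shift n x j h) j (- h) = x\<close> by simp
    ultimately show ?thesis using less by (simp add: abs_if split: if_splits)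
  qed
  moreover have "cube n v' s' \<subseteq> cube n u r" using v'(3) v(3) u1(3) by blast
  ultimately show ?thesis using that[OF v'(1,2)] by blast
qed

end

text \<open>The point \<open>y\<close> varies as well, which makes the partial derivative continuous.\<close>

definition strict_partial :: "nat \<Rightarrow> ('a::linordered_field vec \<Rightarrow> 'a) \<Rightarrow> nat \<Rightarrow> 'a vec \<Rightarrow> 'a \<Rightarrow> bool" where
  "strict_partial n \<phi> j x d \<longleftrightarrow> (\<forall>\<epsilon>>0. \<exists>r>0. \<forall>y h. y \<in> cube n x r \<longrightarrow> shift n y j h \<in> cube n x r \<longrightarrow>
     \<bar>incr n \<phi> j y h - d * h\<bar> \<le> \<epsilon> * \<bar>h\<bar>)"

lemma strict_partialE:
  assumes "strict_partial n \<phi> j x d" "\<epsilon> > 0"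
  obtains r where "r > 0" "\<forall>y h. y \<in> cube n x r \<longrightarrow> shift n y j h \<in> cube n x r \<longrightarrow>
     \<bar>incr n \<phi> j y h - d * h\<bar> \<le> \<epsilon> * \<bar>h\<bar>"
  using assms unfolding strict_partial_def by blast

lemma abs_diff_le_of_approx:
  fixes c d h :: "'a::linordered_field"
  assumes "\<bar>a - c * h\<bar> \<le> \<epsilon> * \<bar>h\<bar>" "\<bar>a - d * h\<bar> \<le> \<epsilon>' * \<bar>h\<bar>" "h \<noteq> 0"
  shows "\<bar>c - d\<bar> \<le> \<epsilon> + \<epsilon>'"
proof -
  have "\<bar>c - d\<bar> * \<bar>h\<bar> = \<bar>(a - d * h) - (a - c * h)\<bar>" by (simp add: abs_mult[symmetric] algebra_simps)
  also have "\<dots> \<le> \<bar>a - d * h\<bar> + \<bar>a - c * h\<bar>" by (rule abs_triangle_ineq4)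
  also have "\<dots> \<le> (\<epsilon> + \<epsilon>') * \<bar>h\<bar>" using assms(1,2) by (simp add: algebra_simps)
  finally show ?thesis using assms(3) by (simp add: mult_le_cancel_right)
qed

text \<open>Both \<open>c\<close> and \<open>d\<close> approximate the increment over one and the
  same short step from \<open>x\<close>. Uniqueness of the derivative and, with \<open>c\<close> the
  derivative at a neighbouring point, its continuity both follow from this.\<close>

lemma strict_partial_approx:
  assumes d: "strict_partial n \<phi> j x d" and j: "j < n" and x: "x \<in> cube n v s"
    and c: "\<forall>y h. y \<in> cube n v s \<longrightarrow> shift n y j h \<in> cube n v s \<longrightarrow> \<bar>incr n \<phi> j y h - c * h\<bar> \<le> \<epsilon> * \<bar>h\<bar>"
  shows "\<bar>c - d\<bar> \<le> \<epsilon>"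
proof (rule field_le_epsilon)
  fix e :: 'a assume "0 < e"
  obtain r where r: "r > 0" "\<forall>y h. y \<in> cube n x r \<longrightarrow> shift n y j h \<in> cube n x r \<longrightarrow>
     \<bar>incr n \<phi> j y h - d * h\<bar> \<le> e * \<bar>h\<bar>"
    by (rule strict_partialE[OF d \<open>0 < e\<close>])
  have xc: "x \<in> carrier_vec n" by (rule cube_carrier[OF x])
  obtain \<rho> where rho: "\<rho> > 0" "cube n x \<rho> \<subseteq> cube n v s" "cube n x \<rho> \<subseteq> cube n x r"
    by (rule cube_refine[OF x center_in_cube[OF xc r(1)]])
  have x\<rho>: "x \<in> cube n x \<rho>" "shift n x j (\<rho> / 2) \<in> cube n x \<rho>"
    using center_in_cube[OF xc rho(1)] shift_small_in_cube[OF xc j, of "\<rho> / 2" \<rho>] rho(1) by simp_all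
  have "\<bar>incr n \<phi> j x (\<rho> / 2) - c * (\<rho> / 2)\<bar> \<le> \<epsilon> * \<bar>\<rho> / 2\<bar>" using c x\<rho> rho(2) by blast
  moreover have "\<bar>incr n \<phi> j x (\<rho> / 2) - d * (\<rho> / 2)\<bar> \<le> e * \<bar>\<rho> / 2\<bar>" using r(2) x\<rho> rho(3) by blast
  moreover have "\<rho> / 2 \<noteq> 0" using rho(1) by simp
  ultimately show "\<bar>c - d\<bar> \<le> \<epsilon> + e" by (rule abs_diff_le_of_approx)
qed

lemma strict_partial_unique:
  assumes "strict_partial n \<phi> j x d" "strict_partial n \<phi> j x d'" "j < n" "x \<in> carrier_vec n"
  shows "d = d'"
proof -
  have "\<bar>d - d'\<bar> \<le> 0"
  proof (rule field_le_epsilon)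
    fix e :: 'a assume "0 < e"
    obtain r where r: "r > 0" "\<forall>y h. y \<in> cube n x r \<longrightarrow> shift n y j h \<in> cube n x r \<longrightarrow>
       \<bar>incr n \<phi> j y h - d * h\<bar> \<le> e * \<bar>h\<bar>"
      by (rule strict_partialE[OF assms(1) \<open>0 < e\<close>])
    have "\<bar>d - d'\<bar> \<le> e"
      by (rule strict_partial_approx[OF assms(2,3) center_in_cube[OF assms(4) r(1)] r(2)])
    then show "\<bar>d - d'\<bar> \<le> 0 + e" by simp
  qed
  then show ?thesis by simp
qed

lemma def_strict_partial:
  assumes "def_fun M n \<phi>" "def_vec M n v" "def_term M t"
  shows "def_pred M (\<lambda>e. strict_partial n \<phi> j (v e) (t e))"
proof -
  have eq: "strict_partial n \<phi> j x d \<longleftrightarrow> (\<forall>\<epsilon>. 0 < \<epsilon> \<longrightarrow> (\<exists>r. 0 < r \<and> (\<forall>y\<in>carrier_vec n. \<forall>h.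
     y \<in> cube n x r \<longrightarrow> shift n y j h \<in> cube n x r \<longrightarrow> \<bar>incr n \<phi> j y h - d * h\<bar> \<le> \<epsilon> * \<bar>h\<bar>)))" for x d
    unfolding strict_partial_def using cube_carrier by meson
  have "def_pred M (\<lambda>e. strict_partial n \<phi> j (vec n (\<lambda>i. e (Suc i))) (e 0))"
    unfolding eq by (rule def_intros def_pred_mem_cube def_vec_shift def_fun_shift[OF assms(1)] | assumption)+
  then show ?thesis
    using assms(3,2) by (rule def_pred_subst_scalar_vec[where R = "\<lambda>d x. strict_partial n \<phi> j x d"])
qed

text \<open>The points near which no constant approximates the slopes to within \<open>1 / t\<close>
  are nowhere dense by \<open>slope_oscillation\<close>, and they increase with \<open>t\<close>.
  Off their union the nearby slopes satisfy a Cauchy condition.\<close>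

lemma (in restrained_expansion) strict_partial_dense:
  assumes \<phi>: "def_fun M n \<phi>" and j: "j < n" and u: "u \<in> carrier_vec n" "r > 0"
    and cont: "\<And>y. y \<in> cube n u r \<Longrightarrow> cont_at n \<phi> y"
  obtains v s where "v \<in> carrier_vec n" "s > 0" "cube n v s \<subseteq> cube n u r"
    "\<forall>x\<in>cube n v s. \<exists>d. strict_partial n \<phi> j x d"
proof -
  define osc where "osc \<epsilon> x \<longleftrightarrow> (\<exists>s. 0 < s \<and> (\<exists>c. \<forall>y\<in>carrier_vec n. \<forall>h. y \<in> cube n x s \<longrightarrow>
      shift n y j h \<in> cube n x s \<longrightarrow> \<bar>incr n \<phi> j y h - c * h\<bar> \<le> \<epsilon> * \<bar>h\<bar>))" for \<epsilon> x
  define A where "A t = {x \<in> carrier_vec n. x \<in> cube n u r \<and> \<not> osc (1 / t) x}" for t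
  have defA: "def_family M n A"
    unfolding def_family_def A_def mem_Collect_eq osc_def
    by (rule def_intros def_pred_carrier def_pred_mem_cube def_vec_const[OF u(1)] def_vec_shift def_fun_shift[OF \<phi>])+
  have osc_mono: "osc \<epsilon> x \<Longrightarrow> \<epsilon> \<le> \<epsilon>' \<Longrightarrow> osc \<epsilon>' x" for \<epsilon> \<epsilon>' x
    unfolding osc_def by (meson abs_ge_zero mult_right_mono order_trans)
  have monoA: "A s \<subseteq> A t" if st: "0 < s" "s \<le> t" for s t
  proof -
    have "1 / t \<le> 1 / s" using st by (simp add: frac_le)
    then show ?thesis unfolding A_def using osc_mono by blast
  qed
  have ndA: "nowhere_dense_cubes n (A t)" if t: "t > 0" for t
  proof (rule nowhere_dense_cubesI_dense)
    fix x0 r0 assume x0: "x0 \<in> carrier_vec n" "r0 > 0" "dense_in_cube n (A t) x0 r0"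
    have "A t \<subseteq> cube n u r" unfolding A_def by blast
    then obtain y s where y: "y \<in> carrier_vec n" "s > 0" "cube n y s \<subseteq> cube n x0 r0" "cube n y s \<subseteq> cube n u r"
        "dense_in_cube n (A t) y s"
      using x0(3,1,2) by (rule dense_subcube)
    have "1 / t > 0" using t by simp
    have cont_y: "cont_at n \<phi> z" if "z \<in> cube n y s" for z using cont y(4) that by blast
    obtain c v s' where v: "v \<in> carrier_vec n" "s' > 0" "cube n v s' \<subseteq> cube n y s"
      "\<forall>x h. x \<in> cube n v s' \<longrightarrow> shift n x j h \<in> cube n v s' \<longrightarrow> \<bar>incr n \<phi> j x h - c * h\<bar> \<le> 1 / t * \<bar>h\<bar>"
      by (rule slope_oscillation[OF \<phi> j y(1,2) cont_y \<open>1 / t > 0\<close>])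
    obtain x where x: "x \<in> cube n v s'" "x \<in> A t" by (rule dense_in_cube_meets[OF y(5) v(1-3)])
    obtain \<rho> where rho: "\<rho> > 0" "cube n x \<rho> \<subseteq> cube n v s'" by (rule cube_open[OF x(1)])
    have "\<forall>y\<in>carrier_vec n. \<forall>h. y \<in> cube n x \<rho> \<longrightarrow> shift n y j h \<in> cube n x \<rho> \<longrightarrow>
        \<bar>incr n \<phi> j y h - c * h\<bar> \<le> 1 / t * \<bar>h\<bar>" using rho(2) v(4) by blast
    then have "osc (1 / t) x" unfolding osc_def using rho(1) by blast
    then show False using x(2) unfolding A_def by blast
  qed
  have "nowhere_dense_cubes n {x. \<exists>t>0. x \<in> A t}" by (rule increasing_union[OF defA ndA monoA])
  then obtain v s where v: "v \<in> carrier_vec n" "s > 0" "cube n v s \<subseteq> cube n u r"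
      "cube n v s \<inter> {x. \<exists>t>0. x \<in> A t} = {}"
    using u by (rule nowhere_dense_cubesD)
  have "\<exists>d. strict_partial n \<phi> j x d" if x: "x \<in> cube n v s" for x
  proof -
    have xc: "x \<in> carrier_vec n" by (rule cube_carrier[OF x])
    have osc: "\<exists>s c. 0 < s \<and> (\<forall>y h. y \<in> cube n x s \<longrightarrow>
      shift n y j h \<in> cube n x s \<longrightarrow> \<bar>incr n \<phi> j y h - c * h\<bar> \<le> \<epsilon> * \<bar>h\<bar>)" if eps: "\<epsilon> > 0" for \<epsilon>
    proof -
      have "1 / \<epsilon> > 0" using eps by simp
      then have "x \<notin> A (1 / \<epsilon>)" using v(4) x by blast
      then have "osc (1 / (1 / \<epsilon>)) x" unfolding A_def using xc x v(3) by blast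
      then have "osc \<epsilon> x" by simp
      then show ?thesis unfolding osc_def using cube_carrier by meson
    qed
    \<comment> \<open>The limit is found as a supremum: that of the lower bounds for the slopes of
      short steps to the right. Any constant that approximates the slopes near \<open>x\<close> to
      within \<open>\<epsilon>\<close> differs from it by at most \<open>\<epsilon>\<close>.\<close>
    define P where "P q \<longleftrightarrow> (\<exists>\<rho>. 0 < \<rho> \<and> (\<forall>h. 0 < h \<longrightarrow> h < \<rho> \<longrightarrow> q * h \<le> incr n \<phi> j x h))" for q
    have defP: "def_pred M (\<lambda>e. P (e 0))"
      unfolding P_def by (rule def_intros def_fun_shift[OF \<phi>] def_vec_const[OF xc])+
    have bounds: "P (c - \<epsilon>) \<and> (\<forall>q. P q \<longrightarrow> q \<le> c + \<epsilon>)"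
      if s: "0 < s" "\<forall>y h. y \<in> cube n x s \<longrightarrow> shift n y j h \<in> cube n x s \<longrightarrow> \<bar>incr n \<phi> j y h - c * h\<bar> \<le> \<epsilon> * \<bar>h\<bar>"
      for s c \<epsilon>
    proof -
      have near: "\<bar>incr n \<phi> j x h - c * h\<bar> \<le> \<epsilon> * h" if h: "0 < h" "h < s" for h
      proof -
        have "shift n x j h \<in> cube n x s" using shift_small_in_cube[OF xc j, of h s] h by simp
        then have "\<bar>incr n \<phi> j x h - c * h\<bar> \<le> \<epsilon> * \<bar>h\<bar>" using s(2) center_in_cube[OF xc s(1)] by blast
        then show ?thesis using h by simp
      qed
      have "(c - \<epsilon>) * h \<le> incr n \<phi> j x h" if "0 < h" "h < s" for h
        using near[OF that] by (simp add: abs_le_iff algebra_simps)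
      then have "P (c - \<epsilon>)" unfolding P_def using s(1) by blast
      moreover have "q \<le> c + \<epsilon>" if Pq: "P q" for q
      proof -
        obtain \<rho> where rho: "0 < \<rho>" "\<forall>h. 0 < h \<longrightarrow> h < \<rho> \<longrightarrow> q * h \<le> incr n \<phi> j x h" using Pq unfolding P_def by blast
        define h where "h = min s \<rho> / 2"
        have h: "0 < h" "h < s" "h < \<rho>" unfolding h_def using s(1) rho(1) by (simp_all add: min_def)
        have "q * h \<le> (c + \<epsilon>) * h" using near[OF h(1,2)] rho(2) h by (fastforce simp: abs_le_iff algebra_simps)
        then show ?thesis using h(1) by (rule mult_right_le_imp_le)
      qed
      ultimately show ?thesis by blast
    qed
    obtain s1 c1 where s1: "0 < s1" "\<forall>y h. y \<in> cube n x s1 \<longrightarrow> shift n y j h \<in> cube n x s1 \<longrightarrow> \<bar>incr n \<phi> j y h - c1 * h\<bar> \<le> 1 * \<bar>h\<bar>"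
      using osc[of 1] by auto
    from bounds[OF s1] have b1: "P (c1 - 1)" "\<forall>q. P q \<longrightarrow> q \<le> c1 + 1" by blast+
    obtain d where d: "\<forall>q. P q \<longrightarrow> q \<le> d" "\<forall>t<d. \<exists>q. P q \<and> t < q"
      by (rule def_sup[OF defP b1])
    have "strict_partial n \<phi> j x d"
      unfolding strict_partial_def
    proof (intro allI impI)
      fix \<epsilon> :: 'a assume "\<epsilon> > 0"
      then have "\<epsilon> / 2 > 0" by simp
      from osc[OF this] obtain s2 c where s2: "0 < s2"
        "\<forall>y h. y \<in> cube n x s2 \<longrightarrow> shift n y j h \<in> cube n x s2 \<longrightarrow> \<bar>incr n \<phi> j y h - c * h\<bar> \<le> \<epsilon> / 2 * \<bar>h\<bar>" by blast
      from bounds[OF s2] have b: "P (c - \<epsilon> / 2)" "\<forall>q. P q \<longrightarrow> q \<le> c + \<epsilon> / 2" by blast+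
      have "c - \<epsilon> / 2 \<le> d" using d(1) b(1) by blast
      moreover have "d \<le> c + \<epsilon> / 2"
      proof (rule ccontr)
        assume "\<not> d \<le> c + \<epsilon> / 2"
        then have "c + \<epsilon> / 2 < d" by simp
        then obtain q where "P q" "c + \<epsilon> / 2 < q" using d(2) by blast
        then show False using b(2) by (meson not_le)
      qed
      ultimately have cd: "\<bar>c - d\<bar> \<le> \<epsilon> / 2" unfolding abs_le_iff by linarith
      have "\<bar>incr n \<phi> j y h - d * h\<bar> \<le> \<epsilon> * \<bar>h\<bar>" if y: "y \<in> cube n x s2" "shift n y j h \<in> cube n x s2" for y h
      proof -
        have "incr n \<phi> j y h - d * h = (incr n \<phi> j y h - c * h) + (c - d) * h" by (simp add: algebra_simps)
        then have "\<bar>incr n \<phi> j y h - d * h\<bar> \<le> \<bar>incr n \<phi> j y h - c * h\<bar> + \<bar>c - d\<bar> * \<bar>h\<bar>"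
          using abs_triangle_ineq[of "incr n \<phi> j y h - c * h" "(c - d) * h"] by (simp only: abs_mult)
        moreover have "\<bar>incr n \<phi> j y h - c * h\<bar> \<le> \<epsilon> / 2 * \<bar>h\<bar>" using s2(2) y by blast
        moreover have "\<bar>c - d\<bar> * \<bar>h\<bar> \<le> \<epsilon> / 2 * \<bar>h\<bar>" by (rule mult_right_mono[OF cd abs_ge_zero])
        moreover have "\<epsilon> / 2 * \<bar>h\<bar> + \<epsilon> / 2 * \<bar>h\<bar> = \<epsilon> * \<bar>h\<bar>" by (simp add: distrib_right[symmetric])
        ultimately show ?thesis by linarith
      qed
      then show "\<exists>r>0. \<forall>y h. y \<in> cube n x r \<longrightarrow> shift n y j h \<in> cube n x r \<longrightarrow> \<bar>incr n \<phi> j y h - d * h\<bar> \<le> \<epsilon> * \<bar>h\<bar>"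
        using s2(1) by blast
    qed
    then show ?thesis by blast
  qed
  then show ?thesis using that[OF v(1-3)] by blast
qed

section \<open>Smoothness on a dense open set\<close>

definition open_cubes :: "nat \<Rightarrow> 'a::linordered_field vec set \<Rightarrow> bool" where
  "open_cubes n U \<longleftrightarrow> U \<subseteq> carrier_vec n \<and> (\<forall>x\<in>U. \<exists>r>0. cube n x r \<subseteq> U)"

text \<open>For open \<open>U\<close> this says that the interior of \<open>G\<close> is dense in
  \<open>U\<close>. Unlike mere density, the property survives finite intersections.\<close>

definition dense_cubes_in :: "nat \<Rightarrow> 'a::linordered_field vec set \<Rightarrow> 'a vec set \<Rightarrow> bool" where
  "dense_cubes_in n U G \<longleftrightarrow> (\<forall>u\<in>carrier_vec n. \<forall>r>0. cube n u r \<subseteq> U \<longrightarrow>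
     (\<exists>v\<in>carrier_vec n. \<exists>s>0. cube n v s \<subseteq> cube n u r \<and> cube n v s \<subseteq> G))"

lemma openin_iff_open_cubes:
  fixes U :: "'a::{linordered_field, linorder_topology} vec set"
  shows "openin (vec_topology n) U \<longleftrightarrow> open_cubes n U"
  unfolding openin_vec_topology open_cubes_def ..

lemma dense_cubes_inE:
  assumes "dense_cubes_in n U G" "u \<in> carrier_vec n" "r > 0" "cube n u r \<subseteq> U"
  obtains v s where "v \<in> carrier_vec n" "s > 0" "cube n v s \<subseteq> cube n u r" "cube n v s \<subseteq> G"
  using assms unfolding dense_cubes_in_def by blast

lemma dense_cubes_in_trans:
  assumes "dense_cubes_in n U G" "dense_cubes_in n G H"
  shows "dense_cubes_in n U H"
  unfolding dense_cubes_in_def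
proof (intro ballI allI impI)
  fix u r assume u: "u \<in> carrier_vec n" "(r::'a) > 0" "cube n u r \<subseteq> U"
  obtain v s where v: "v \<in> carrier_vec n" "s > 0" "cube n v s \<subseteq> cube n u r" "cube n v s \<subseteq> G"
    by (rule dense_cubes_inE[OF assms(1) u])
  obtain w t where w: "w \<in> carrier_vec n" "t > 0" "cube n w t \<subseteq> cube n v s" "cube n w t \<subseteq> H"
    by (rule dense_cubes_inE[OF assms(2) v(1,2,4)])
  have "cube n w t \<subseteq> cube n u r" using w(3) v(3) by blast
  then show "\<exists>v\<in>carrier_vec n. \<exists>s>0. cube n v s \<subseteq> cube n u r \<and> cube n v s \<subseteq> H"
    using w(1,2,4) by blast
qed

lemma dense_cubes_in_all_less:
  fixes k :: nat
  assumes "\<And>i. i < k \<Longrightarrow> dense_cubes_in n U (G i)"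
  shows "dense_cubes_in n U {x \<in> U. \<forall>i<k. x \<in> G i}"
  using assms
proof (induction k)
  case 0
  show ?case unfolding dense_cubes_in_def by auto
next
  case (Suc k)
  then have IH: "dense_cubes_in n U {x \<in> U. \<forall>i<k. x \<in> G i}" by simp
  show ?case
    unfolding dense_cubes_in_def
  proof (intro ballI allI impI)
    fix u r assume u: "u \<in> carrier_vec n" "(r::'a) > 0" "cube n u r \<subseteq> U"
    obtain v s where v: "v \<in> carrier_vec n" "s > 0" "cube n v s \<subseteq> cube n u r" "cube n v s \<subseteq> {x \<in> U. \<forall>i<k. x \<in> G i}"
      by (rule dense_cubes_inE[OF IH u])
    have "cube n v s \<subseteq> U" using v(4) by blast
    moreover have "dense_cubes_in n U (G k)" using Suc.prems by simp
    ultimately obtain w t where w: "w \<in> carrier_vec n" "t > 0" "cube n w t \<subseteq> cube n v s" "cube n w t \<subseteq> G k"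
      using dense_cubes_inE[OF _ v(1,2)] by blast
    have "cube n w t \<subseteq> {x \<in> U. \<forall>i<Suc k. x \<in> G i}"
      using w(3,4) v(4) by (auto simp: less_Suc_eq)
    moreover have "cube n w t \<subseteq> cube n u r" using w(3) v(3) by blast
    ultimately show "\<exists>v\<in>carrier_vec n. \<exists>s>0. cube n v s \<subseteq> cube n u r \<and> cube n v s \<subseteq> {x \<in> U. \<forall>i<Suc k. x \<in> G i}"
      using w(1,2) by blast
  qed
qed

lemma open_cubes_all_less:
  fixes k :: nat
  assumes U: "open_cubes n U" and G: "\<And>i. i < k \<Longrightarrow> open_cubes n (G i)"
  shows "open_cubes n {x \<in> U. \<forall>i<k. x \<in> G i}"
  unfolding open_cubes_def
proof (intro conjI ballI)
  show "{x \<in> U. \<forall>i<k. x \<in> G i} \<subseteq> carrier_vec n" using U unfolding open_cubes_def by blast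
  fix x assume x: "x \<in> {x \<in> U. \<forall>i<k. x \<in> G i}"
  have "\<exists>r>0. \<forall>i<k. cube n x r \<subseteq> G i"
  proof (rule ex_pos_all_less)
    show "\<exists>r>0. cube n x r \<subseteq> G i" if "i < k" for i
      using G[OF that] x that unfolding open_cubes_def by blast
    show "cube n x s' \<subseteq> G i" if "cube n x s \<subseteq> G i" "s' \<le> s" for i s s'
      using that cube_mono[of s' s n x] by blast
  qed
  then obtain r where r: "r > 0" "\<forall>i<k. cube n x r \<subseteq> G i" by blast
  obtain r' where r': "r' > 0" "cube n x r' \<subseteq> U" using U x unfolding open_cubes_def by blast
  have sub: "cube n x (min r r') \<subseteq> cube n x r" "cube n x (min r r') \<subseteq> cube n x r'" by (simp_all add: cube_mono)
  have "cube n x (min r r') \<subseteq> {x \<in> U. \<forall>i<k. x \<in> G i}" using sub r(2) r'(2) by blast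
  moreover have "min r r' > 0" using r(1) r'(1) by simp
  ultimately show "\<exists>r>0. cube n x r \<subseteq> {x \<in> U. \<forall>i<k. x \<in> G i}" by blast
qed

lemma continuous_map_vec_iff:
  fixes f :: "'a::{linordered_field, linorder_topology} vec \<Rightarrow> 'a vec"
  assumes U: "open_cubes n U"
  shows "continuous_map (subtopology (vec_topology n) U) (vec_topology m) f \<longleftrightarrow>
    (\<forall>x\<in>U. f x \<in> carrier_vec m \<and> (\<forall>i<m. cont_at n (\<lambda>y. f y $ i) x))"
proof -
  have Uc: "U \<subseteq> carrier_vec n" using U unfolding open_cubes_def by blast
  have top: "topspace (subtopology (vec_topology n) U) = U" using Uc by auto
  have op: "openin (subtopology (vec_topology n) U) S \<longleftrightarrow> S \<subseteq> U \<and> (\<forall>x\<in>S. \<exists>r>0. cube n x r \<subseteq> S)" for S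
    using openin_open_subtopology[of "vec_topology n" U S] U Uc
    unfolding openin_iff_open_cubes open_cubes_def by blast
  show ?thesis
  proof
    assume f: "continuous_map (subtopology (vec_topology n) U) (vec_topology m) f"
    have fc: "f x \<in> carrier_vec m" if "x \<in> U" for x
      using f that unfolding continuous_map_def top topspace_vec_topology by blast
    have "cont_at n (\<lambda>y. f y $ i) x" if x: "x \<in> U" and i: "i < m" for x i
      unfolding cont_at_def
    proof (intro allI impI)
      fix \<epsilon> :: 'a assume eps: "\<epsilon> > 0"
      have "openin (subtopology (vec_topology n) U) {y \<in> U. f y \<in> cube m (f x) \<epsilon>}"
        using f openin_cube[of m "f x" \<epsilon>] unfolding continuous_map_def top by blast
      moreover have "x \<in> {y \<in> U. f y \<in> cube m (f x) \<epsilon>}" using x center_in_cube[OF fc[OF x] eps] by blast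
      ultimately obtain \<delta> where d: "\<delta> > 0" "cube n x \<delta> \<subseteq> {y \<in> U. f y \<in> cube m (f x) \<epsilon>}" unfolding op by blast
      have "\<bar>f y $ i - f x $ i\<bar> < \<epsilon>" if "y \<in> cube n x \<delta>" for y
        using that d(2) cube_center_radius[of "f y" m "f x" \<epsilon> i] i by blast
      then show "\<exists>\<delta>>0. \<forall>y\<in>cube n x \<delta>. \<bar>f y $ i - f x $ i\<bar> < \<epsilon>" using d(1) by blast
    qed
    then show "\<forall>x\<in>U. f x \<in> carrier_vec m \<and> (\<forall>i<m. cont_at n (\<lambda>y. f y $ i) x)" using fc by blast
  next
    assume f: "\<forall>x\<in>U. f x \<in> carrier_vec m \<and> (\<forall>i<m. cont_at n (\<lambda>y. f y $ i) x)"
    have "openin (subtopology (vec_topology n) U) {x \<in> U. f x \<in> V}" if V: "openin (vec_topology m) V" for V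
      unfolding op
    proof (intro conjI ballI)
      show "{x \<in> U. f x \<in> V} \<subseteq> U" by blast
      fix x assume x: "x \<in> {x \<in> U. f x \<in> V}"
      then obtain \<epsilon> where eps: "\<epsilon> > 0" "cube m (f x) \<epsilon> \<subseteq> V" using V unfolding openin_vec_topology by blast
      have "\<exists>\<delta>>0. \<forall>i<m. \<forall>y\<in>cube n x \<delta>. \<bar>f y $ i - f x $ i\<bar> < \<epsilon>"
      proof (rule ex_pos_all_less)
        show "\<exists>\<delta>>0. \<forall>y\<in>cube n x \<delta>. \<bar>f y $ i - f x $ i\<bar> < \<epsilon>" if "i < m" for i
          using f x that eps(1) unfolding cont_at_def by blast
        show "\<forall>y\<in>cube n x s'. \<bar>f y $ i - f x $ i\<bar> < \<epsilon>"
          if "\<forall>y\<in>cube n x s. \<bar>f y $ i - f x $ i\<bar> < \<epsilon>" "s' \<le> s" for i s s'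
          using that cube_mono[of s' s n x] by blast
      qed
      then obtain \<delta> where d: "\<delta> > 0" "\<forall>i<m. \<forall>y\<in>cube n x \<delta>. \<bar>f y $ i - f x $ i\<bar> < \<epsilon>" by blast
      obtain r where r: "r > 0" "cube n x r \<subseteq> U" using U x unfolding open_cubes_def by blast
      have sub: "cube n x (min \<delta> r) \<subseteq> cube n x \<delta>" "cube n x (min \<delta> r) \<subseteq> cube n x r" by (simp_all add: cube_mono)
      have "cube n x (min \<delta> r) \<subseteq> {x \<in> U. f x \<in> V}"
      proof
        fix y assume y: "y \<in> cube n x (min \<delta> r)"
        have yU: "y \<in> U" using y sub(2) r(2) by blast
        have "f y \<in> cube m (f x) \<epsilon>" unfolding cube_def using f yU d(2) y sub(1) by blast
        then show "y \<in> {x \<in> U. f x \<in> V}" using yU eps(2) by blast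
      qed
      moreover have "min \<delta> r > 0" using d(1) r(1) by simp
      ultimately show "\<exists>r>0. cube n x r \<subseteq> {x \<in> U. f x \<in> V}" by blast
    qed
    moreover have "f \<in> U \<rightarrow> carrier_vec m" using f by blast
    ultimately show "continuous_map (subtopology (vec_topology n) U) (vec_topology m) f"
      unfolding continuous_map_def top topspace_vec_topology by blast
  qed
qed

section \<open>The maximum norm, and differentials from strict partial derivatives\<close>

lemma max_norm_le_iff:
  "0 \<le> c \<Longrightarrow> max_norm v \<le> c \<longleftrightarrow> (\<forall>i<dim_vec v. \<bar>v $ i\<bar> \<le> c)"
  unfolding max_norm_def by (subst Max_le_iff) auto

lemma max_norm_less_iff:
  "0 < c \<Longrightarrow> max_norm v < c \<longleftrightarrow> (\<forall>i<dim_vec v. \<bar>v $ i\<bar> < c)"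
  unfolding max_norm_def by (subst Max_less_iff) auto

lemma max_norm_nonneg: "0 \<le> max_norm v"
  unfolding max_norm_def by (rule Max_ge) auto

lemma component_le_max_norm: "i < dim_vec v \<Longrightarrow> \<bar>v $ i\<bar> \<le> max_norm v"
  using max_norm_le_iff[OF max_norm_nonneg[of v], of v] by blast

lemma max_norm_diff_less_iff:
  assumes "x \<in> carrier_vec n" "y \<in> carrier_vec n" "0 < r"
  shows "max_norm (y - x) < r \<longleftrightarrow> y \<in> cube n x r"
  unfolding max_norm_less_iff[OF assms(3)] cube_def using assms(1,2) by auto

text \<open>One passes from \<open>x\<close> to \<open>y\<close> by changing one coordinate at a
  time. The increments are taken at intermediate points, about which ordinary partial derivatives at
  \<open>x\<close> say nothing; approximation on a whole cube with the constants \<open>A j\<close>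
  covers them.\<close>

lemma strict_partials_telescope:
  assumes x: "x \<in> carrier_vec n" and y: "y \<in> cube n x r"
    and A: "\<And>j z h. j < n \<Longrightarrow> z \<in> cube n x r \<Longrightarrow> shift n z j h \<in> cube n x r \<Longrightarrow>
      \<bar>incr n \<phi> j z h - A j * h\<bar> \<le> \<epsilon> * \<bar>h\<bar>"
    and N: "\<And>j. j < n \<Longrightarrow> \<bar>y $ j - x $ j\<bar> \<le> N" and "0 \<le> \<epsilon>"
  shows "\<bar>\<phi> y - \<phi> x - (\<Sum>j<n. A j * (y $ j - x $ j))\<bar> \<le> of_nat n * (\<epsilon> * N)"
proof -
  define z where "z k = vec n (\<lambda>l. if l < k then y $ l else x $ l)" for k
  have zc: "z k \<in> cube n x r" for k
    using y cube_center_radius[OF y] unfolding cube_def z_def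
    by (auto intro: le_less_trans[OF abs_ge_zero])
  have "\<bar>\<phi> (z k) - \<phi> x - (\<Sum>j<k. A j * (y $ j - x $ j))\<bar> \<le> of_nat k * (\<epsilon> * N)" if "k \<le> n" for k
    using that
  proof (induction k)
    case 0
    have "z 0 = x" unfolding z_def using x by (intro eq_vecI) auto
    then show ?case by simp
  next
    case (Suc k)
    then have k: "k < n" by simp
    define h where "h = y $ k - x $ k"
    have zk: "z (Suc k) = shift n (z k) k h"
      unfolding z_def shift_def h_def by (intro eq_vecI) auto
    have "\<bar>incr n \<phi> k (z k) h - A k * h\<bar> \<le> \<epsilon> * \<bar>h\<bar>"
      by (rule A[OF k zc]) (use zc[of "Suc k"] zk in simp)
    also have "\<dots> \<le> \<epsilon> * N" using N[OF k] assms(5) unfolding h_def by (rule mult_left_mono)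
    finally have 1: "\<bar>incr n \<phi> k (z k) h - A k * h\<bar> \<le> \<epsilon> * N" .
    have "\<bar>\<phi> (z k) - \<phi> x - (\<Sum>j<k. A j * (y $ j - x $ j))\<bar> \<le> of_nat k * (\<epsilon> * N)"
      using Suc by simp
    moreover have "\<phi> (z (Suc k)) - \<phi> x - (\<Sum>j<Suc k. A j * (y $ j - x $ j)) =
        (\<phi> (z k) - \<phi> x - (\<Sum>j<k. A j * (y $ j - x $ j))) + (incr n \<phi> k (z k) h - A k * h)"
      unfolding incr_def zk by (simp add: h_def algebra_simps)
    ultimately have "\<bar>\<phi> (z (Suc k)) - \<phi> x - (\<Sum>j<Suc k. A j * (y $ j - x $ j))\<bar> \<le> of_nat k * (\<epsilon> * N) + \<epsilon> * N"
      using 1 abs_triangle_ineq[of "\<phi> (z k) - \<phi> x - (\<Sum>j<k. A j * (y $ j - x $ j))" "incr n \<phi> k (z k) h - A k * h"]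
      by linarith
    then show ?case by (simp add: algebra_simps)
  qed
  from this[of n] have "\<bar>\<phi> (z n) - \<phi> x - (\<Sum>j<n. A j * (y $ j - x $ j))\<bar> \<le> of_nat n * (\<epsilon> * N)" by simp
  moreover have "z n = y" unfolding z_def using cube_carrier[OF y] by (intro eq_vecI) auto
  ultimately show ?thesis by simp
qed

lemma mult_mat_vec_diff_index:
  assumes "i < m" "x \<in> carrier_vec n" "y \<in> carrier_vec n" "A \<in> carrier_mat m n"
  shows "(A *\<^sub>v (y - x)) $ i = (\<Sum>j<n. A $$ (i, j) * (y $ j - x $ j))"
  using assms by (auto simp: scalar_prod_def lessThan_atLeast0 intro!: sum.cong)

lemma has_differential_of_strict_partials:
  assumes x: "x \<in> carrier_vec n" "f x \<in> carrier_vec m" and A: "A \<in> carrier_mat m n"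
    and d: "\<And>i j. i < m \<Longrightarrow> j < n \<Longrightarrow> strict_partial n (\<lambda>y. f y $ i) j x (A $$ (i, j))"
  shows "has_differential n m f x A"
  unfolding has_differential_def
proof (intro conjI A allI impI)
  fix \<epsilon> :: 'a assume eps: "\<epsilon> > 0"
  \<comment> \<open>The \<open>n\<close> coordinate errors add up to at most
    \<open>\<epsilon>\<close>; dividing by \<open>n + 1\<close> includes the case
    \<open>n = 0\<close>.\<close>
  define \<epsilon>' where "\<epsilon>' = \<epsilon> / (of_nat n + 1)"
  have n1: "(0::'a) < of_nat n + 1" by (simp add: add_nonneg_pos)
  have eps': "\<epsilon>' > 0" unfolding \<epsilon>'_def using eps n1 by simp
  have eps'n: "of_nat n * \<epsilon>' \<le> \<epsilon>"
  proof -
    have "of_nat n * \<epsilon>' \<le> (of_nat n + 1) * \<epsilon>'" using eps' by (intro mult_right_mono) simp_all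
    also have "\<dots> = \<epsilon>" unfolding \<epsilon>'_def using n1 by simp
    finally show ?thesis .
  qed
  have mono: "\<forall>y h. y \<in> cube n x s' \<longrightarrow> shift n y j h \<in> cube n x s' \<longrightarrow> Q y h"
    if "\<forall>y h. y \<in> cube n x s \<longrightarrow> shift n y j h \<in> cube n x s \<longrightarrow> Q y h" "s' \<le> s" for s s' j Q
    using that cube_mono[of s' s n x] by blast
  have "\<exists>r>0. \<forall>i<m. \<forall>j<n. \<forall>y h. y \<in> cube n x r \<longrightarrow> shift n y j h \<in> cube n x r \<longrightarrow>
     \<bar>incr n (\<lambda>y. f y $ i) j y h - A $$ (i, j) * h\<bar> \<le> \<epsilon>' * \<bar>h\<bar>"
  proof (rule ex_pos_all_less)
    fix i assume i: "i < m"
    show "\<exists>r>0. \<forall>j<n. \<forall>y h. y \<in> cube n x r \<longrightarrow> shift n y j h \<in> cube n x r \<longrightarrow>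
       \<bar>incr n (\<lambda>y. f y $ i) j y h - A $$ (i, j) * h\<bar> \<le> \<epsilon>' * \<bar>h\<bar>"
    proof (rule ex_pos_all_less)
      fix j assume j: "j < n"
      show "\<exists>r>0. \<forall>y h. y \<in> cube n x r \<longrightarrow> shift n y j h \<in> cube n x r \<longrightarrow>
         \<bar>incr n (\<lambda>y. f y $ i) j y h - A $$ (i, j) * h\<bar> \<le> \<epsilon>' * \<bar>h\<bar>"
        using d[OF i j] eps' unfolding strict_partial_def by blast
    qed (rule mono)
  next
    fix i s s'
    assume *: "\<forall>j<n. \<forall>y h. y \<in> cube n x s \<longrightarrow> shift n y j h \<in> cube n x s \<longrightarrow>
       \<bar>incr n (\<lambda>y. f y $ i) j y h - A $$ (i, j) * h\<bar> \<le> \<epsilon>' * \<bar>h\<bar>" and "s' \<le> (s::'a)"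
    show "\<forall>j<n. \<forall>y h. y \<in> cube n x s' \<longrightarrow> shift n y j h \<in> cube n x s' \<longrightarrow>
       \<bar>incr n (\<lambda>y. f y $ i) j y h - A $$ (i, j) * h\<bar> \<le> \<epsilon>' * \<bar>h\<bar>"
    proof (intro allI impI)
      fix j y h assume "j < n" "y \<in> cube n x s'" "shift n y j h \<in> cube n x s'"
      then show "\<bar>incr n (\<lambda>y. f y $ i) j y h - A $$ (i, j) * h\<bar> \<le> \<epsilon>' * \<bar>h\<bar>"
        using * cube_mono[OF \<open>s' \<le> s\<close>, of n x] by blast
    qed
  qed
  then obtain r where r: "r > 0" "\<forall>i<m. \<forall>j<n. \<forall>y h. y \<in> cube n x r \<longrightarrow> shift n y j h \<in> cube n x r \<longrightarrow>
     \<bar>incr n (\<lambda>y. f y $ i) j y h - A $$ (i, j) * h\<bar> \<le> \<epsilon>' * \<bar>h\<bar>" by blast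
  have "max_norm (f y - f x - A *\<^sub>v (y - x)) \<le> \<epsilon> * max_norm (y - x)"
    if yc: "y \<in> carrier_vec n" and y: "max_norm (y - x) < r" for y
  proof -
    have ycube: "y \<in> cube n x r" using y max_norm_diff_less_iff[OF x(1) yc r(1)] by blast
    have N: "\<bar>y $ j - x $ j\<bar> \<le> max_norm (y - x)" if "j < n" for j
      using component_le_max_norm[of j "y - x"] that x(1) by simp
    have dim: "dim_vec (f y - f x - A *\<^sub>v (y - x)) = m" using A by simp
    have "\<bar>(f y - f x - A *\<^sub>v (y - x)) $ i\<bar> \<le> \<epsilon> * max_norm (y - x)" if i: "i < m" for i
    proof -
      have "(f y - f x - A *\<^sub>v (y - x)) $ i = f y $ i - f x $ i - (\<Sum>j<n. A $$ (i, j) * (y $ j - x $ j))"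
        using i x(2) A mult_mat_vec_diff_index[OF i x(1) yc A] by simp
      moreover have "\<bar>f y $ i - f x $ i - (\<Sum>j<n. A $$ (i, j) * (y $ j - x $ j))\<bar> \<le> of_nat n * (\<epsilon>' * max_norm (y - x))"
      proof (rule strict_partials_telescope[OF x(1) ycube _ N])
        show "\<bar>incr n (\<lambda>y. f y $ i) j z h - A $$ (i, j) * h\<bar> \<le> \<epsilon>' * \<bar>h\<bar>"
          if "j < n" "z \<in> cube n x r" "shift n z j h \<in> cube n x r" for j z h using r(2) i that by blast
        show "0 \<le> \<epsilon>'" using eps' by simp
      qed
      moreover have "of_nat n * (\<epsilon>' * max_norm (y - x)) \<le> \<epsilon> * max_norm (y - x)"
        using mult_right_mono[OF eps'n max_norm_nonneg[of "y - x"]] by (simp add: mult.assoc)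
      ultimately show ?thesis by simp
    qed
    moreover have "0 \<le> \<epsilon> * max_norm (y - x)" using eps max_norm_nonneg by (intro mult_nonneg_nonneg) simp_all
    ultimately show ?thesis unfolding max_norm_le_iff[OF \<open>0 \<le> \<epsilon> * max_norm (y - x)\<close>] dim by blast
  qed
  then show "\<exists>\<delta>>0. \<forall>y\<in>carrier_vec n. max_norm (y - x) < \<delta> \<longrightarrow>
      max_norm (f y - f x - A *\<^sub>v (y - x)) \<le> \<epsilon> * max_norm (y - x)" using r(1) by blast
qed

definition partial :: "nat \<Rightarrow> ('a::linordered_field vec \<Rightarrow> 'a) \<Rightarrow> nat \<Rightarrow> 'a vec \<Rightarrow> 'a" where
  "partial n \<phi> j x = (THE d. strict_partial n \<phi> j x d)"

lemma partial_eq: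
  assumes "strict_partial n \<phi> j x d" "j < n" "x \<in> carrier_vec n"
  shows "partial n \<phi> j x = d"
  unfolding partial_def using assms(1)
  by (rule the_equality) (rule strict_partial_unique[OF _ assms])

text \<open>\<open>D x\<close> approximates the slopes on a whole cube around \<open>x\<close>,
  hence also near every point \<open>y\<close> of it, where \<open>strict_partial_approx\<close>
  compares it with \<open>D y\<close>.\<close>

lemma cont_at_strict_partial:
  assumes d: "\<And>y. y \<in> cube n x r \<Longrightarrow> strict_partial n \<phi> j y (D y)"
    and "r > 0" "j < n" "x \<in> carrier_vec n"
  shows "cont_at n D x"
  unfolding cont_at_def
proof (intro allI impI)
  fix \<epsilon> :: 'a assume eps: "\<epsilon> > 0"
  then have "\<epsilon> / 2 > 0" by simp
  moreover have "strict_partial n \<phi> j x (D x)" by (rule d[OF center_in_cube[OF assms(4,2)]])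
  ultimately obtain s where s: "s > 0" "\<forall>y h. y \<in> cube n x s \<longrightarrow> shift n y j h \<in> cube n x s \<longrightarrow>
     \<bar>incr n \<phi> j y h - D x * h\<bar> \<le> \<epsilon> / 2 * \<bar>h\<bar>"
    using strict_partialE by blast
  have "\<bar>D y - D x\<bar> < \<epsilon>" if y: "y \<in> cube n x (min r s)" for y
  proof -
    have "y \<in> cube n x r" "y \<in> cube n x s"
      using y cube_mono[of "min r s" r n x] cube_mono[of "min r s" s n x] by auto
    then have "\<bar>D x - D y\<bar> \<le> \<epsilon> / 2" using strict_partial_approx[OF d assms(3) _ s(2)] by blast
    then have "\<bar>D y - D x\<bar> \<le> \<epsilon> / 2" by (simp add: abs_minus_commute)
    moreover have "\<epsilon> / 2 < \<epsilon>" using eps by simp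
    ultimately show ?thesis by (rule le_less_trans)
  qed
  moreover have "min r s > 0" using s(1) assms(2) by simp
  ultimately show "\<exists>\<delta>>0. \<forall>y\<in>cube n x \<delta>. \<bar>D y - D x\<bar> < \<epsilon>" by blast
qed

text \<open>Existence is required on a whole cube around the point. This makes the set open and, by
  \<open>cont_at_strict_partial\<close>, the partial derivatives continuous on it.\<close>

definition strict_C1_set :: "nat \<Rightarrow> nat \<Rightarrow> 'a::linordered_field vec set \<Rightarrow> (nat \<Rightarrow> 'a vec \<Rightarrow> 'a) \<Rightarrow> 'a vec set" where
  "strict_C1_set n m U F = {x \<in> carrier_vec n. \<exists>r>0. cube n x r \<subseteq> U \<and>
     (\<forall>y\<in>cube n x r. \<forall>i<m. \<forall>j<n. \<exists>d. strict_partial n (F i) j y d)}"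

lemma strict_C1_set_subset: "strict_C1_set n m U F \<subseteq> U"
  unfolding strict_C1_set_def using center_in_cube by blast

lemma strict_C1_set_partial:
  assumes "x \<in> strict_C1_set n m U F" "i < m" "j < n"
  shows "strict_partial n (F i) j x (partial n (F i) j x)"
proof -
  have xc: "x \<in> carrier_vec n" using assms(1) unfolding strict_C1_set_def by blast
  obtain d where d: "strict_partial n (F i) j x d"
    using assms center_in_cube[OF xc] unfolding strict_C1_set_def by blast
  then show ?thesis using partial_eq[OF d assms(3) xc] by simp
qed

lemma open_strict_C1_set: "open_cubes n (strict_C1_set n m U F)"
  unfolding open_cubes_def
proof (intro conjI ballI)
  show "strict_C1_set n m U F \<subseteq> carrier_vec n" unfolding strict_C1_set_def by blast
  fix x assume "x \<in> strict_C1_set n m U F"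
  then obtain r where r: "r > 0" "cube n x r \<subseteq> U"
    "\<forall>y\<in>cube n x r. \<forall>i<m. \<forall>j<n. \<exists>d. strict_partial n (F i) j y d" unfolding strict_C1_set_def by blast
  have "y \<in> strict_C1_set n m U F" if y: "y \<in> cube n x r" for y
  proof -
    obtain s where s: "s > 0" "cube n y s \<subseteq> cube n x r" by (rule cube_open[OF y])
    have "cube n y s \<subseteq> U" "\<forall>z\<in>cube n y s. \<forall>i<m. \<forall>j<n. \<exists>d. strict_partial n (F i) j z d"
      using s(2) r(2,3) by blast+
    then show ?thesis unfolding strict_C1_set_def using s(1) cube_carrier[OF y] by blast
  qed
  then show "\<exists>r>0. cube n x r \<subseteq> strict_C1_set n m U F" using r(1) by blast
qed

lemma Cp_on_subset: "Cp_on p n m U f \<Longrightarrow> V \<subseteq> U \<Longrightarrow> Cp_on p n m V f"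
proof (induction p arbitrary: f)
  case 0
  then show ?case using continuous_map_from_subtopology_mono by auto
next
  case (Suc p)
  then obtain J where "\<forall>x\<in>U. has_differential n m f x (J x)" "\<forall>j<n. Cp_on p n m U (\<lambda>x. col (J x) j)"
    by auto
  then have "\<forall>x\<in>V. has_differential n m f x (J x)" "\<forall>j<n. Cp_on p n m V (\<lambda>x. col (J x) j)"
    using Suc by blast+
  then show ?case unfolding Cp_on.simps by blast
qed

lemma Cp_on_0_iff:
  fixes f :: "'a::{linordered_field, linorder_topology} vec \<Rightarrow> 'a vec"
  assumes "open_cubes n U"
  shows "Cp_on 0 n m U f \<longleftrightarrow> (\<forall>x\<in>U. f x \<in> carrier_vec m \<and> (\<forall>i<m. cont_at n (\<lambda>y. f y $ i) x))"
  using continuous_map_vec_iff[OF assms] by simp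

context restrained_expansion
begin

lemma dense_strict_C1_set:
  assumes F: "\<And>i. i < m \<Longrightarrow> def_fun M n (F i)" and cont: "\<And>i x. i < m \<Longrightarrow> x \<in> U \<Longrightarrow> cont_at n (F i) x"
  shows "dense_cubes_in n U (strict_C1_set n m U F)"
proof -
  define D where "D i j = {x. \<exists>d. strict_partial n (F i) j x d}" for i j
  have "dense_cubes_in n U (D i j)" if i: "i < m" and j: "j < n" for i j
    unfolding dense_cubes_in_def
  proof (intro ballI allI impI)
    fix u r assume u: "u \<in> carrier_vec n" "(r::'a) > 0" "cube n u r \<subseteq> U"
    have c: "cont_at n (F i) y" if "y \<in> cube n u r" for y using cont[OF i] u(3) that by blast
    obtain v s where v: "v \<in> carrier_vec n" "s > 0" "cube n v s \<subseteq> cube n u r"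
      "\<forall>x\<in>cube n v s. \<exists>d. strict_partial n (F i) j x d"
      by (rule strict_partial_dense[OF F[OF i] j u(1,2) c])
    have "cube n v s \<subseteq> D i j" unfolding D_def using v(4) by blast
    then show "\<exists>v\<in>carrier_vec n. \<exists>s>0. cube n v s \<subseteq> cube n u r \<and> cube n v s \<subseteq> D i j" using v(1-3) by blast
  qed
  then have "dense_cubes_in n U {x \<in> U. \<forall>j<n. x \<in> D i j}" if "i < m" for i
    using dense_cubes_in_all_less[of n n U "D i"] that by blast
  then have d: "dense_cubes_in n U {x \<in> U. \<forall>i<m. x \<in> {x \<in> U. \<forall>j<n. x \<in> D i j}}"
    by (rule dense_cubes_in_all_less)
  show ?thesis
    unfolding dense_cubes_in_def
  proof (intro ballI allI impI)
    fix u r assume u: "u \<in> carrier_vec n" "(r::'a) > 0" "cube n u r \<subseteq> U"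
    obtain v s where v: "v \<in> carrier_vec n" "s > 0" "cube n v s \<subseteq> cube n u r"
      "cube n v s \<subseteq> {x \<in> U. \<forall>i<m. x \<in> {x \<in> U. \<forall>j<n. x \<in> D i j}}"
      by (rule dense_cubes_inE[OF d u])
    have "cube n v s \<subseteq> strict_C1_set n m U F"
    proof
      fix x assume x: "x \<in> cube n v s"
      obtain t where t: "t > 0" "cube n x t \<subseteq> cube n v s" by (rule cube_open[OF x])
      have "cube n x t \<subseteq> U" using t(2) v(4) by blast
      moreover have "\<forall>y\<in>cube n x t. \<forall>i<m. \<forall>j<n. \<exists>d. strict_partial n (F i) j y d"
        using t(2) v(4) unfolding D_def by blast
      ultimately show "x \<in> strict_C1_set n m U F"
        unfolding strict_C1_set_def using t(1) cube_carrier[OF x] by blast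
    qed
    then show "\<exists>v\<in>carrier_vec n. \<exists>s>0. cube n v s \<subseteq> cube n u r \<and> cube n v s \<subseteq> strict_C1_set n m U F"
      using v(1-3) by blast
  qed
qed

lemma def_strict_C1_set:
  assumes F: "\<And>i. i < m \<Longrightarrow> def_fun M n (F i)" and U: "def_set M n U"
  shows "def_set M n (strict_C1_set n m U F)"
proof -
  have eq: "x \<in> strict_C1_set n m U F \<longleftrightarrow> x \<in> carrier_vec n \<and> (\<exists>r. 0 < r \<and> (\<forall>y\<in>carrier_vec n. y \<in> cube n x r \<longrightarrow> y \<in> U) \<and>
      (\<forall>y\<in>carrier_vec n. y \<in> cube n x r \<longrightarrow> (\<forall>i<m. \<forall>j<n. \<exists>d. strict_partial n (F i) j y d)))" for x
    unfolding strict_C1_set_def using cube_carrier by blast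
  show ?thesis
    unfolding def_set_def eq
    by (rule def_intros def_pred_carrier def_pred_mem_cube def_set_mem[OF U] def_strict_partial[OF F] | assumption)+
qed

text \<open>\<open>partial\<close> is a definite description that means something only where the
  strict derivative exists. On \<open>G\<close> its graph is given by \<open>strict_partial\<close>;
  the value \<open>0\<close> elsewhere makes the function total.\<close>

lemma def_fun_partial:
  assumes \<phi>: "def_fun M n \<phi>" and j: "j < n" and G: "def_set M n G"
    and d: "\<And>x. x \<in> G \<Longrightarrow> strict_partial n \<phi> j x (partial n \<phi> j x)"
  shows "def_fun M n (\<lambda>x. if x \<in> G then partial n \<phi> j x else 0)"
  unfolding def_fun_def
proof (rule def_termI)
  have eq: "t = (if x \<in> G then partial n \<phi> j x else 0) \<longleftrightarrow>
      (x \<in> G \<and> strict_partial n \<phi> j x t) \<or> (\<not> x \<in> G \<and> t = 0)" if "x \<in> carrier_vec n" for t x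
    using d[of x] partial_eq[OF _ j that] by auto
  have "def_pred M (\<lambda>e. (vec n (\<lambda>i. e (Suc i)) \<in> G \<and> strict_partial n \<phi> j (vec n (\<lambda>i. e (Suc i))) (e 0)) \<or>
      (\<not> vec n (\<lambda>i. e (Suc i)) \<in> G \<and> e 0 = 0))"
    by (rule def_intros def_set_mem[OF G] def_strict_partial[OF \<phi>])+
  then show "def_pred M (\<lambda>e. e 0 = (if vec n (\<lambda>i. e (Suc i)) \<in> G then partial n \<phi> j (vec n (\<lambda>i. e (Suc i))) else 0))"
    using eq[OF vec_carrier] by (simp only:)
qed

text \<open>The differential and the continuity of its columns are available on \<open>G1\<close>
  only, so the induction has to run over all open \<open>U\<close>. Each column has its own good
  set, and these finitely many sets are intersected.\<close>

theorem Cp_dense: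
  assumes "def_set M n U" "open_cubes n U" "\<And>i. i < m \<Longrightarrow> def_fun M n (\<lambda>x. f x $ i)" "Cp_on 0 n m U f"
  shows "\<exists>G. def_set M n G \<and> G \<subseteq> U \<and> open_cubes n G \<and> dense_cubes_in n U G \<and> Cp_on p n m G f"
  using assms
proof (induction p arbitrary: f U)
  case 0
  have "dense_cubes_in n U U" unfolding dense_cubes_in_def by blast
  then show ?case using 0 by (intro exI[of _ U]) blast
next
  case (Suc p)
  define F where "F i x = f x $ i" for i x
  have F: "def_fun M n (F i)" if "i < m" for i unfolding F_def by (rule Suc.prems(3)[OF that])
  have f: "f x \<in> carrier_vec m" "\<And>i. i < m \<Longrightarrow> cont_at n (F i) x" if "x \<in> U" for x
    using Suc.prems(4) that unfolding Cp_on_0_iff[OF Suc.prems(2)] F_def by blast+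
  define G1 where "G1 = strict_C1_set n m U F"
  have G1: "def_set M n G1" "G1 \<subseteq> U" "open_cubes n G1" "dense_cubes_in n U G1"
    unfolding G1_def
    by (rule def_strict_C1_set[OF F Suc.prems(1)], assumption, rule strict_C1_set_subset,
        rule open_strict_C1_set, rule dense_strict_C1_set[OF F f(2)])
  have G1c: "x \<in> carrier_vec n" if "x \<in> G1" for x using that G1(3) unfolding open_cubes_def by blast
  define J where "J x = mat m n (\<lambda>(i, j). if x \<in> G1 then partial n (F i) j x else 0)" for x
  have J: "has_differential n m f x (J x)" if x: "x \<in> G1" for x
  proof (rule has_differential_of_strict_partials)
    show "x \<in> carrier_vec n" by (rule G1c[OF x])
    show "f x \<in> carrier_vec m" using f(1) x G1(2) by blast
    show "J x \<in> carrier_mat m n" unfolding J_def by simp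
    show "strict_partial n (\<lambda>y. f y $ i) j x (J x $$ (i, j))" if "i < m" "j < n" for i j
      using strict_C1_set_partial[of x n m U F i j] x that unfolding J_def G1_def F_def by simp
  qed
  have "\<exists>G. def_set M n G \<and> G \<subseteq> G1 \<and> open_cubes n G \<and> dense_cubes_in n G1 G \<and> Cp_on p n m G (\<lambda>x. col (J x) j)"
    if j: "j < n" for j
  proof (rule Suc.IH[OF G1(1,3)])
    have col: "col (J x) j $ i = (if x \<in> G1 then partial n (F i) j x else 0)" if "i < m" for i x
      unfolding J_def using that j by simp
    show "def_fun M n (\<lambda>x. col (J x) j $ i)" if i: "i < m" for i
      unfolding col[OF i]
      by (rule def_fun_partial[OF F[OF i] j G1(1)]) (use strict_C1_set_partial i j in \<open>auto simp: G1_def\<close>)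
    show "Cp_on 0 n m G1 (\<lambda>x. col (J x) j)"
      unfolding Cp_on_0_iff[OF G1(3)]
    proof (intro ballI conjI allI impI)
      fix x assume x: "x \<in> G1"
      show "col (J x) j \<in> carrier_vec m" unfolding J_def by (simp add: carrier_vecI)
      fix i assume i: "i < m"
      obtain r where r: "r > 0" "cube n x r \<subseteq> G1" using G1(3) x unfolding open_cubes_def by blast
      show "cont_at n (\<lambda>y. col (J y) j $ i) x"
        unfolding col[OF i]
      proof (rule cont_at_strict_partial[OF _ r(1) j G1c[OF x]])
        fix y assume "y \<in> cube n x r"
        then have y: "y \<in> G1" using r(2) by blast
        then show "strict_partial n (F i) j y (if y \<in> G1 then partial n (F i) j y else 0)"
          using strict_C1_set_partial[of y n m U F i j] i j unfolding G1_def by simp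
      qed
    qed
  qed
  then obtain G where G: "\<And>j. j < n \<Longrightarrow> def_set M n (G j) \<and> G j \<subseteq> G1 \<and> open_cubes n (G j) \<and>
      dense_cubes_in n G1 (G j) \<and> Cp_on p n m (G j) (\<lambda>x. col (J x) j)" by metis
  define H where "H = {x \<in> G1. \<forall>j<n. x \<in> G j}"
  have "def_set M n H"
    unfolding def_set_def H_def mem_Collect_eq
  proof (intro def_pred_conj def_pred_all_less)
    show "def_pred M (\<lambda>e. vec n e \<in> G1)" using G1(1) unfolding def_set_def .
    show "def_pred M (\<lambda>e. vec n e \<in> G j)" if "j < n" for j using G[OF that] unfolding def_set_def by blast
  qed
  moreover have "H \<subseteq> U" unfolding H_def using G1(2) by blast
  moreover have "open_cubes n H" unfolding H_def using G by (intro open_cubes_all_less G1(3)) blast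
  moreover have "dense_cubes_in n U H"
  proof (rule dense_cubes_in_trans[OF G1(4)])
    show "dense_cubes_in n G1 H" unfolding H_def using G by (intro dense_cubes_in_all_less) blast
  qed
  moreover have "Cp_on (Suc p) n m H f"
  proof -
    have "\<forall>x\<in>H. has_differential n m f x (J x)" using J unfolding H_def by blast
    moreover have "Cp_on p n m H (\<lambda>x. col (J x) j)" if "j < n" for j
    proof (rule Cp_on_subset)
      show "Cp_on p n m (G j) (\<lambda>x. col (J x) j)" using G[OF that] by blast
      show "H \<subseteq> G j" unfolding H_def using that by blast
    qed
    ultimately show ?thesis unfolding Cp_on.simps by blast
  qed
  ultimately show ?case by blast
qed

end

section \<open>Closed sets given by continuous functions\<close>

lemma cont_at_const: "cont_at n (\<lambda>y. c) x"
  unfolding cont_at_def by (auto intro!: exI[of _ 1])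

lemma cont_at_coord: "i < n \<Longrightarrow> cont_at n (\<lambda>y. y $ i) x"
  unfolding cont_at_def using cube_center_radius by blast

lemma cont_at_add:
  assumes "cont_at n f x" "cont_at n g x" shows "cont_at n (\<lambda>y. f y + g y) x"
  unfolding cont_at_def
proof (intro allI impI)
  fix \<epsilon> :: 'a assume "\<epsilon> > 0"
  then have e: "\<epsilon> / 2 > 0" by simp
  obtain \<delta>1 where d1: "\<delta>1 > 0" "\<forall>y\<in>cube n x \<delta>1. \<bar>f y - f x\<bar> < \<epsilon> / 2" by (rule cont_atE[OF assms(1) e])
  obtain \<delta>2 where d2: "\<delta>2 > 0" "\<forall>y\<in>cube n x \<delta>2. \<bar>g y - g x\<bar> < \<epsilon> / 2" by (rule cont_atE[OF assms(2) e])
  have "\<bar>f y + g y - (f x + g x)\<bar> < \<epsilon>" if y: "y \<in> cube n x (min \<delta>1 \<delta>2)" for y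
  proof -
    have "y \<in> cube n x \<delta>1" "y \<in> cube n x \<delta>2"
      using y cube_mono[of "min \<delta>1 \<delta>2" \<delta>1 n x] cube_mono[of "min \<delta>1 \<delta>2" \<delta>2 n x] by auto
    then have "\<bar>f y - f x\<bar> < \<epsilon> / 2" "\<bar>g y - g x\<bar> < \<epsilon> / 2" using d1(2) d2(2) by blast+
    then show ?thesis unfolding abs_less_iff by linarith
  qed
  moreover have "min \<delta>1 \<delta>2 > 0" using d1(1) d2(1) by simp
  ultimately show "\<exists>\<delta>>0. \<forall>y\<in>cube n x \<delta>. \<bar>f y + g y - (f x + g x)\<bar> < \<epsilon>" by blast
qed

lemma cont_at_diff:
  assumes "cont_at n f x" "cont_at n g x" shows "cont_at n (\<lambda>y. f y - g y) x"
  using cont_at_add[OF assms(1) cont_at_uminus[OF assms(2)]] by simp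

lemma cont_at_mult:
  assumes "cont_at n f x" "cont_at n g x" shows "cont_at n (\<lambda>y. f y * g y) x"
  unfolding cont_at_def
proof (intro allI impI)
  fix \<epsilon> :: 'a assume eps: "\<epsilon> > 0"
  \<comment> \<open>One constant serves both terms of the product rule:
    \<open>\<bar>f x\<bar> \<le> K\<close>, and \<open>\<bar>g y\<bar> \<le> K\<close> as soon as
    \<open>\<bar>g y - g x\<bar> < 1\<close>. Each term then stays below
    \<open>\<epsilon> / 2\<close>.\<close>
  define K where "K = \<bar>f x\<bar> + \<bar>g x\<bar> + 1"
  have K: "K > 0" "\<bar>f x\<bar> \<le> K" "\<bar>g x\<bar> + 1 \<le> K" unfolding K_def by (simp_all add: add_nonneg_pos)
  have e: "\<epsilon> / (2 * K) > 0" using eps K(1) by simp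
  obtain \<delta>1 where d1: "\<delta>1 > 0" "\<forall>y\<in>cube n x \<delta>1. \<bar>f y - f x\<bar> < \<epsilon> / (2 * K)" by (rule cont_atE[OF assms(1) e])
  have "min 1 (\<epsilon> / (2 * K)) > 0" using e by simp
  then obtain \<delta>2 where d2: "\<delta>2 > 0" "\<forall>y\<in>cube n x \<delta>2. \<bar>g y - g x\<bar> < min 1 (\<epsilon> / (2 * K))"
    by (rule cont_atE[OF assms(2)])
  have "\<bar>f y * g y - f x * g x\<bar> < \<epsilon>" if y: "y \<in> cube n x (min \<delta>1 \<delta>2)" for y
  proof -
    have "y \<in> cube n x \<delta>1" "y \<in> cube n x \<delta>2"
      using y cube_mono[of "min \<delta>1 \<delta>2" \<delta>1 n x] cube_mono[of "min \<delta>1 \<delta>2" \<delta>2 n x] by auto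
    then have f: "\<bar>f y - f x\<bar> < \<epsilon> / (2 * K)" and g: "\<bar>g y - g x\<bar> < 1" "\<bar>g y - g x\<bar> < \<epsilon> / (2 * K)"
      using d1(2) d2(2) by auto
    have "\<bar>g y\<bar> \<le> \<bar>g y - g x\<bar> + \<bar>g x\<bar>" using abs_triangle_ineq[of "g y - g x" "g x"] by simp
    then have gy: "\<bar>g y\<bar> \<le> K" using g(1) K(3) by linarith
    have "f y * g y - f x * g x = (f y - f x) * g y + f x * (g y - g x)" by (simp add: algebra_simps)
    then have "\<bar>f y * g y - f x * g x\<bar> \<le> \<bar>f y - f x\<bar> * \<bar>g y\<bar> + \<bar>f x\<bar> * \<bar>g y - g x\<bar>"
      using abs_triangle_ineq[of "(f y - f x) * g y" "f x * (g y - g x)"] by (simp only: abs_mult)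
    moreover have "\<bar>f y - f x\<bar> * \<bar>g y\<bar> \<le> \<bar>f y - f x\<bar> * K" by (rule mult_left_mono[OF gy abs_ge_zero])
    moreover have "\<bar>f y - f x\<bar> * K < \<epsilon> / (2 * K) * K" by (rule mult_strict_right_mono[OF f K(1)])
    moreover have "\<bar>f x\<bar> * \<bar>g y - g x\<bar> \<le> K * \<bar>g y - g x\<bar>" by (rule mult_right_mono[OF K(2) abs_ge_zero])
    moreover have "K * \<bar>g y - g x\<bar> < K * (\<epsilon> / (2 * K))" by (rule mult_strict_left_mono[OF g(2) K(1)])
    moreover have "\<epsilon> / (2 * K) * K = \<epsilon> / 2" "K * (\<epsilon> / (2 * K)) = \<epsilon> / 2" using K(1) by simp_all
    ultimately show ?thesis by linarith
  qed
  moreover have "min \<delta>1 \<delta>2 > 0" using d1(1) d2(1) by simp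
  ultimately show "\<exists>\<delta>>0. \<forall>y\<in>cube n x \<delta>. \<bar>f y * g y - f x * g x\<bar> < \<epsilon>" by blast
qed

lemma cont_at_sum:
  fixes k :: nat
  assumes "\<And>i. i < k \<Longrightarrow> cont_at n (\<lambda>y. g y i) x"
  shows "cont_at n (\<lambda>y. \<Sum>i<k. g y i) x"
  using assms
proof (induction k)
  case 0
  show ?case using cont_at_const[of n 0 x] by simp
next
  case (Suc k)
  have "cont_at n (\<lambda>y. (\<Sum>i<k. g y i) + g y k) x" by (rule cont_at_add) (use Suc in auto)
  then show ?case by (simp only: sum.lessThan_Suc)
qed

definition slice :: "nat \<Rightarrow> nat \<Rightarrow> 'a vec \<Rightarrow> 'a vec" where
  "slice c k w = vec k (\<lambda>i. w $ (c + i))"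

lemma slice_carrier [simp]: "slice c k w \<in> carrier_vec k"
  by (simp add: slice_def)

lemma slice_index [simp]: "i < k \<Longrightarrow> slice c k w $ i = w $ (c + i)"
  by (simp add: slice_def)

lemma def_vec_slice:
  assumes "def_vec M n v" "c + k \<le> n" shows "def_vec M k (\<lambda>e. slice c k (v e))"
  unfolding slice_def using assms by (intro def_vec_vec def_term_vec_nth[OF assms(1)]) simp

lemma slice_cube:
  assumes "y \<in> cube n x r" "c + k \<le> n" shows "slice c k y \<in> cube k (slice c k x) r"
  unfolding cube_def using cube_center_radius[OF assms(1)] assms(2) by simp

lemma cont_at_slice:
  assumes "cont_at k g (slice c k x)" "c + k \<le> n" shows "cont_at n (\<lambda>y. g (slice c k y)) x"
  using assms slice_cube unfolding cont_at_def by blast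

lemma closed_zero_set:
  assumes "\<And>x. x \<in> carrier_vec n \<Longrightarrow> cont_at n g x"
  shows "closed_cubes n {x \<in> carrier_vec n. g x = 0}"
  unfolding closed_cubes_def
proof
  fix x assume "x \<in> carrier_vec n - {x \<in> carrier_vec n. g x = 0}"
  then have x: "x \<in> carrier_vec n" "\<bar>g x\<bar> > 0" by auto
  obtain \<delta> where d: "\<delta> > 0" "\<forall>y\<in>cube n x \<delta>. \<bar>g y - g x\<bar> < \<bar>g x\<bar>" by (rule cont_atE[OF assms[OF x(1)] x(2)])
  have "y \<notin> {x \<in> carrier_vec n. g x = 0}" if "y \<in> cube n x \<delta>" for y using d(2) that by fastforce
  then show "\<exists>r>0. cube n x r \<inter> {x \<in> carrier_vec n. g x = 0} = {}" using d(1) by blast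
qed

lemma closed_cubes_Int:
  assumes "closed_cubes n S" "closed_cubes n T" shows "closed_cubes n (S \<inter> T)"
  using assms unfolding closed_cubes_def by blast

lemma closed_cubes_all_less:
  fixes k :: nat
  assumes "\<And>i. i < k \<Longrightarrow> closed_cubes n (S i)"
  shows "closed_cubes n {x \<in> carrier_vec n. \<forall>i<k. x \<in> S i}"
  using assms unfolding closed_cubes_def by blast

lemma closed_cubes_ex_less:
  fixes k :: nat
  assumes "\<And>i. i < k \<Longrightarrow> closed_cubes n (S i)"
  shows "closed_cubes n {x \<in> carrier_vec n. \<exists>i<k. x \<in> S i}"
  unfolding closed_cubes_def
proof
  fix x assume x: "x \<in> carrier_vec n - {x \<in> carrier_vec n. \<exists>i<k. x \<in> S i}"
  have "\<exists>r>0. \<forall>i<k. cube n x r \<inter> S i = {}"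
  proof (rule ex_pos_all_less)
    show "\<exists>r>0. cube n x r \<inter> S i = {}" if "i < k" for i
      using assms[OF that] x that unfolding closed_cubes_def by blast
    show "cube n x s' \<inter> S i = {}" if "cube n x s \<inter> S i = {}" "s' \<le> s" for i s s'
      using that cube_mono[of s' s n x] by blast
  qed
  then show "\<exists>r>0. cube n x r \<inter> {x \<in> carrier_vec n. \<exists>i<k. x \<in> S i} = {}" by blast
qed

section \<open>Differentials\<close>

lemma max_norm_shift_diff:
  assumes "x \<in> carrier_vec n" "j < n" shows "max_norm (shift n x j h - x) = \<bar>h\<bar>"
proof (rule antisym)
  show "max_norm (shift n x j h - x) \<le> \<bar>h\<bar>"
    unfolding max_norm_le_iff[OF abs_ge_zero] using assms by (simp add: shift_index)
  have "\<bar>(shift n x j h - x) $ j\<bar> \<le> max_norm (shift n x j h - x)"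
    using assms by (intro component_le_max_norm) simp
  then show "\<bar>h\<bar> \<le> max_norm (shift n x j h - x)" using assms by (simp add: shift_index)
qed

lemma has_differential_bound:
  assumes d: "has_differential n m f x A" and x: "x \<in> carrier_vec n" "f x \<in> carrier_vec m" and "\<epsilon> > 0"
  obtains \<delta> where "\<delta> > 0" "\<forall>y\<in>cube n x \<delta>. \<forall>i<m.
    \<bar>f y $ i - f x $ i - (\<Sum>j<n. A $$ (i, j) * (y $ j - x $ j))\<bar> \<le> \<epsilon> * max_norm (y - x)"
proof -
  have A: "A \<in> carrier_mat m n" using d unfolding has_differential_def by blast
  obtain \<delta> where delta: "\<delta> > 0" "\<forall>y\<in>carrier_vec n. max_norm (y - x) < \<delta> \<longrightarrow>
        max_norm (f y - f x - A *\<^sub>v (y - x)) \<le> \<epsilon> * max_norm (y - x)"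
    using d \<open>\<epsilon> > 0\<close> unfolding has_differential_def by blast
  have "\<bar>f y $ i - f x $ i - (\<Sum>j<n. A $$ (i, j) * (y $ j - x $ j))\<bar> \<le> \<epsilon> * max_norm (y - x)"
    if y: "y \<in> cube n x \<delta>" and i: "i < m" for y i
  proof -
    have yc: "y \<in> carrier_vec n" by (rule cube_carrier[OF y])
    have "max_norm (f y - f x - A *\<^sub>v (y - x)) \<le> \<epsilon> * max_norm (y - x)"
      using delta y max_norm_diff_less_iff[OF x(1) yc delta(1)] yc by blast
    moreover have "\<bar>(f y - f x - A *\<^sub>v (y - x)) $ i\<bar> \<le> max_norm (f y - f x - A *\<^sub>v (y - x))"
      using i A by (intro component_le_max_norm) simp
    moreover have "(f y - f x - A *\<^sub>v (y - x)) $ i = f y $ i - f x $ i - (\<Sum>j<n. A $$ (i, j) * (y $ j - x $ j))"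
      using i x(2) A mult_mat_vec_diff_index[OF i x(1) yc A] by simp
    ultimately show ?thesis by simp
  qed
  then show ?thesis using that[OF delta(1)] by blast
qed

text \<open>The ordinary partial derivative, with fixed base point. It is a definable condition that
  characterizes the entries of a given differential.\<close>

definition partial_deriv :: "nat \<Rightarrow> ('a::linordered_field vec \<Rightarrow> 'a) \<Rightarrow> nat \<Rightarrow> 'a vec \<Rightarrow> 'a \<Rightarrow> bool" where
  "partial_deriv n \<phi> j x d \<longleftrightarrow> (\<forall>\<epsilon>. 0 < \<epsilon> \<longrightarrow> (\<exists>\<delta>. 0 < \<delta> \<and> (\<forall>h. \<bar>h\<bar> < \<delta> \<longrightarrow>
     \<bar>incr n \<phi> j x h - d * h\<bar> \<le> \<epsilon> * \<bar>h\<bar>)))"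

lemma has_differential_partial_deriv:
  assumes d: "has_differential n m f x A" and x: "x \<in> carrier_vec n" "f x \<in> carrier_vec m" and ij: "i < m" "j < n"
  shows "partial_deriv n (\<lambda>y. f y $ i) j x (A $$ (i, j))"
  unfolding partial_deriv_def
proof (intro allI impI)
  fix \<epsilon> :: 'a assume eps: "\<epsilon> > 0"
  obtain \<delta> where delta: "\<delta> > 0" "\<forall>y\<in>cube n x \<delta>. \<forall>i<m.
    \<bar>f y $ i - f x $ i - (\<Sum>j<n. A $$ (i, j) * (y $ j - x $ j))\<bar> \<le> \<epsilon> * max_norm (y - x)"
    by (rule has_differential_bound[OF d x eps])
  have "\<bar>incr n (\<lambda>y. f y $ i) j x h - A $$ (i, j) * h\<bar> \<le> \<epsilon> * \<bar>h\<bar>" if "\<bar>h\<bar> < \<delta>" for h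
  proof -
    have "shift n x j h \<in> cube n x \<delta>" by (rule shift_small_in_cube[OF x(1) ij(2) that])
    then have "\<bar>f (shift n x j h) $ i - f x $ i - (\<Sum>l<n. A $$ (i, l) * (shift n x j h $ l - x $ l))\<bar> \<le> \<epsilon> * \<bar>h\<bar>"
      using delta(2) ij(1) unfolding max_norm_shift_diff[OF x(1) ij(2), symmetric] by blast
    moreover have "(\<Sum>l<n. A $$ (i, l) * (shift n x j h $ l - x $ l)) = (\<Sum>l<n. if l = j then A $$ (i, j) * h else 0)"
      by (rule sum.cong) (simp_all add: shift_index)
    moreover have "\<dots> = A $$ (i, j) * h" using ij(2) by simp
    ultimately show ?thesis unfolding incr_def by simp
  qed
  then show "\<exists>\<delta>. 0 < \<delta> \<and> (\<forall>h. \<bar>h\<bar> < \<delta> \<longrightarrow> \<bar>incr n (\<lambda>y. f y $ i) j x h - A $$ (i, j) * h\<bar> \<le> \<epsilon> * \<bar>h\<bar>)"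
    using delta(1) by blast
qed

lemma partial_deriv_unique:
  assumes "partial_deriv n \<phi> j x d" "partial_deriv n \<phi> j x d'"
  shows "d = d'"
proof -
  have "\<bar>d - d'\<bar> \<le> 0"
  proof (rule field_le_epsilon)
    fix e :: 'a assume "0 < e"
    then have e: "0 < e / 2" by simp
    obtain \<delta> where d: "0 < \<delta>" "\<forall>h. \<bar>h\<bar> < \<delta> \<longrightarrow> \<bar>incr n \<phi> j x h - d * h\<bar> \<le> e / 2 * \<bar>h\<bar>"
      using assms(1) e unfolding partial_deriv_def by blast
    obtain \<delta>' where d': "0 < \<delta>'" "\<forall>h. \<bar>h\<bar> < \<delta>' \<longrightarrow> \<bar>incr n \<phi> j x h - d' * h\<bar> \<le> e / 2 * \<bar>h\<bar>"
      using assms(2) e unfolding partial_deriv_def by blast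
    define h where "h = min \<delta> \<delta>' / 2"
    have h: "0 < h" "h < \<delta>" "h < \<delta>'" unfolding h_def using d(1) d'(1) by (simp_all add: min_def)
    have "\<bar>h\<bar> < \<delta>" "\<bar>h\<bar> < \<delta>'" "h \<noteq> 0" using h by simp_all
    then have "\<bar>d - d'\<bar> \<le> e / 2 + e / 2" using d(2) d'(2) by (intro abs_diff_le_of_approx) blast+
    then show "\<bar>d - d'\<bar> \<le> 0 + e" by simp
  qed
  then show ?thesis by simp
qed

text \<open>The matrix in \<open>singular_values\<close> and the one in \<open>Cp_on\<close> come
  from separate existential quantifiers; uniqueness identifies them.\<close>

lemma has_differential_unique:
  assumes "has_differential n m f x A" "has_differential n m f x B" "x \<in> carrier_vec n" "f x \<in> carrier_vec m"
  shows "A = B"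
proof -
  have c: "A \<in> carrier_mat m n" "B \<in> carrier_mat m n"
    using assms(1,2) unfolding has_differential_def by blast+
  show ?thesis
  proof (rule eq_matI)
    fix i j assume "i < dim_row B" "j < dim_col B"
    then have "i < m" "j < n" using c by auto
    then show "A $$ (i, j) = B $$ (i, j)"
      using partial_deriv_unique has_differential_partial_deriv[OF assms(1,3,4)]
        has_differential_partial_deriv[OF assms(2,3,4)] by blast
  qed (use c in auto)
qed

lemma has_differential_cont_at:
  assumes d: "has_differential n m f x A" and x: "x \<in> carrier_vec n" "f x \<in> carrier_vec m" and i: "i < m"
  shows "cont_at n (\<lambda>y. f y $ i) x"
  unfolding cont_at_def
proof (intro allI impI)
  fix \<epsilon> :: 'a assume eps: "\<epsilon> > 0"
  obtain \<delta> where delta: "\<delta> > 0" "\<forall>y\<in>cube n x \<delta>. \<forall>i<m.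
    \<bar>f y $ i - f x $ i - (\<Sum>j<n. A $$ (i, j) * (y $ j - x $ j))\<bar> \<le> 1 * max_norm (y - x)"
    by (rule has_differential_bound[OF d x, of 1]) simp_all
  define L where "L y = (\<Sum>j<n. A $$ (i, j) * (y $ j - x $ j))" for y
  have "cont_at n L x" unfolding L_def
    by (intro cont_at_sum cont_at_mult cont_at_diff cont_at_const cont_at_coord)
  moreover have "L x = 0" unfolding L_def by simp
  moreover have "\<epsilon> / 2 > 0" using eps by simp
  ultimately obtain \<delta>' where d': "\<delta>' > 0" "\<forall>y\<in>cube n x \<delta>'. \<bar>L y - 0\<bar> < \<epsilon> / 2"
    using cont_atE[of n L x "\<epsilon> / 2"] by auto
  define \<rho> where "\<rho> = min (min \<delta> \<delta>') (\<epsilon> / 2)"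
  have rho: "\<rho> > 0" "\<rho> \<le> \<delta>" "\<rho> \<le> \<delta>'" "\<rho> \<le> \<epsilon> / 2" unfolding \<rho>_def using delta(1) d'(1) eps by simp_all
  have "\<bar>f y $ i - f x $ i\<bar> < \<epsilon>" if y: "y \<in> cube n x \<rho>" for y
  proof -
    have "y \<in> cube n x \<delta>" "y \<in> cube n x \<delta>'" using y cube_mono[OF rho(2)] cube_mono[OF rho(3)] by blast+
    then have "\<bar>f y $ i - f x $ i - L y\<bar> \<le> max_norm (y - x)" "\<bar>L y\<bar> < \<epsilon> / 2"
      using delta(2) i d'(2) unfolding L_def by auto
    moreover have "max_norm (y - x) < \<rho>" using max_norm_diff_less_iff[OF x(1) cube_carrier[OF y] rho(1)] y by blast
    ultimately show ?thesis using rho(4) unfolding abs_less_iff abs_le_iff by linarith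
  qed
  then show "\<exists>\<delta>>0. \<forall>y\<in>cube n x \<delta>. \<bar>f y $ i - f x $ i\<bar> < \<epsilon>" using rho(1) by blast
qed

lemma def_partial_deriv:
  assumes "def_fun M n \<phi>" "def_vec M n v" "def_term M t"
  shows "def_pred M (\<lambda>e. partial_deriv n \<phi> j (v e) (t e))"
proof -
  have "def_pred M (\<lambda>e. partial_deriv n \<phi> j (vec n (\<lambda>i. e (Suc i))) (e 0))"
    unfolding partial_deriv_def by (rule def_intros def_fun_shift[OF assms(1)] | assumption)+
  then show ?thesis
    using assms(3,2) by (rule def_pred_subst_scalar_vec[where R = "\<lambda>d x. partial_deriv n \<phi> j x d"])
qed

text \<open>Over an ordered field, \<open>A A\<^sup>T v = 0\<close> implies \<open>A\<^sup>T v = 0\<close>, and if \<open>A A\<^sup>T\<close> is invertible then the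
  columns of \<open>A\<close> span.\<close>

lemma low_rank_left_kernel:
  fixes A :: "'a::linordered_field mat"
  assumes A: "A \<in> carrier_mat m n" and rk: "vec_space.rank m A < m"
  obtains v where "v \<in> carrier_vec m" "v \<noteq> 0\<^sub>v m" "\<forall>j<n. (\<Sum>i<m. v $ i * A $$ (i, j)) = 0"
proof -
  interpret vec_space "TYPE('a)" m .
  have At: "transpose_mat A \<in> carrier_mat n m" using A by simp
  define G where "G = A * transpose_mat A"
  have G: "G \<in> carrier_mat m m" unfolding G_def using A by simp
  have "det G = 0"
  proof (rule ccontr)
    assume det: "det G \<noteq> 0"
    have "y \<in> col_space A" if y: "y \<in> carrier_vec m" for y
    proof -
      \<comment> \<open>The preimage of \<open>y\<close> under \<open>A\<close> is the transpose of
        \<open>A\<close> applied to the inverse of \<open>G\<close> at \<open>y\<close>, the inverse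
        being written with the adjugate.\<close>
      define x where "x = transpose_mat A *\<^sub>v ((1 / det G) \<cdot>\<^sub>v (adj_mat G *\<^sub>v y))"
      have adj: "adj_mat G \<in> carrier_mat m m" "G * adj_mat G = det G \<cdot>\<^sub>m 1\<^sub>m m" using adj_mat[OF G] by auto
      have z: "adj_mat G *\<^sub>v y \<in> carrier_vec m" using adj(1) y by simp
      have z': "(1 / det G) \<cdot>\<^sub>v (adj_mat G *\<^sub>v y) \<in> carrier_vec m" using z by simp
      have xc: "x \<in> carrier_vec n" unfolding x_def by (rule mult_mat_vec_carrier[OF At z'])
      have "A *\<^sub>v x = G *\<^sub>v ((1 / det G) \<cdot>\<^sub>v (adj_mat G *\<^sub>v y))"
        unfolding x_def using assoc_mult_mat_vec[OF A At z'] unfolding G_def by (rule sym)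
      also have "\<dots> = (1 / det G) \<cdot>\<^sub>v (G *\<^sub>v (adj_mat G *\<^sub>v y))" using mult_mat_vec[OF G z] .
      also have "G *\<^sub>v (adj_mat G *\<^sub>v y) = (G * adj_mat G) *\<^sub>v y"
        using assoc_mult_mat_vec[OF G adj(1) y] by simp
      also have "\<dots> = det G \<cdot>\<^sub>v y"
      proof (rule eq_vecI)
        show "dim_vec ((G * adj_mat G) *\<^sub>v y) = dim_vec (det G \<cdot>\<^sub>v y)" unfolding adj(2) using y by simp
        fix i assume "i < dim_vec (det G \<cdot>\<^sub>v y)"
        then have i: "i < m" using y by simp
        have "((G * adj_mat G) *\<^sub>v y) $ i = (\<Sum>l = 0..<m. det G * (if l = i then 1 else 0) * y $ l)"
          unfolding adj(2) using i y by (auto simp: scalar_prod_def intro!: sum.cong)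
        also have "\<dots> = (\<Sum>l = 0..<m. if l = i then det G * y $ i else 0)" by (rule sum.cong) auto
        finally show "((G * adj_mat G) *\<^sub>v y) $ i = (det G \<cdot>\<^sub>v y) $ i" using i y by simp
      qed
      also have "(1 / det G) \<cdot>\<^sub>v (det G \<cdot>\<^sub>v y) = y" using det by (simp add: smult_smult_assoc)
      finally show ?thesis unfolding col_space_eq[OF A] using A xc y by auto
    qed
    moreover have "col_space A \<subseteq> carrier_vec m" unfolding col_space_eq[OF A] using A by auto
    ultimately have "span (set (cols A)) = carrier_vec m" unfolding col_space_def by blast
    then have "span_vs (set (cols A)) = V" by simp
    then have "rank A = m" unfolding rank_def using dim_is_n by simp
    then show False using rk by simp
  qed
  then obtain v where v: "v \<in> carrier_vec m" "v \<noteq> 0\<^sub>v m" "G *\<^sub>v v = 0\<^sub>v m"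
    using det_0_iff_vec_prod_zero_field[OF G] by blast
  define w where "w = transpose_mat A *\<^sub>v v"
  have wc: "w \<in> carrier_vec n" unfolding w_def by (rule mult_mat_vec_carrier[OF At v(1)])
  have "A *\<^sub>v w = 0\<^sub>v m" unfolding w_def using assoc_mult_mat_vec[of A m n "transpose_mat A" m v] A v unfolding G_def by simp
  then have "0 = v \<bullet> (A *\<^sub>v w)" using v(1) by simp
  also have "\<dots> = w \<bullet> w" unfolding w_def using transpose_vec_mult_scalar[OF A wc v(1)] unfolding w_def by simp
  \<comment> \<open>In an ordered field a vanishing sum of squares has vanishing terms.\<close>
  finally have "(\<Sum>j<n. w $ j * w $ j) = 0" using wc unfolding scalar_prod_def by (simp add: lessThan_atLeast0)
  then have w0: "w $ j = 0" if "j < n" for j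
    using that sum_nonneg_eq_0_iff[of "{..<n}" "\<lambda>j. w $ j * w $ j"] by simp
  have "(\<Sum>i<m. v $ i * A $$ (i, j)) = 0" if j: "j < n" for j
  proof -
    have "w $ j = (\<Sum>i<m. v $ i * A $$ (i, j))"
      unfolding w_def using j A v(1) by (auto simp: scalar_prod_def lessThan_atLeast0 mult.commute intro!: sum.cong)
    then show ?thesis using w0[OF j] by simp
  qed
  then show ?thesis using that[OF v(1,2)] by blast
qed

section \<open>Definable continuous selections\<close>

lemma vCons_append: "vCons a x @\<^sub>v y = vCons a (x @\<^sub>v y)"
proof (rule eq_vecI)
  fix i assume "i < dim_vec (vCons a (x @\<^sub>v y))"
  then show "(vCons a x @\<^sub>v y) $ i = vCons a (x @\<^sub>v y) $ i" by (cases i) auto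
qed simp

lemma empty_append: "x \<in> carrier_vec 0 \<Longrightarrow> x @\<^sub>v y = y"
  by (rule eq_vecI) auto

lemma slice_append_left: "x \<in> carrier_vec k \<Longrightarrow> slice 0 k (x @\<^sub>v y) = x"
  unfolding slice_def by (rule eq_vecI) auto

lemma slice_append_right: "x \<in> carrier_vec k \<Longrightarrow> y \<in> carrier_vec m \<Longrightarrow> slice k m (x @\<^sub>v y) = y"
  unfolding slice_def by (rule eq_vecI) auto

text \<open>The last coordinate of \<open>x\<close> is moved to the front of the following block,
  because the selection treats that coordinate first.\<close>

lemma append_slices: "x \<in> carrier_vec (Suc k) \<Longrightarrow> x @\<^sub>v y = slice 0 k x @\<^sub>v vCons (x $ k) y"
proof (rule eq_vecI)
  assume x: "x \<in> carrier_vec (Suc k)"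
  then show "dim_vec (x @\<^sub>v y) = dim_vec (slice 0 k x @\<^sub>v vCons (x $ k) y)" by (simp add: slice_def)
  fix i assume "i < dim_vec (slice 0 k x @\<^sub>v vCons (x $ k) y)"
  then have i: "i < Suc k + dim_vec y" by (simp add: slice_def)
  consider "i < k" | "i = k" | j where "i = Suc (k + j)" by (metis less_imp_Suc_add linorder_neqE_nat add_Suc_right)
  then show "(x @\<^sub>v y) $ i = (slice 0 k x @\<^sub>v vCons (x $ k) y) $ i"
    using x i by cases (auto simp: slice_def)
qed

context restrained_expansion
begin

text \<open>The tube lemma is iterated over the coordinates of the box of radius \<open>t\<close>,
  one at a time. The bound on the witnesses is what stands in for compactness.\<close>

lemma closed_projection:
  assumes "def_set M (k + m) A" "closed_cubes (k + m) A"
  shows "closed_cubes m {y \<in> carrier_vec m. \<exists>x\<in>carrier_vec k. (\<forall>i<k. - t \<le> x $ i \<and> x $ i \<le> t) \<and> x @\<^sub>v y \<in> A}"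
  using assms
proof (induction k arbitrary: A)
  case 0
  have ex0: "\<exists>x. x \<in> (carrier_vec 0 :: 'a vec set)" by (intro exI[of _ "vec 0 (\<lambda>_. 0)"]) simp
  have "{y \<in> carrier_vec m. \<exists>x\<in>carrier_vec 0. (\<forall>i<0. - t \<le> x $ i \<and> x $ i \<le> t) \<and> x @\<^sub>v y \<in> A} =
      A \<inter> carrier_vec m" using ex0 by (auto simp: empty_append)
  moreover have "closed_cubes m (A \<inter> carrier_vec m)"
    unfolding closed_cubes_def
  proof
    fix x :: "'a vec" assume x: "x \<in> carrier_vec m - A \<inter> carrier_vec m"
    have "closed_cubes m A" using 0(2) by simp
    moreover have "x \<in> carrier_vec m - A" using x by blast
    ultimately obtain r where "r > 0" "cube m x r \<inter> A = {}" unfolding closed_cubes_def by blast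
    then show "\<exists>r>0. cube m x r \<inter> (A \<inter> carrier_vec m) = {}" by blast
  qed
  ultimately show ?case by simp
next
  case (Suc k)
  define B where "B = {z \<in> carrier_vec (k + m). \<exists>w. - t \<le> w \<and> w \<le> t \<and> vCons w z \<in> A}"
  have A: "def_set M (Suc (k + m)) A" "closed_cubes (Suc (k + m)) A" using Suc.prems by simp_all
  have "def_set M (k + m) B"
    unfolding def_set_def B_def mem_Collect_eq
    by (rule def_intros def_pred_carrier def_set_mem[OF A(1)])+
  moreover have "closed_cubes (k + m) B" unfolding B_def by (rule closed_projection_step[OF A])
  ultimately have IH: "closed_cubes m {y \<in> carrier_vec m. \<exists>x\<in>carrier_vec k. (\<forall>i<k. - t \<le> x $ i \<and> x $ i \<le> t) \<and> x @\<^sub>v y \<in> B}"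
    by (rule Suc.IH)
  have "(\<exists>x\<in>carrier_vec (Suc k). (\<forall>i<Suc k. - t \<le> x $ i \<and> x $ i \<le> t) \<and> x @\<^sub>v y \<in> A) \<longleftrightarrow>
      (\<exists>x\<in>carrier_vec k. (\<forall>i<k. - t \<le> x $ i \<and> x $ i \<le> t) \<and> x @\<^sub>v y \<in> B)" (is "?L \<longleftrightarrow> ?R")
    if y: "y \<in> carrier_vec m" for y
  proof
    assume ?L
    then obtain x where x: "x \<in> carrier_vec (Suc k)" "\<forall>i<Suc k. - t \<le> x $ i \<and> x $ i \<le> t" "x @\<^sub>v y \<in> A" by blast
    obtain w x' where wx: "x = vCons w x'" "x' \<in> carrier_vec k" by (rule vCons_decompose[OF x(1)])
    have "- t \<le> w \<and> w \<le> t" using x(2)[rule_format, of 0] unfolding wx(1) by simp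
    moreover have "\<forall>i<k. - t \<le> x' $ i \<and> x' $ i \<le> t"
    proof (intro allI impI)
      fix i assume "i < k"
      then show "- t \<le> x' $ i \<and> x' $ i \<le> t" using x(2)[rule_format, of "Suc i"] unfolding wx(1) by simp
    qed
    moreover have "vCons w (x' @\<^sub>v y) \<in> A" using x(3) unfolding wx(1) vCons_append .
    ultimately show ?R unfolding B_def using wx(2) y by auto
  next
    assume ?R
    then obtain x' w where x': "x' \<in> carrier_vec k" "\<forall>i<k. - t \<le> x' $ i \<and> x' $ i \<le> t"
      "- t \<le> w \<and> w \<le> t" "vCons w (x' @\<^sub>v y) \<in> A" unfolding B_def by blast
    have "\<forall>i<Suc k. - t \<le> vCons w x' $ i \<and> vCons w x' $ i \<le> t" unfolding All_less_Suc2 using x'(2,3) by simp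
    moreover have "vCons w x' @\<^sub>v y \<in> A" using x'(4) unfolding vCons_append .
    ultimately show ?L using x'(1) by (intro bexI[of _ "vCons w x'"]) simp_all
  qed
  then have "{y \<in> carrier_vec m. \<exists>x\<in>carrier_vec (Suc k). (\<forall>i<Suc k. - t \<le> x $ i \<and> x $ i \<le> t) \<and> x @\<^sub>v y \<in> A} =
    {y \<in> carrier_vec m. \<exists>x\<in>carrier_vec k. (\<forall>i<k. - t \<le> x $ i \<and> x $ i \<le> t) \<and> x @\<^sub>v y \<in> B}" by blast
  then show ?case using IH by simp
qed

text \<open>Another use of the union theorem: the points with no neighbourhood on which
  \<open>h\<close> stays within \<open>1 / t\<close> of its value there form an increasing family,
  and each member is nowhere dense by \<open>osc\<close>.\<close>

lemma continuous_on_subcube: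
  assumes h: "def_fun M m h" and u: "u \<in> carrier_vec m" "r > 0"
    and osc: "\<And>x0 r0 \<epsilon>. x0 \<in> carrier_vec m \<Longrightarrow> r0 > 0 \<Longrightarrow> cube m x0 r0 \<subseteq> cube m u r \<Longrightarrow> \<epsilon> > 0 \<Longrightarrow>
      \<exists>v\<in>carrier_vec m. \<exists>s>0. cube m v s \<subseteq> cube m x0 r0 \<and> (\<forall>y\<in>cube m v s. \<forall>z\<in>cube m v s. \<bar>h y - h z\<bar> \<le> \<epsilon>)"
  obtains v s where "v \<in> carrier_vec m" "s > 0" "cube m v s \<subseteq> cube m u r" "\<forall>y\<in>cube m v s. cont_at m h y"
proof -
  define N where "N \<epsilon> x \<longleftrightarrow> (\<exists>s. 0 < s \<and> (\<forall>y\<in>carrier_vec m. y \<in> cube m x s \<longrightarrow> \<bar>h y - h x\<bar> \<le> \<epsilon>))" for \<epsilon> x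
  define A where "A t = {x \<in> carrier_vec m. x \<in> cube m u r \<and> \<not> N (1 / t) x}" for t
  have defA: "def_family M m A"
    unfolding def_family_def A_def mem_Collect_eq N_def
    by (rule def_intros def_pred_carrier def_pred_mem_cube def_vec_const[OF u(1)] def_fun_app[OF h])+
  have N_mono: "N \<epsilon> x \<Longrightarrow> \<epsilon> \<le> \<epsilon>' \<Longrightarrow> N \<epsilon>' x" for \<epsilon> \<epsilon>' x
    unfolding N_def by (meson order_trans)
  have monoA: "A s \<subseteq> A t" if st: "0 < s" "s \<le> t" for s t
  proof -
    have "1 / t \<le> 1 / s" using st by (simp add: frac_le)
    then show ?thesis unfolding A_def using N_mono by blast
  qed
  have ndA: "nowhere_dense_cubes m (A t)" if t: "t > 0" for t
  proof (rule nowhere_dense_cubesI_dense)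
    fix x0 r0 assume x0: "x0 \<in> carrier_vec m" "r0 > 0" "dense_in_cube m (A t) x0 r0"
    have "A t \<subseteq> cube m u r" unfolding A_def by blast
    then obtain y s where y: "y \<in> carrier_vec m" "s > 0" "cube m y s \<subseteq> cube m x0 r0" "cube m y s \<subseteq> cube m u r"
        "dense_in_cube m (A t) y s"
      using x0(3,1,2) by (rule dense_subcube)
    have "1 / t > 0" using t by simp
    from osc[OF y(1,2,4) this] obtain v s' where v: "v \<in> carrier_vec m" "s' > 0" "cube m v s' \<subseteq> cube m y s"
      "\<forall>y\<in>cube m v s'. \<forall>z\<in>cube m v s'. \<bar>h y - h z\<bar> \<le> 1 / t" by blast
    obtain x where x: "x \<in> cube m v s'" "x \<in> A t" by (rule dense_in_cube_meets[OF y(5) v(1-3)])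
    obtain \<rho> where rho: "\<rho> > 0" "cube m x \<rho> \<subseteq> cube m v s'" by (rule cube_open[OF x(1)])
    have "\<forall>y\<in>carrier_vec m. y \<in> cube m x \<rho> \<longrightarrow> \<bar>h y - h x\<bar> \<le> 1 / t" using v(4) x(1) rho(2) by blast
    then have "N (1 / t) x" unfolding N_def using rho(1) by blast
    then show False using x(2) unfolding A_def by blast
  qed
  have "nowhere_dense_cubes m {x. \<exists>t>0. x \<in> A t}" by (rule increasing_union[OF defA ndA monoA])
  then obtain v s where v: "v \<in> carrier_vec m" "s > 0" "cube m v s \<subseteq> cube m u r"
      "cube m v s \<inter> {x. \<exists>t>0. x \<in> A t} = {}"
    using u by (rule nowhere_dense_cubesD)
  have "cont_at m h x" if x: "x \<in> cube m v s" for x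
    unfolding cont_at_def
  proof (intro allI impI)
    fix \<epsilon> :: 'a assume eps: "\<epsilon> > 0"
    define t where "t = 2 / \<epsilon>"
    have t: "t > 0" "1 / t = \<epsilon> / 2" unfolding t_def using eps by simp_all
    have "x \<notin> A t" using v(4) x t(1) by blast
    then have "N (\<epsilon> / 2) x" unfolding A_def t(2) using cube_carrier[OF x] x v(3) by blast
    then obtain \<delta> where d: "0 < \<delta>" "\<forall>y\<in>carrier_vec m. y \<in> cube m x \<delta> \<longrightarrow> \<bar>h y - h x\<bar> \<le> \<epsilon> / 2"
      unfolding N_def by blast
    have "\<bar>h y - h x\<bar> < \<epsilon>" if "y \<in> cube m x \<delta>" for y
    proof -
      have "\<bar>h y - h x\<bar> \<le> \<epsilon> / 2" using d(2) that cube_carrier by blast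
      moreover have "\<epsilon> / 2 < \<epsilon>" using eps by simp
      ultimately show ?thesis by (rule le_less_trans)
    qed
    then show "\<exists>\<delta>>0. \<forall>y\<in>cube m x \<delta>. \<bar>h y - h x\<bar> < \<epsilon>" using d(1) by blast
  qed
  then show ?thesis using that[OF v(1-3)] by blast
qed

text \<open>The oscillation is small near a point with an almost maximal local lower bound.\<close>

lemma lower_semicontinuous_subcube:
  assumes h: "def_fun M m h" and u: "u \<in> carrier_vec m" "r > 0"
    and bdd: "\<And>y. y \<in> cube m u r \<Longrightarrow> lo \<le> h y \<and> h y \<le> hi"
    and C: "\<And>c. closed_cubes m (C c)" "\<And>y c. y \<in> cube m u r \<Longrightarrow> h y \<le> c \<longleftrightarrow> y \<in> C c"
  obtains v s where "v \<in> carrier_vec m" "s > 0" "cube m v s \<subseteq> cube m u r" "\<forall>y\<in>cube m v s. cont_at m h y"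
proof (rule continuous_on_subcube[OF h u])
  fix x0 :: "'a vec" and r0 \<epsilon> :: 'a
  assume x0: "x0 \<in> carrier_vec m" "r0 > 0" "cube m x0 r0 \<subseteq> cube m u r" and eps: "\<epsilon> > 0"
  define P where "P q \<longleftrightarrow> (\<exists>v\<in>carrier_vec m. \<exists>s. 0 < s \<and> (\<forall>y\<in>carrier_vec m. y \<in> cube m v s \<longrightarrow> y \<in> cube m x0 r0) \<and>
      (\<forall>y\<in>carrier_vec m. y \<in> cube m v s \<longrightarrow> q \<le> h y))" for q
  have PI: "P q" if "v \<in> carrier_vec m" "0 < s" "cube m v s \<subseteq> cube m x0 r0" "\<forall>y\<in>cube m v s. q \<le> h y" for q v s
    unfolding P_def using that by blast
  have PE: "\<exists>v s. v \<in> carrier_vec m \<and> 0 < s \<and> cube m v s \<subseteq> cube m x0 r0 \<and> (\<forall>y\<in>cube m v s. q \<le> h y)" if Pq: "P q" for q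
    using Pq cube_carrier unfolding P_def by (meson subsetI)
  have "def_pred M (\<lambda>e. P (e 0))"
    unfolding P_def by (rule def_intros def_pred_mem_cube def_vec_const[OF x0(1)] def_fun_app[OF h])+
  moreover have "P lo" using PI[OF x0(1,2) order_refl] bdd x0(3) by blast
  moreover have "\<forall>q. P q \<longrightarrow> q \<le> hi"
  proof (intro allI impI)
    fix q assume "P q"
    then obtain v s where v: "v \<in> carrier_vec m" "0 < s" "cube m v s \<subseteq> cube m x0 r0" "\<forall>y\<in>cube m v s. q \<le> h y"
      using PE by blast
    have c: "v \<in> cube m v s" by (rule center_in_cube[OF v(1,2)])
    have "q \<le> h v" using v(4) c by blast
    also have "h v \<le> hi" using bdd c v(3) x0(3) by blast
    finally show "q \<le> hi" .
  qed
  ultimately obtain \<sigma> where sigma: "\<forall>q. P q \<longrightarrow> q \<le> \<sigma>" "\<forall>t<\<sigma>. \<exists>q. P q \<and> t < q"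
    by (rule def_sup)
  have "\<sigma> - \<epsilon> / 2 < \<sigma>" using eps by simp
  then obtain q where q: "P q" "\<sigma> - \<epsilon> / 2 < q" using sigma(2) by blast
  obtain v s where v: "v \<in> carrier_vec m" "0 < s" "cube m v s \<subseteq> cube m x0 r0" "\<forall>y\<in>cube m v s. q \<le> h y"
    using PE[OF q(1)] by blast
  have "\<not> \<sigma> + \<epsilon> / 2 \<le> \<sigma>" using eps by simp
  then have nP: "\<not> P (\<sigma> + \<epsilon> / 2)" using sigma(1) by blast
  \<comment> \<open>No subcube has the lower bound \<open>\<sigma> + \<epsilon> / 2\<close>, so this
    sublevel set is dense, and being closed it contains the cube. Together with the lower bound
    \<open>q\<close> this confines \<open>h\<close> to a window of length
    \<open>\<epsilon>\<close>.\<close>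
  have "dense_in_cube m (C (\<sigma> + \<epsilon> / 2)) v s"
    unfolding dense_in_cube_def
  proof (intro ballI allI impI)
    fix y t assume y: "y \<in> carrier_vec m" "(t::'a) > 0" "cube m y t \<subseteq> cube m v s"
    have "cube m y t \<subseteq> cube m x0 r0" using y(3) v(3) by blast
    then have "\<not> (\<forall>z\<in>cube m y t. \<sigma> + \<epsilon> / 2 \<le> h z)" using PI[OF y(1,2)] nP by blast
    then obtain z where z: "z \<in> cube m y t" "\<not> \<sigma> + \<epsilon> / 2 \<le> h z" by blast
    then have "z \<in> C (\<sigma> + \<epsilon> / 2)" using C(2)[of z "\<sigma> + \<epsilon> / 2"] y(3) v(3) x0(3) by (meson not_le order.strict_implies_order subsetD)
    then show "cube m y t \<inter> C (\<sigma> + \<epsilon> / 2) \<noteq> {}" using z(1) by blast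
  qed
  then have sub: "cube m v s \<subseteq> C (\<sigma> + \<epsilon> / 2)" by (rule closed_dense_contains_cube[OF C(1)])
  have "\<bar>h y - h z\<bar> \<le> \<epsilon>" if "y \<in> cube m v s" "z \<in> cube m v s" for y z
  proof -
    have *: "q \<le> h x" "h x \<le> \<sigma> + \<epsilon> / 2" if x: "x \<in> cube m v s" for x
    proof -
      show "q \<le> h x" using v(4) x by blast
      have "x \<in> cube m u r" using x v(3) x0(3) by blast
      then show "h x \<le> \<sigma> + \<epsilon> / 2" using C(2) sub x by blast
    qed
    show ?thesis using *[OF that(1)] *[OF that(2)] q(2) unfolding abs_le_iff by linarith
  qed
  then show "\<exists>v\<in>carrier_vec m. \<exists>s>0. cube m v s \<subseteq> cube m x0 r0 \<and>
      (\<forall>y\<in>cube m v s. \<forall>z\<in>cube m v s. \<bar>h y - h z\<bar> \<le> \<epsilon>)"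
    using v(1-3) by blast
qed (rule that)

text \<open>Definable choice by the least element of a closed bounded fibre. Its sublevel sets are
  projections of \<open>B\<close> along the interval from \<open>lo\<close> to
  \<open>min c hi\<close> and hence closed, so the choice is lower semicontinuous.\<close>

lemma continuous_minimum:
  assumes B: "def_set M (Suc m) B" "closed_cubes (Suc m) B" and u: "u \<in> carrier_vec m" "r > 0"
    and ex: "\<And>y. y \<in> cube m u r \<Longrightarrow> \<exists>w. lo \<le> w \<and> w \<le> hi \<and> vCons w y \<in> B"
  obtains h v s where "def_fun M m h" "v \<in> carrier_vec m" "s > 0" "cube m v s \<subseteq> cube m u r"
    "\<forall>y\<in>cube m v s. cont_at m h y" "\<forall>y\<in>cube m v s. vCons (h y) y \<in> B"
proof -
  define least where "least w y \<longleftrightarrow> lo \<le> w \<and> w \<le> hi \<and> vCons w y \<in> B \<and>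
      (\<forall>w'. lo \<le> w' \<longrightarrow> w' \<le> hi \<longrightarrow> vCons w' y \<in> B \<longrightarrow> w \<le> w')" for w y
  define h where "h y = (if y \<in> cube m u r then (THE w. least w y) else 0)" for y
  have least_unique: "w = w'" if "least w y" "least w' y" for w w' y
    using that unfolding least_def by (meson antisym)
  have least_ex: "\<exists>w. least w y" if y: "y \<in> cube m u r" for y
  proof -
    have yc: "y \<in> carrier_vec m" by (rule cube_carrier[OF y])
    define X where "X = {w. lo \<le> w \<and> w \<le> hi \<and> vCons w y \<in> B}"
    have "def_pred M (\<lambda>e. e 0 \<in> X)"
      unfolding X_def mem_Collect_eq by (rule def_intros def_set_mem[OF B(1)] def_vec_const[OF yc])+
    moreover obtain a where "a \<in> X" using ex[OF y] unfolding X_def by blast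
    moreover have "\<forall>w. w \<in> X \<longrightarrow> lo \<le> w" unfolding X_def by blast
    ultimately obtain s where s: "\<forall>x. x \<in> X \<longrightarrow> s \<le> x" "\<forall>t>s. \<exists>x. x \<in> X \<and> x < t" by (rule def_inf)
    have "closed_ivl X" unfolding X_def by (rule closed_fibre_ivl[OF B(2) yc])
    then have "s \<in> X" by (rule closed_inf_mem) (use s in blast)
    then have "least s y" using s(1) unfolding least_def X_def by blast
    then show ?thesis by blast
  qed
  have least_h: "least (h y) y" if y: "y \<in> cube m u r" for y
  proof -
    obtain w where w: "least w y" using least_ex[OF y] by blast
    then have "h y = w" unfolding h_def using y least_unique by (simp add: the_equality)
    then show ?thesis using w by simp
  qed
  have h_eq: "t = h y \<longleftrightarrow> (y \<in> cube m u r \<and> least t y) \<or> (\<not> y \<in> cube m u r \<and> t = 0)" for t y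
    using least_h[of y] least_unique unfolding h_def by auto
  have "def_fun M m h"
    unfolding def_fun_def
  proof (rule def_termI)
    have "def_pred M (\<lambda>e. (vec m (\<lambda>i. e (Suc i)) \<in> cube m u r \<and> least (e 0) (vec m (\<lambda>i. e (Suc i)))) \<or>
        (\<not> vec m (\<lambda>i. e (Suc i)) \<in> cube m u r \<and> e 0 = 0))"
      unfolding least_def by (rule def_intros def_pred_mem_cube def_set_mem[OF B(1)] def_vec_const[OF u(1)])+
    then show "def_pred M (\<lambda>e. e 0 = h (vec m (\<lambda>i. e (Suc i))))" by (simp only: h_eq)
  qed
  moreover obtain v s where "v \<in> carrier_vec m" "s > 0" "cube m v s \<subseteq> cube m u r" "\<forall>y\<in>cube m v s. cont_at m h y"
  proof (rule lower_semicontinuous_subcube[OF \<open>def_fun M m h\<close> u])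
    show "lo \<le> h y \<and> h y \<le> hi" if "y \<in> cube m u r" for y using least_h[OF that] unfolding least_def by blast
    show "closed_cubes m {y \<in> carrier_vec m. \<exists>w. lo \<le> w \<and> w \<le> min c hi \<and> vCons w y \<in> B}" for c
      by (rule closed_projection_step[OF B])
    show "h y \<le> c \<longleftrightarrow> y \<in> {y \<in> carrier_vec m. \<exists>w. lo \<le> w \<and> w \<le> min c hi \<and> vCons w y \<in> B}"
      if y: "y \<in> cube m u r" for y c
    proof
      assume "h y \<le> c"
      then show "y \<in> {y \<in> carrier_vec m. \<exists>w. lo \<le> w \<and> w \<le> min c hi \<and> vCons w y \<in> B}"
        using least_h[OF y] cube_carrier[OF y] unfolding least_def by auto
    next
      assume "y \<in> {y \<in> carrier_vec m. \<exists>w. lo \<le> w \<and> w \<le> min c hi \<and> vCons w y \<in> B}"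
      then obtain w where "lo \<le> w" "w \<le> c" "w \<le> hi" "vCons w y \<in> B" by auto
      then show "h y \<le> c" using least_h[OF y] unfolding least_def by (meson order_trans)
    qed
  qed (rule that)
  moreover have "\<forall>y\<in>cube m v s. vCons (h y) y \<in> B" if "cube m v s \<subseteq> cube m u r" for v s
    using that least_h unfolding least_def by blast
  ultimately show ?thesis using that by blast
qed

text \<open>The coordinates of the selection are chosen one after the other, the last one first. A choice
  is continuous only on a smaller cube; passing to a closed cube keeps the remaining set closed.\<close>

lemma continuous_selection:
  assumes "def_set M (k + m) A" "closed_cubes (k + m) A" "u \<in> carrier_vec m" "r > 0"
    and "\<And>y. y \<in> cube m u r \<Longrightarrow> \<exists>x\<in>carrier_vec k. (\<forall>i<k. - t \<le> x $ i \<and> x $ i \<le> t) \<and> x @\<^sub>v y \<in> A"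
  shows "\<exists>v\<in>carrier_vec m. \<exists>s>0. \<exists>H. cube m v s \<subseteq> cube m u r \<and> (\<forall>i<k. def_fun M m (H i)) \<and>
    (\<forall>i<k. \<forall>y\<in>cube m v s. cont_at m (H i) y) \<and> (\<forall>y\<in>cube m v s. vec k (\<lambda>i. H i y) @\<^sub>v y \<in> A)"
  using assms
proof (induction k arbitrary: A u r)
  case 0
  have "vec 0 (\<lambda>i. (0::'a)) @\<^sub>v y \<in> A" if y: "y \<in> cube m u r" for y
    using 0(5)[OF y] by (auto simp: empty_append)
  then show ?case using 0(3,4) by (intro bexI[of _ u] exI[of _ r] exI[of _ "\<lambda>_ _. 0"] conjI) simp_all
next
  case (Suc k)
  have A: "def_set M (k + Suc m) A" "closed_cubes (k + Suc m) A" using Suc.prems(1,2) by simp_all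
  define B where "B = {z \<in> carrier_vec (Suc m). \<exists>x\<in>carrier_vec k. (\<forall>i<k. - t \<le> x $ i \<and> x $ i \<le> t) \<and> x @\<^sub>v z \<in> A}"
  have defB: "def_set M (Suc m) B"
    unfolding def_set_def B_def mem_Collect_eq
    by (rule def_intros def_pred_carrier def_set_mem[OF A(1)] | assumption)+
  have closedB: "closed_cubes (Suc m) B" unfolding B_def by (rule closed_projection[OF A])
  have exB: "\<exists>w. - t \<le> w \<and> w \<le> t \<and> vCons w y \<in> B" if y: "y \<in> cube m u r" for y
  proof -
    obtain x where x: "x \<in> carrier_vec (Suc k)" "\<forall>i<Suc k. - t \<le> x $ i \<and> x $ i \<le> t" "x @\<^sub>v y \<in> A"
      using Suc.prems(5)[OF y] by blast
    have "slice 0 k x @\<^sub>v vCons (x $ k) y \<in> A" using x(3) unfolding append_slices[OF x(1)] .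
    moreover have "\<forall>i<k. - t \<le> slice 0 k x $ i \<and> slice 0 k x $ i \<le> t" using x(2) by simp
    moreover have "vCons (x $ k) y \<in> carrier_vec (Suc m)" using cube_carrier[OF y] by simp
    ultimately have "vCons (x $ k) y \<in> B" unfolding B_def using slice_carrier by blast
    then show ?thesis using x(2) by blast
  qed
  obtain h v s where h: "def_fun M m h" and v: "v \<in> carrier_vec m" "s > 0" "cube m v s \<subseteq> cube m u r"
    and h_cont: "\<forall>y\<in>cube m v s. cont_at m h y" and hB: "\<forall>y\<in>cube m v s. vCons (h y) y \<in> B"
    by (rule continuous_minimum[OF defB closedB Suc.prems(3,4) exB])
  \<comment> \<open>\<open>p\<close> inserts the chosen coordinate between the remaining ones and
    \<open>y\<close>, which turns a point for the induction hypothesis into a candidate for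
    \<open>A\<close>.\<close>
  define p where "p z = slice 0 k z @\<^sub>v vCons (h (slice k m z)) (slice k m z)" for z
  have pc: "p z \<in> carrier_vec (k + Suc m)" for z unfolding p_def by (intro append_carrier_vec) simp_all
  \<comment> \<open>Half the radius leaves room: a point that satisfies the non-strict bound lies in
    the open cube on which \<open>h\<close> is continuous.\<close>
  define A' where "A' = {z \<in> carrier_vec (k + m). (\<forall>i<m. \<bar>z $ (k + i) - v $ i\<bar> \<le> s / 2) \<and> p z \<in> A}"
  have "def_set M (k + m) A'"
    unfolding def_set_def A'_def mem_Collect_eq p_def
    by (rule def_intros def_pred_carrier def_set_mem[OF A(1)] def_fun_app[OF h] def_vec_slice def_vec_const[OF v(1)] | assumption | simp)+
  moreover have "closed_cubes (k + m) A'"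
    unfolding closed_cubes_def
  proof
    fix z assume z: "z \<in> carrier_vec (k + m) - A'"
    show "\<exists>\<rho>>0. cube (k + m) z \<rho> \<inter> A' = {}"
    proof (cases "\<forall>i<m. \<bar>z $ (k + i) - v $ i\<bar> \<le> s / 2")
      case False
      then obtain i where i: "i < m" "s / 2 < \<bar>z $ (k + i) - v $ i\<bar>" by auto
      define \<rho> where "\<rho> = \<bar>z $ (k + i) - v $ i\<bar> - s / 2"
      have "y \<notin> A'" if y: "y \<in> cube (k + m) z \<rho>" for y
      proof -
        have "\<bar>y $ (k + i) - z $ (k + i)\<bar> < \<rho>" by (rule cube_center_radius[OF y]) (use i(1) in simp)
        moreover have "\<bar>z $ (k + i) - v $ i\<bar> \<le> \<bar>y $ (k + i) - z $ (k + i)\<bar> + \<bar>y $ (k + i) - v $ i\<bar>"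
          by (simp add: abs_if)
        ultimately have "s / 2 < \<bar>y $ (k + i) - v $ i\<bar>" unfolding \<rho>_def by linarith
        then show ?thesis unfolding A'_def using i(1) by (auto simp: not_le)
      qed
      moreover have "\<rho> > 0" unfolding \<rho>_def using i(2) by simp
      ultimately show ?thesis by blast
    next
      case True
      have "s / 2 < s" using v(2) by simp
      have "\<bar>slice k m z $ i - v $ i\<bar> < s" if i: "i < m" for i
        using le_less_trans[OF True[rule_format, OF i] \<open>s / 2 < s\<close>] i by simp
      then have zs: "slice k m z \<in> cube m v s" unfolding cube_def by simp
      have "p z \<notin> A" using z True unfolding A'_def by blast
      then obtain \<epsilon> where eps: "\<epsilon> > 0" "cube (k + Suc m) (p z) \<epsilon> \<inter> A = {}"
        using A(2) pc[of z] unfolding closed_cubes_def by blast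
      obtain \<delta> where d: "\<delta> > 0" "\<forall>y\<in>cube m (slice k m z) \<delta>. \<bar>h y - h (slice k m z)\<bar> < \<epsilon>"
        by (rule cont_atE[OF h_cont[rule_format, OF zs] eps(1)])
      have "y \<notin> A'" if y: "y \<in> cube (k + m) z (min \<epsilon> \<delta>)" for y
      proof -
        have y\<epsilon>: "\<bar>y $ i - z $ i\<bar> < \<epsilon>" if "i < k + m" for i
          using cube_center_radius[OF y that] by simp
        have "slice k m y \<in> cube m (slice k m z) (min \<epsilon> \<delta>)" by (rule slice_cube[OF y]) simp
        then have "slice k m y \<in> cube m (slice k m z) \<delta>" using cube_mono[of "min \<epsilon> \<delta>" \<delta> m] by auto
        then have hy: "\<bar>h (slice k m y) - h (slice k m z)\<bar> < \<epsilon>" using d(2) by blast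
        have "\<bar>p y $ i - p z $ i\<bar> < \<epsilon>" if i: "i < k + Suc m" for i
        proof -
          consider "i < k" | "i = k" | j where "i = Suc (k + j)" "j < m"
            using i by (metis add_Suc_right add_less_cancel_left less_imp_Suc_add linorder_neqE_nat Suc_less_eq)
          then show ?thesis using y\<epsilon> hy unfolding p_def by cases (auto simp: slice_def)
        qed
        then have "p y \<in> cube (k + Suc m) (p z) \<epsilon>" unfolding cube_def using pc by blast
        then show ?thesis using eps(2) unfolding A'_def by blast
      qed
      moreover have "min \<epsilon> \<delta> > 0" using eps(1) d(1) by simp
      ultimately show ?thesis by blast
    qed
  qed
  moreover have s2: "s / 2 > 0" "s / 2 \<le> s" using v(2) by simp_all
  moreover have "\<exists>x\<in>carrier_vec k. (\<forall>i<k. - t \<le> x $ i \<and> x $ i \<le> t) \<and> x @\<^sub>v y \<in> A'" if y: "y \<in> cube m v (s / 2)" for y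
  proof -
    have ys: "y \<in> cube m v s" using y cube_mono[OF s2(2)] by blast
    have yc: "y \<in> carrier_vec m" by (rule cube_carrier[OF y])
    obtain x where x: "x \<in> carrier_vec k" "\<forall>i<k. - t \<le> x $ i \<and> x $ i \<le> t" "x @\<^sub>v vCons (h y) y \<in> A"
      using hB ys unfolding B_def by blast
    have "p (x @\<^sub>v y) \<in> A" unfolding p_def slice_append_left[OF x(1)] slice_append_right[OF x(1) yc] by (rule x(3))
    moreover have "\<bar>(x @\<^sub>v y) $ (k + i) - v $ i\<bar> \<le> s / 2" if i: "i < m" for i
      using cube_center_radius[OF y i] x(1) yc i by simp
    moreover have "x @\<^sub>v y \<in> carrier_vec (k + m)" by (rule append_carrier_vec[OF x(1) yc])
    ultimately have "x @\<^sub>v y \<in> A'" unfolding A'_def by blast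
    then show ?thesis using x(1,2) by blast
  qed
  ultimately obtain v' s' H where v': "v' \<in> carrier_vec m" "s' > 0" "cube m v' s' \<subseteq> cube m v (s / 2)"
    and H: "\<forall>i<k. def_fun M m (H i)" "\<forall>i<k. \<forall>y\<in>cube m v' s'. cont_at m (H i) y"
      "\<forall>y\<in>cube m v' s'. vec k (\<lambda>i. H i y) @\<^sub>v y \<in> A'"
    using Suc.IH[of A' v "s / 2"] v(1) by blast
  define H' where "H' i = (if i < k then H i else h)" for i
  have sub: "cube m v' s' \<subseteq> cube m v s" using v'(3) cube_mono[OF s2(2)] by blast
  have "vec (Suc k) (\<lambda>i. H' i y) @\<^sub>v y \<in> A" if y: "y \<in> cube m v' s'" for y
  proof -
    have yc: "y \<in> carrier_vec m" by (rule cube_carrier[OF y])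
    have vk: "vec k (\<lambda>i. H i y) \<in> carrier_vec k" by simp
    have "p (vec k (\<lambda>i. H i y) @\<^sub>v y) \<in> A" using H(3) y unfolding A'_def by blast
    then have "vec k (\<lambda>i. H i y) @\<^sub>v vCons (h y) y \<in> A"
      unfolding p_def slice_append_left[OF vk] slice_append_right[OF vk yc] .
    moreover have "slice 0 k (vec (Suc k) (\<lambda>i. H' i y)) = vec k (\<lambda>i. H i y)"
      unfolding slice_def H'_def by (rule eq_vecI) simp_all
    moreover have "vec (Suc k) (\<lambda>i. H' i y) $ k = h y" unfolding H'_def by simp
    ultimately show ?thesis using append_slices[of "vec (Suc k) (\<lambda>i. H' i y)" k y] by simp
  qed
  moreover have "\<forall>i<Suc k. def_fun M m (H' i)" unfolding H'_def using H(1) h by simp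
  moreover have "\<forall>i<Suc k. \<forall>y\<in>cube m v' s'. cont_at m (H' i) y"
    unfolding H'_def using H(2) h_cont sub by auto
  moreover have "cube m v' s' \<subseteq> cube m u r" using sub v(3) by blast
  ultimately show ?case using v'(1,2) by blast
qed

text \<open>One number \<open>s\<close> codes both the range of the steps and the Lipschitz constant
  \<open>1 / s\<close>. In this form the condition passes to smaller \<open>s\<close>, so that
  finitely many functions can share it. The bound itself is a two-sided slope bound on a
  subcube.\<close>

lemma locally_lipschitz_dense:
  assumes \<phi>: "def_fun M n \<phi>" and j: "j < n" and cont: "\<And>y. y \<in> cube n u r \<Longrightarrow> cont_at n \<phi> y"
  shows "dense_cubes_in n (cube n u r) {y. \<exists>s>0. \<forall>h. 0 < h \<and> h < s \<longrightarrow> s * \<bar>incr n \<phi> j y h\<bar> \<le> h}"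
  unfolding dense_cubes_in_def
proof (intro ballI allI impI)
  fix x0 r0 assume x0: "x0 \<in> carrier_vec n" "(r0::'a) > 0" "cube n x0 r0 \<subseteq> cube n u r"
  have cont0: "cont_at n \<phi> y" if "y \<in> cube n x0 r0" for y using cont x0(3) that by blast
  obtain a v s where v: "v \<in> carrier_vec n" "s > 0" "cube n v s \<subseteq> cube n x0 r0"
    "\<forall>x h. x \<in> cube n v s \<longrightarrow> shift n x j h \<in> cube n v s \<longrightarrow> 0 < h \<longrightarrow> incr n \<phi> j x h \<le> a * h"
    by (rule slope_bounded_above[OF \<phi> j x0(1,2) cont0])
  have cont1: "cont_at n \<phi> y" if "y \<in> cube n v s" for y using cont0 v(3) that by blast
  obtain b w t where w: "w \<in> carrier_vec n" "t > 0" "cube n w t \<subseteq> cube n v s"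
    "\<forall>x h. x \<in> cube n w t \<longrightarrow> shift n x j h \<in> cube n w t \<longrightarrow> 0 < h \<longrightarrow> b * h \<le> incr n \<phi> j x h"
    by (rule slope_bounded_below[OF \<phi> j v(1,2) cont1])
  define T where "T = \<bar>a\<bar> + \<bar>b\<bar> + 1"
  have T: "T > 0" "a \<le> T" "- T \<le> b" unfolding T_def by (auto simp: abs_if add_pos_nonneg)
  have "\<exists>s>0. \<forall>h. 0 < h \<and> h < s \<longrightarrow> s * \<bar>incr n \<phi> j y h\<bar> \<le> h" if y: "y \<in> cube n w t" for y
  proof -
    obtain \<rho> where rho: "\<rho> > 0" "cube n y \<rho> \<subseteq> cube n w t" by (rule cube_open[OF y])
    define \<sigma> where "\<sigma> = min \<rho> (1 / T)"
    have sigma: "\<sigma> > 0" "\<sigma> \<le> \<rho>" "\<sigma> \<le> 1 / T" unfolding \<sigma>_def using rho(1) T(1) by simp_all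
    have "\<sigma> * \<bar>incr n \<phi> j y h\<bar> \<le> h" if h: "0 < h" "h < \<sigma>" for h
    proof -
      have "shift n y j h \<in> cube n y \<rho>"
        by (rule shift_small_in_cube[OF cube_carrier[OF y] j]) (use h sigma(2) in simp)
      then have in_w: "shift n y j h \<in> cube n w t" using rho(2) by blast
      have "incr n \<phi> j y h \<le> a * h" using v(4) y in_w w(3) h(1) by blast
      also have "\<dots> \<le> T * h" using T(2) h(1) by (intro mult_right_mono) simp_all
      finally have 1: "incr n \<phi> j y h \<le> T * h" .
      have "- T * h \<le> b * h" using T(3) h(1) by (intro mult_right_mono) simp_all
      also have "\<dots> \<le> incr n \<phi> j y h" using w(4) y in_w h(1) by blast
      finally have "\<bar>incr n \<phi> j y h\<bar> \<le> T * h" using 1 by (simp add: abs_le_iff)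
      then have "\<sigma> * \<bar>incr n \<phi> j y h\<bar> \<le> 1 / T * (T * h)"
        using sigma T(1) by (intro mult_mono) simp_all
      then show ?thesis using T(1) by simp
    qed
    then show ?thesis using sigma(1) by blast
  qed
  then have "cube n w t \<subseteq> {y. \<exists>s>0. \<forall>h. 0 < h \<and> h < s \<longrightarrow> s * \<bar>incr n \<phi> j y h\<bar> \<le> h}" by blast
  moreover have "cube n w t \<subseteq> cube n x0 r0" using w(3) v(3) by blast
  ultimately show "\<exists>v\<in>carrier_vec n. \<exists>s>0. cube n v s \<subseteq> cube n x0 r0 \<and>
      cube n v s \<subseteq> {y. \<exists>s>0. \<forall>h. 0 < h \<and> h < s \<longrightarrow> s * \<bar>incr n \<phi> j y h\<bar> \<le> h}"
    using w(1,2) by blast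
qed

end

section \<open>Singular values\<close>

text \<open>Along the Lipschitz curve \<open>X\<close>, the function \<open>c \<bullet> f\<close> grows by \<open>h\<close>, but also by \<open>o(h)\<close> as \<open>c\<close>
  annihilates the differential.\<close>

lemma no_critical_lipschitz_section:
  fixes c :: "nat \<Rightarrow> 'a::linordered_field"
  assumes d: "has_differential n m f x0 A" and x0: "x0 \<in> carrier_vec n" "f x0 = y0" and y0: "y0 \<in> carrier_vec m"
    and c: "\<forall>j<n. (\<Sum>i<m. c i * A $$ (i, j)) = 0" "k < m" "c k = 1" and "s > 0"
    and X: "\<And>h. 0 < h \<Longrightarrow> h < s \<Longrightarrow> X h \<in> carrier_vec n \<and> f (X h) = shift m y0 k h \<and>
      (\<forall>l<n. s * \<bar>X h $ l - x0 $ l\<bar> \<le> h)"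
  shows False
proof -
  define V where "V = (\<Sum>i<m. \<bar>c i\<bar>)"
  have V: "V \<ge> 0" unfolding V_def by (rule sum_nonneg) simp
  \<comment> \<open>The errors, weighted with \<open>c\<close>, then add up to at most
    \<open>V * \<epsilon> * h / s\<close>, which is \<open>h * V / (2 * (V + 1))\<close> and less
    than \<open>h\<close>.\<close>
  define \<epsilon> where "\<epsilon> = s / (2 * (V + 1))"
  have eps: "\<epsilon> > 0" unfolding \<epsilon>_def using \<open>s > 0\<close> V by simp
  have fc: "f x0 \<in> carrier_vec m" using x0(2) y0 by simp
  obtain \<delta> where delta: "\<delta> > 0" "\<forall>y\<in>cube n x0 \<delta>. \<forall>i<m.
    \<bar>f y $ i - f x0 $ i - (\<Sum>j<n. A $$ (i, j) * (y $ j - x0 $ j))\<bar> \<le> \<epsilon> * max_norm (y - x0)"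
    by (rule has_differential_bound[OF d x0(1) fc eps])
  \<comment> \<open>Below \<open>s\<close> the point \<open>X h\<close> is available; below
    \<open>\<delta> * s\<close> it lies in the cube of radius \<open>\<delta>\<close>, as its
    coordinates move by at most \<open>h / s\<close>.\<close>
  define q where "q = min s (\<delta> * s)"
  define h where "h = q / 2"
  have "q > 0" unfolding q_def using \<open>s > 0\<close> delta(1) by simp
  then have "h > 0" "h < q" unfolding h_def by simp_all
  then have h: "h > 0" "h < s" "h < \<delta> * s" unfolding q_def by simp_all
  define x where "x = X h"
  have x: "x \<in> carrier_vec n" "f x = shift m y0 k h" "\<forall>l<n. s * \<bar>x $ l - x0 $ l\<bar> \<le> h"
    using X[OF h(1,2)] unfolding x_def by blast+
  have xl: "\<bar>x $ l - x0 $ l\<bar> \<le> h / s" if "l < n" for l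
    using x(3) that \<open>s > 0\<close> by (simp add: pos_le_divide_eq mult.commute)
  have "h / s < \<delta>" using h(3) \<open>s > 0\<close> by (simp add: pos_divide_less_eq)
  then have xd: "x \<in> cube n x0 \<delta>" unfolding cube_def using x(1) xl by (auto intro: le_less_trans)
  have "0 \<le> h / s" using h(1) \<open>s > 0\<close> by simp
  then have N: "max_norm (x - x0) \<le> h / s" unfolding max_norm_le_iff[OF \<open>0 \<le> h / s\<close>] using x0(1) xl by simp
  define w where "w i = f x $ i - f x0 $ i - (\<Sum>j<n. A $$ (i, j) * (x $ j - x0 $ j))" for i
  have w: "\<bar>w i\<bar> \<le> \<epsilon> * (h / s)" if "i < m" for i
  proof -
    have "\<bar>w i\<bar> \<le> \<epsilon> * max_norm (x - x0)" unfolding w_def using delta(2) xd that by blast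
    also have "\<dots> \<le> \<epsilon> * (h / s)" using N eps by (intro mult_left_mono) simp_all
    finally show ?thesis .
  qed
  \<comment> \<open>The linearization error is paired with \<open>c\<close>. The increment of
    \<open>f\<close> contributes \<open>h\<close> through coordinate \<open>k\<close>, and the
    linear part vanishes once the sums are exchanged.\<close>
  have "(\<Sum>i<m. c i * w i) = (\<Sum>i<m. c i * (f x $ i - f x0 $ i)) - (\<Sum>i<m. \<Sum>j<n. c i * A $$ (i, j) * (x $ j - x0 $ j))"
    unfolding w_def by (simp add: right_diff_distrib sum_subtractf sum_distrib_left mult.assoc)
  also have "(\<Sum>i<m. c i * (f x $ i - f x0 $ i)) = (\<Sum>i<m. if i = k then h else 0)"
    unfolding x(2) x0(2) using c(3) by (intro sum.cong) (auto simp: shift_index)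
  also have "\<dots> = h" using c(2) by simp
  also have "(\<Sum>i<m. \<Sum>j<n. c i * A $$ (i, j) * (x $ j - x0 $ j)) = (\<Sum>j<n. (\<Sum>i<m. c i * A $$ (i, j)) * (x $ j - x0 $ j))"
    unfolding sum_distrib_right by (rule sum.swap)
  also have "\<dots> = 0" using c(1) by simp
  finally have "h = (\<Sum>i<m. c i * w i)" by simp
  also have "\<dots> \<le> (\<Sum>i<m. \<bar>c i\<bar> * (\<epsilon> * (h / s)))"
  proof (rule sum_mono)
    fix i assume "i \<in> {..<m}"
    then have "\<bar>c i\<bar> * \<bar>w i\<bar> \<le> \<bar>c i\<bar> * (\<epsilon> * (h / s))" using w[of i] by (intro mult_left_mono) simp_all
    then show "c i * w i \<le> \<bar>c i\<bar> * (\<epsilon> * (h / s))"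
      using abs_ge_self[of "c i * w i"] by (simp add: abs_mult)
  qed
  also have "\<dots> = V * (\<epsilon> * (h / s))" unfolding V_def by (rule sum_distrib_right[symmetric])
  also have "\<epsilon> * (h / s) = h / (2 * (V + 1))" unfolding \<epsilon>_def using \<open>s > 0\<close> by simp
  finally have "h \<le> V * (h / (2 * (V + 1)))" .
  also have "\<dots> = h * (V / (2 * (V + 1)))" by simp
  also have "\<dots> < h * 1"
  proof (rule mult_strict_left_mono[OF _ h(1)])
    show "V / (2 * (V + 1)) < 1" using V by (simp add: divide_less_eq)
  qed
  finally show False by simp
qed

text \<open>A covector being nonzero is not a closed condition, whereas some coordinate being
  \<open>1\<close> is a finite union of closed conditions. Dividing by a nonzero coordinate passes
  from the one to the other.\<close>

lemma low_rank_normalized_kernel: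
  fixes A :: "'a::linordered_field mat"
  assumes "A \<in> carrier_mat m n" "vec_space.rank m A < m"
  obtains c k where "k < m" "c \<in> carrier_vec m" "c $ k = 1" "\<forall>j<n. (\<Sum>i<m. c $ i * A $$ (i, j)) = 0"
proof -
  obtain v where v: "v \<in> carrier_vec m" "v \<noteq> 0\<^sub>v m" "\<forall>j<n. (\<Sum>i<m. v $ i * A $$ (i, j)) = 0"
    by (rule low_rank_left_kernel[OF assms])
  have "\<exists>k<m. v $ k \<noteq> 0"
  proof (rule ccontr)
    assume "\<not> (\<exists>k<m. v $ k \<noteq> 0)"
    then have "v = 0\<^sub>v m" using v(1) by (intro eq_vecI) auto
    then show False using v(2) by simp
  qed
  then obtain k where k: "k < m" "v $ k \<noteq> 0" by blast
  define c where "c = vec m (\<lambda>i. v $ i / v $ k)"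
  have "(\<Sum>i<m. c $ i * A $$ (i, j)) = 0" if "j < n" for j
  proof -
    have "(\<Sum>i<m. c $ i * A $$ (i, j)) = (\<Sum>i<m. v $ i * A $$ (i, j)) / v $ k"
      unfolding sum_divide_distrib c_def by (rule sum.cong) simp_all
    then show ?thesis using v(3) that by simp
  qed
  moreover have "c $ k = 1" "c \<in> carrier_vec m" unfolding c_def using k by simp_all
  ultimately show ?thesis using that k(1) by blast
qed

lemma def_fun_component:
  assumes f: "definable_map M n m (carrier_vec n) f" and i: "i < m"
  shows "def_fun M n (\<lambda>x. f x $ i)"
  unfolding def_fun_def
proof (rule def_termI)
  define S where "S = (\<lambda>x. x @\<^sub>v f x) ` carrier_vec n"
  have S: "def_set M (n + m) S" and fc: "\<And>x. x \<in> carrier_vec n \<Longrightarrow> f x \<in> carrier_vec m"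
    using f unfolding definable_map_def definable_iff_def_set S_def by auto
  have eq: "t = f x $ i \<longleftrightarrow> (\<exists>y\<in>carrier_vec m. x @\<^sub>v y \<in> S \<and> t = y $ i)" if x: "x \<in> carrier_vec n" for t x
  proof
    assume "t = f x $ i"
    then show "\<exists>y\<in>carrier_vec m. x @\<^sub>v y \<in> S \<and> t = y $ i"
      unfolding S_def using x fc[OF x] by (intro bexI[of _ "f x"]) auto
  next
    assume "\<exists>y\<in>carrier_vec m. x @\<^sub>v y \<in> S \<and> t = y $ i"
    then obtain y x' where y: "y \<in> carrier_vec m" "t = y $ i" "x' \<in> carrier_vec n" "x @\<^sub>v y = x' @\<^sub>v f x'"
      unfolding S_def by auto
    have "x = x'" using arg_cong[OF y(4), of "slice 0 n"] unfolding slice_append_left[OF x] slice_append_left[OF y(3)] .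
    moreover have "y = f x'" using arg_cong[OF y(4), of "slice n m"]
      unfolding slice_append_right[OF x y(1)] slice_append_right[OF y(3) fc[OF y(3)]] .
    ultimately show "t = f x $ i" using y(2) by simp
  qed
  have "def_pred M (\<lambda>e. \<exists>y\<in>carrier_vec m. vec n (\<lambda>i. e (Suc i)) @\<^sub>v y \<in> S \<and> e 0 = y $ i)"
    by (rule def_intros def_set_mem[OF S] i)+
  then show "def_pred M (\<lambda>e. e 0 = f (vec n (\<lambda>i. e (Suc i))) $ i)"
    using eq[OF vec_carrier] by (simp only:)
qed

lemma open_cubes_carrier: "open_cubes n (carrier_vec n)"
  unfolding open_cubes_def using cube_carrier by (auto intro!: exI[of _ 1])

context restrained_expansion
begin

lemma nowhere_dense_singular_values:
  assumes f: "definable_map M n m (carrier_vec n) f" and C1: "Cp_on 1 n m (carrier_vec n) f"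
  shows "nowhere_dense_cubes m (singular_values n m f)"
proof -
  have fc: "f x \<in> carrier_vec m" if "x \<in> carrier_vec n" for x
    using f that unfolding definable_map_def by blast
  have deff: "def_fun M n (\<lambda>x. f x $ i)" if "i < m" for i by (rule def_fun_component[OF f that])
  obtain J where J: "\<forall>x\<in>carrier_vec n. has_differential n m f x (J x)"
    "\<forall>j<n. Cp_on 0 n m (carrier_vec n) (\<lambda>x. col (J x) j)" using C1 by auto
  have Jc: "J x \<in> carrier_mat m n" if "x \<in> carrier_vec n" for x
    using J(1) that unfolding has_differential_def by blast
  have dJ: "has_differential n m f x (J x)" if "x \<in> carrier_vec n" for x
    using J(1) that by blast
  have contf: "cont_at n (\<lambda>y. f y $ i) x" if "x \<in> carrier_vec n" "i < m" for x i
    by (rule has_differential_cont_at[OF dJ[OF that(1)] that(1) fc[OF that(1)] that(2)])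
  have contJ: "cont_at n (\<lambda>y. J y $$ (i, j)) x" if x: "x \<in> carrier_vec n" and ij: "i < m" "j < n" for x i j
  proof -
    have "cont_at n (\<lambda>y. col (J y) j $ i) x"
      using J(2) x ij unfolding Cp_on_0_iff[OF open_cubes_carrier] by blast
    moreover have "col (J y) j $ i = J y $$ (i, j)" if "y \<in> carrier_vec n" for y
      using Jc[OF that] ij by simp
    moreover from this x have "col (J x) j $ i = J x $$ (i, j)" by blast
    ultimately show ?thesis unfolding cont_at_def by (simp add: cube_def cong: conj_cong)
  qed
  \<comment> \<open>\<open>J\<close> stems from an existential quantifier in \<open>Cp_on\<close>
    and carries no definability of its own; its entries are recovered as the unique partial
    derivatives of \<open>f\<close>.\<close>
  have defJ: "def_fun M n (\<lambda>x. J x $$ (i, j))" if ij: "i < m" "j < n" for i j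
    unfolding def_fun_def
  proof (rule def_termI)
    have eq: "t = J x $$ (i, j) \<longleftrightarrow> partial_deriv n (\<lambda>y. f y $ i) j x t" if x: "x \<in> carrier_vec n" for t x
    proof
      have J': "partial_deriv n (\<lambda>y. f y $ i) j x (J x $$ (i, j))"
        by (rule has_differential_partial_deriv[OF dJ[OF x] x fc[OF x] ij])
      then show "t = J x $$ (i, j) \<Longrightarrow> partial_deriv n (\<lambda>y. f y $ i) j x t" by simp
      show "t = J x $$ (i, j)" if "partial_deriv n (\<lambda>y. f y $ i) j x t"
        using that J' by (rule partial_deriv_unique)
    qed
    have "def_pred M (\<lambda>e. partial_deriv n (\<lambda>y. f y $ i) j (vec n (\<lambda>i. e (Suc i))) (e 0))"
      by (rule def_partial_deriv[OF deff[OF ij(1)]] def_intros)+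
    then show "def_pred M (\<lambda>e. e 0 = J (vec n (\<lambda>i. e (Suc i))) $$ (i, j))"
      using eq[OF vec_carrier] by (simp only:)
  qed
  \<comment> \<open>A point \<open>w\<close> lists \<open>n\<close> coordinates of \<open>x\<close>,
    then \<open>m\<close> of the covector \<open>v\<close>, then \<open>m\<close> of
    \<open>y\<close>. The sets \<open>S1\<close>, \<open>S2\<close> and \<open>S3\<close> express
    componentwise \<open>f(x) = y\<close>, \<open>v J(x) = 0\<close> and
    \<open>v_i = 1\<close>.\<close>
  define N where "N = n + m + m"
  define S1 where "S1 i = {w \<in> carrier_vec N. f (slice 0 n w) $ i - w $ (n + m + i) = 0}" for i
  define S2 where "S2 j = {w \<in> carrier_vec N. (\<Sum>i<m. w $ (n + i) * J (slice 0 n w) $$ (i, j)) = 0}" for j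
  define S3 where "S3 i = {w \<in> carrier_vec N. w $ (n + i) - (1::'a) = 0}" for i
  define S where "S = {w \<in> carrier_vec N. \<forall>i<m. w \<in> S1 i} \<inter> ({w \<in> carrier_vec N. \<forall>j<n. w \<in> S2 j} \<inter>
      {w \<in> carrier_vec N. \<exists>i<m. w \<in> S3 i})"
  have "closed_cubes N S"
    unfolding S_def
  proof (intro closed_cubes_Int closed_cubes_all_less closed_cubes_ex_less)
    show "closed_cubes N (S1 i)" if i: "i < m" for i
      unfolding S1_def
    proof (intro closed_zero_set cont_at_diff cont_at_coord)
      show "cont_at N (\<lambda>y. f (slice 0 n y) $ i) x" for x
        by (rule cont_at_slice[where g = "\<lambda>x. f x $ i", OF contf[OF slice_carrier i]]) (simp add: N_def)
    qed (use i in \<open>simp add: N_def\<close>)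
    show "closed_cubes N (S2 j)" if j: "j < n" for j
      unfolding S2_def
    proof (intro closed_zero_set cont_at_sum cont_at_mult cont_at_coord)
      show "cont_at N (\<lambda>y. J (slice 0 n y) $$ (i, j)) x" if "i < m" for x i
        by (rule cont_at_slice[where g = "\<lambda>x. J x $$ (i, j)", OF contJ[OF slice_carrier that j]]) (simp add: N_def)
    qed (simp add: N_def)
    show "closed_cubes N (S3 i)" if i: "i < m" for i
      unfolding S3_def by (intro closed_zero_set cont_at_diff cont_at_coord cont_at_const) (use i in \<open>simp add: N_def\<close>)
  qed
  moreover have "def_set M N S"
    unfolding def_set_def S_def S1_def S2_def S3_def Int_iff mem_Collect_eq
    by (rule def_intros def_pred_carrier def_fun_app[OF deff] def_fun_app[OF defJ] def_vec_slice | assumption | simp add: N_def)+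
  ultimately have S: "def_set M (n + m + m) S" "closed_cubes (n + m + m) S" unfolding N_def by blast+
  have S_iff: "z @\<^sub>v y \<in> S \<longleftrightarrow> f (slice 0 n z) = y \<and> (\<forall>j<n. (\<Sum>i<m. z $ (n + i) * J (slice 0 n z) $$ (i, j)) = 0) \<and>
      (\<exists>i<m. z $ (n + i) = 1)"
    if z: "z \<in> carrier_vec (n + m)" and y: "y \<in> carrier_vec m" for z y
  proof -
    have zy: "z @\<^sub>v y \<in> carrier_vec N" unfolding N_def using z y by (rule append_carrier_vec)
    have s: "slice 0 n (z @\<^sub>v y) = slice 0 n z" unfolding slice_def using z y by (intro eq_vecI) simp_all
    have i: "(z @\<^sub>v y) $ (n + i) = z $ (n + i)" "(z @\<^sub>v y) $ (n + m + i) = y $ i" if "i < m" for i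
      using z y that by simp_all
    have "f (slice 0 n z) = y \<longleftrightarrow> (\<forall>i<m. f (slice 0 n z) $ i - y $ i = 0)"
      using fc[OF slice_carrier, of 0 z] y by (auto intro: eq_vecI)
    moreover have "(\<Sum>i<m. (z @\<^sub>v y) $ (n + i) * J (slice 0 n z) $$ (i, j)) =
        (\<Sum>i<m. z $ (n + i) * J (slice 0 n z) $$ (i, j))" for j
      using i(1) by (intro sum.cong) simp_all
    ultimately show ?thesis unfolding S_def S1_def S2_def S3_def using zy i by (simp add: s cong: conj_cong)
  qed
  define \<Sigma> where "\<Sigma> t = {y \<in> carrier_vec m. \<exists>z\<in>carrier_vec (n + m). (\<forall>i<n + m. - t \<le> z $ i \<and> z $ i \<le> t) \<and> z @\<^sub>v y \<in> S}" for t
  have def\<Sigma>: "def_family M m \<Sigma>"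
    unfolding def_family_def \<Sigma>_def mem_Collect_eq
    by (rule def_intros def_pred_carrier def_set_mem[OF S(1)] | assumption)+
  have mono\<Sigma>: "\<Sigma> s \<subseteq> \<Sigma> t" if "0 < s" "s \<le> t" for s t
  proof
    fix y assume "y \<in> \<Sigma> s"
    then obtain z where z: "y \<in> carrier_vec m" "z \<in> carrier_vec (n + m)" "\<forall>i<n + m. - s \<le> z $ i \<and> z $ i \<le> s" "z @\<^sub>v y \<in> S"
      unfolding \<Sigma>_def by blast
    have "\<forall>i<n + m. - t \<le> z $ i \<and> z $ i \<le> t"
    proof (intro allI impI)
      fix i assume "i < n + m"
      then have "- s \<le> z $ i" "z $ i \<le> s" using z(3) by blast+
      then show "- t \<le> z $ i \<and> z $ i \<le> t" using that(2) by simp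
    qed
    then show "y \<in> \<Sigma> t" unfolding \<Sigma>_def using z by blast
  qed
  have sing: "singular_values n m f \<subseteq> {y. \<exists>t>0. y \<in> \<Sigma> t}"
  proof
    fix y assume "y \<in> singular_values n m f"
    then obtain x A where x: "x \<in> carrier_vec n" "y = f x" "has_differential n m f x A" "vec_space.rank m A < m"
      unfolding singular_values_def by blast
    have A: "A = J x" using x(3) dJ[OF x(1)] x(1) fc[OF x(1)] by (rule has_differential_unique)
    obtain c k where c: "k < m" "c \<in> carrier_vec m" "c $ k = 1" "\<forall>j<n. (\<Sum>i<m. c $ i * J x $$ (i, j)) = 0"
      by (rule low_rank_normalized_kernel[OF Jc[OF x(1)] x(4)[unfolded A]])
    define z where "z = x @\<^sub>v c"
    have z: "z \<in> carrier_vec (n + m)" unfolding z_def using x(1) c(2) by (rule append_carrier_vec)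
    have zi: "z $ (n + i) = c $ i" if "i < m" for i unfolding z_def using x(1) c(2) that by simp
    have zx: "slice 0 n z = x" unfolding z_def by (rule slice_append_left[OF x(1)])
    have "z @\<^sub>v y \<in> S"
      unfolding S_iff[OF z fc[OF x(1), folded x(2)]] zx
      using x(2) c zi by (auto intro!: exI[of _ k] simp del: sum.lessThan_Suc) 
    moreover have "\<forall>i<n + m. - (max_norm z + 1) \<le> z $ i \<and> z $ i \<le> max_norm z + 1"
    proof (intro allI impI)
      fix i assume "i < n + m"
      then have "\<bar>z $ i\<bar> \<le> max_norm z" using z by (intro component_le_max_norm) simp
      then show "- (max_norm z + 1) \<le> z $ i \<and> z $ i \<le> max_norm z + 1" unfolding abs_le_iff by linarith
    qed
    moreover have "max_norm z + 1 > 0" using max_norm_nonneg[of z] by simp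
    ultimately show "y \<in> {y. \<exists>t>0. y \<in> \<Sigma> t}" unfolding \<Sigma>_def using z fc[OF x(1)] x(2) by blast
  qed
  have "nowhere_dense_cubes m (\<Sigma> t)" if "t > 0" for t
  proof (rule nowhere_dense_cubesI_dense)
    fix u r assume u: "u \<in> carrier_vec m" "r > 0" "dense_in_cube m (\<Sigma> t) u r"
    have "closed_cubes m (\<Sigma> t)" unfolding \<Sigma>_def by (rule closed_projection[OF S])
    then have "cube m u r \<subseteq> \<Sigma> t" using u(3) by (rule closed_dense_contains_cube)
    then have "\<exists>z\<in>carrier_vec (n + m). (\<forall>i<n + m. - t \<le> z $ i \<and> z $ i \<le> t) \<and> z @\<^sub>v y \<in> S" if "y \<in> cube m u r" for y
      using that unfolding \<Sigma>_def by blast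
    from continuous_selection[OF S u(1,2) this]
    obtain v s H where v: "v \<in> carrier_vec m" "s > 0" and H: "\<forall>i<n + m. def_fun M m (H i)"
      "\<forall>i<n + m. \<forall>y\<in>cube m v s. cont_at m (H i) y" "\<forall>y\<in>cube m v s. vec (n + m) (\<lambda>i. H i y) @\<^sub>v y \<in> S" by blast
    define Q where "Q i k s y \<longleftrightarrow> (\<forall>h. 0 < h \<and> h < s \<longrightarrow> s * \<bar>incr m (H i) k y h\<bar> \<le> h)" for i k s y
    define L where "L k i = {y. \<exists>s>0. Q i k s y}" for k i
    have "dense_cubes_in m (cube m v s) {y \<in> cube m v s. \<forall>i<n. y \<in> L k i}" if k: "k < m" for k
    proof (rule dense_cubes_in_all_less)
      fix i assume i: "i < n"
      then have i': "i < n + m" by simp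
      show "dense_cubes_in m (cube m v s) (L k i)" unfolding L_def Q_def
        by (rule locally_lipschitz_dense[OF H(1)[rule_format, OF i'] k H(2)[rule_format, OF i']])
    qed
    \<comment> \<open>All directions \<open>k\<close> are handled together: which coordinate of the
      covector equals \<open>1\<close> depends on the point and is known only after
      \<open>v'\<close> has been chosen.\<close>
    then have "dense_cubes_in m (cube m v s) {y \<in> cube m v s. \<forall>k<m. y \<in> {y \<in> cube m v s. \<forall>i<n. y \<in> L k i}}"
      by (rule dense_cubes_in_all_less)
    then obtain v' s' where v': "v' \<in> carrier_vec m" "s' > 0" "cube m v' s' \<subseteq> cube m v s"
        "cube m v' s' \<subseteq> {y \<in> cube m v s. \<forall>k<m. y \<in> {y \<in> cube m v s. \<forall>i<n. y \<in> L k i}}"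
      using v order_refl by (rule dense_cubes_inE)
    have v'L: "v' \<in> L k i" if "k < m" "i < n" for k i
      using v'(4) center_in_cube[OF v'(1,2)] that by blast
    define z where "z y = vec (n + m) (\<lambda>i. H i y)" for y
    have zc: "z y \<in> carrier_vec (n + m)" for y unfolding z_def by simp
    have zS: "f (slice 0 n (z y)) = y" "\<forall>j<n. (\<Sum>i<m. z y $ (n + i) * J (slice 0 n (z y)) $$ (i, j)) = 0"
      "\<exists>i<m. z y $ (n + i) = 1" if y: "y \<in> cube m v s" for y
    proof -
      have "z y @\<^sub>v y \<in> S" using H(3) y unfolding z_def by blast
      then show "f (slice 0 n (z y)) = y" "\<forall>j<n. (\<Sum>i<m. z y $ (n + i) * J (slice 0 n (z y)) $$ (i, j)) = 0"
        "\<exists>i<m. z y $ (n + i) = 1" using S_iff[OF zc cube_carrier[OF y]] by blast+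
    qed
    have v'c: "v' \<in> cube m v s" using v'(3) center_in_cube[OF v'(1,2)] by blast
    obtain k where k: "k < m" "z v' $ (n + k) = 1" using zS(3)[OF v'c] by blast
    have "\<exists>\<sigma>>0. \<forall>i<n. Q i k \<sigma> v'"
    proof (rule ex_pos_all_less)
      show "\<exists>\<sigma>>0. Q i k \<sigma> v'" if "i < n" for i using v'L[OF k(1) that] unfolding L_def by blast
      show "Q i k \<sigma>' v'" if "Q i k \<sigma> v'" "0 < \<sigma>'" "\<sigma>' \<le> \<sigma>" for i \<sigma> \<sigma>'
        unfolding Q_def
      proof (intro allI impI)
        fix h assume h: "0 < h \<and> h < \<sigma>'"
        have "\<sigma>' * \<bar>incr m (H i) k v' h\<bar> \<le> \<sigma> * \<bar>incr m (H i) k v' h\<bar>" using that(3) by (rule mult_right_mono) simp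
        also have "\<dots> \<le> h" using that(1,3) h unfolding Q_def by simp
        finally show "\<sigma>' * \<bar>incr m (H i) k v' h\<bar> \<le> h" .
      qed
    qed
    then obtain \<sigma> where sigma: "\<sigma> > 0" "\<forall>i<n. Q i k \<sigma> v'" by blast
    \<comment> \<open>Steps shorter than \<open>\<tau>\<close> stay in the cube over which the
      section is defined and within the range of the Lipschitz bounds.\<close>
    define \<tau> where "\<tau> = min \<sigma> s'"
    have tau: "\<tau> > 0" "\<tau> \<le> \<sigma>" "\<tau> \<le> s'" unfolding \<tau>_def using sigma(1) v'(2) by simp_all
    define X where "X h = slice 0 n (z (shift m v' k h))" for h
    define x0 where "x0 = slice 0 n (z v')"
    show False
    proof (rule no_critical_lipschitz_section[where c = "\<lambda>i. z v' $ (n + i)" and X = X])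
      show "has_differential n m f x0 (J x0)" using J(1) unfolding x0_def by simp
      show "x0 \<in> carrier_vec n" unfolding x0_def by simp
      show "f x0 = v'" unfolding x0_def by (rule zS(1)[OF v'c])
      show "v' \<in> carrier_vec m" by (rule v'(1))
      show "\<forall>j<n. (\<Sum>i<m. z v' $ (n + i) * J x0 $$ (i, j)) = 0" unfolding x0_def by (rule zS(2)[OF v'c])
      show "k < m" "z v' $ (n + k) = 1" by (rule k)+
      show "\<tau> > 0" by (rule tau(1))
      fix h assume h: "0 < h" "h < \<tau>"
      have "shift m v' k h \<in> cube m v' s'" by (rule shift_small_in_cube[OF v'(1) k(1)]) (use h tau(3) in simp)
      then have sh: "shift m v' k h \<in> cube m v s" using v'(3) by blast
      have "\<tau> * \<bar>X h $ l - x0 $ l\<bar> \<le> h" if l: "l < n" for l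
      proof -
        have "X h $ l - x0 $ l = incr m (H l) k v' h"
          unfolding X_def x0_def z_def incr_def using l by simp
        moreover have "\<sigma> * \<bar>incr m (H l) k v' h\<bar> \<le> h" using sigma(2) l h tau(2) unfolding Q_def by simp
        moreover have "\<tau> * \<bar>incr m (H l) k v' h\<bar> \<le> \<sigma> * \<bar>incr m (H l) k v' h\<bar>" using tau(2) by (rule mult_right_mono) simp
        ultimately show ?thesis by simp
      qed
      then show "X h \<in> carrier_vec n \<and> f (X h) = shift m v' k h \<and> (\<forall>l<n. \<tau> * \<bar>X h $ l - x0 $ l\<bar> \<le> h)"
        unfolding X_def using zS(1)[OF sh] by simp
    qed
  qed
  then have "nowhere_dense_cubes m {y. \<exists>t>0. y \<in> \<Sigma> t}" by (rule increasing_union[OF def\<Sigma> _ mono\<Sigma>])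
  then show ?thesis using sing by (rule nowhere_dense_cubes_subset)
qed

end

theorem theorem1p14:
  fixes M :: "('f, 'r, 'a::{linordered_field, linorder_topology}) expansion"
    and n m :: nat
    and f :: "'a vec \<Rightarrow> 'a vec"
  assumes "restrained M"
    and "definable_map M n m (carrier_vec n) f"
  shows "(continuous_map (vec_topology n) (vec_topology m) f \<longrightarrow>
           (\<forall>p. \<exists>D. definable M n D \<and> nowhere_dense_in (vec_topology n) D \<and>
                    Cp_outside p n m D f)) \<and>
         (Cp_on 1 n m (carrier_vec n) f \<longrightarrow>
           nowhere_dense_in (vec_topology m) (singular_values n m f))"
proof -
  interpret restrained_expansion M by unfold_locales (rule assms(1))
  have fc: "f x \<in> carrier_vec m" if "x \<in> carrier_vec n" for x
    using assms(2) that unfolding definable_map_def by blast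
  show ?thesis
  proof (intro conjI impI allI)
    fix p
    assume cont: "continuous_map (vec_topology n) (vec_topology m) f"
    have def_carrier: "def_set M n (carrier_vec n)"
      unfolding def_set_def by (rule def_pred_carrier def_intros)+
    have "Cp_on 0 n m (carrier_vec n) f"
      using cont continuous_map_from_subtopology[of "vec_topology n" "vec_topology m" f] by simp
    then obtain G where G: "def_set M n G" "G \<subseteq> carrier_vec n" "open_cubes n G"
        "dense_cubes_in n (carrier_vec n) G" "Cp_on p n m G f"
      using Cp_dense[OF def_carrier open_cubes_carrier def_fun_component[OF assms(2)]] by blast
    \<comment> \<open>\<open>G\<close> itself is the open set demanded by \<open>Cp_outside\<close>;
      its interior being dense makes the complement nowhere dense.\<close>
    define D where "D = carrier_vec n - G"
    have "definable M n D"
      unfolding definable_iff_def_set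
    proof
      show "D \<subseteq> carrier_vec n" unfolding D_def by blast
      show "def_set M n D" unfolding def_set_def D_def Diff_iff
        by (rule def_pred_carrier def_set_mem[OF G(1)] def_intros)+
    qed
    moreover have "nowhere_dense_in (vec_topology n) D"
      unfolding nowhere_dense_in_vec_topology
    proof
      show "D \<subseteq> carrier_vec n" unfolding D_def by blast
      show "nowhere_dense_cubes n D"
      proof (rule nowhere_dense_cubesI_dense)
        fix x r assume x: "x \<in> carrier_vec n" "r > 0" "dense_in_cube n D x r"
        have "cube n x r \<subseteq> carrier_vec n" using cube_carrier by blast
        with G(4) x(1,2) obtain v s where v: "v \<in> carrier_vec n" "s > 0" "cube n v s \<subseteq> cube n x r" "cube n v s \<subseteq> G"
          by (rule dense_cubes_inE)
        obtain z where "z \<in> cube n v s" "z \<in> D" by (rule dense_in_cube_meets[OF x(3) v(1-3)])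
        then show False using v(4) unfolding D_def by blast
      qed
    qed
    moreover have "Cp_outside p n m D f"
      unfolding Cp_outside_def openin_iff_open_cubes
    proof (intro exI conjI)
      show "open_cubes n G" by (rule G(3))
      show "carrier_vec n - D \<subseteq> G" unfolding D_def by blast
      show "Cp_on p n m G f" by (rule G(5))
    qed
    ultimately show "\<exists>D. definable M n D \<and> nowhere_dense_in (vec_topology n) D \<and> Cp_outside p n m D f"
      by blast
  next
    assume C1: "Cp_on 1 n m (carrier_vec n) f"
    have "singular_values n m f \<subseteq> carrier_vec m" unfolding singular_values_def using fc by blast
    then show "nowhere_dense_in (vec_topology m) (singular_values n m f)"
      unfolding nowhere_dense_in_vec_topology using nowhere_dense_singular_values[OF assms(2) C1] by blast
  qed
qed

end
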